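(* Let $X=(X_t)_{t\ge0}$ be an ergodic discrete-time birth-and-death chain on $\{0, \dots, d\}$ with kernel $P$ having nonnegative eigenvalues $0 \le \theta_0 \le \dots \le \theta_{d - 1} < \theta_d = 1$, and assume $X_0=0$. Let $\widehat{\Lambda}$ be the $(d+1)\times(d+1)$ matrix whose $k$th row ($0\le k\le d$) is row $0$ of $$Q_k := (1 - \theta_0)^{-1} \cdots (1 - \theta_{k-1})^{-1} (P - \theta_0 I) \cdots (P - \theta_{k-1} I),\qquad Q_0:=I.$$ Construct $\widehat{X}=(\widehat{X}_t)_{t\ge0}$ from $X$ and independent randomness as follows. Set $\widehat{X}_0=0$. For $t\ge1$, given $\widehat{X}_{t-1}=\hat{x}$ and $X_t=y$: if $\hat{x}=d$, set $\widehat{X}_t=d$; if $\hat{x}<d$ and $y\le\hat{x}$, set $\widehat{X}_t=\hat{x}+1$ with probability $$\frac{(1 - \theta_{\hat{x}})\, \widehat{\Lambda}(\hat{x} + 1, y)}{\theta_{\hat{x}}\, \widehat{\Lambda}(\hat{x}, y) + (1 - \theta_{\hat{x}})\, \widehat{\Lambda}(\hat{x} + 1, y)}$$ and $\widehat{X}_t=\hat{x}$ with the complementary probability (using randomness independent of everything else); if $y=\hat{x}+1$, set $\widehat{X}_t=\hat{x}+1$ with certainty. Then $\widehat{\Lambda}(\widehat{X}_t,X_t)>0$ (hence $X_t\le\widehat{X}_t$) for all $t$, so that these cases are exhaustive; $\widehat{X}$ is a Markov chain with the pure-birth kernel $\widehat{P}$ given by $\widehat{P}(i,i)=\theta_i$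 ($0\le i\le d$) and $\widehat{P}(i,i+1)=1-\theta_i$ ($0\le i\le d-1$); its absorption time $\widehat{T}$ in state $d$ is a fastest strong stationary time for $X$; and the waiting times between successive births of $\widehat{X}$ are independent geometric random variables, with failure probabilities $\theta_0,\dots,\theta_{d-1}$, whose sum is $\widehat{T}$.
   Context: A discrete-time birth-and-death chain on $\{0,\dots,d\}$ has a tridiagonal stochastic transition matrix. Ergodic means irreducible and aperiodic; let $\pi$ be the stationary distribution. Eigenvalues are listed with multiplicity. A geometric random variable with failure probability $\theta$ takes value $n\ge1$ with probability $\theta^{n-1}(1-\theta)$. A strong stationary time for $X$ is an a.s. finite randomized stopping time $T$ for $X$ (that is, a stopping time with respect to some filtration to which $X$ is adapted and with respect to which $X$ is Markov with kernel $P$) such that $X_T$ has distribution $\pi$ and is independent of $T$; it is fastest if it is stochastically minimal among all strong stationary times for the chain with kernel $P$ started at $0$. *)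

theory Defs
  imports "HOL-Probability.Probability" "Jordan_Normal_Form.Char_Poly"
begin

definition stochastic_kernel :: "nat \<Rightarrow> real mat \<Rightarrow> bool" where
  "stochastic_kernel d P \<longleftrightarrow> P \<in> carrier_mat (Suc d) (Suc d) \<and>
     (\<forall>i\<le>d. \<forall>j\<le>d. 0 \<le> P $$ (i, j)) \<and> (\<forall>i\<le>d. (\<Sum>j\<le>d. P $$ (i, j)) = 1)"

definition birth_death_kernel :: "nat \<Rightarrow> real mat \<Rightarrow> bool" where
  "birth_death_kernel d P \<longleftrightarrow> stochastic_kernel d P \<and>
     (\<forall>i\<le>d. \<forall>j\<le>d. Suc i < j \<or> Suc j < i \<longrightarrow> P $$ (i, j) = 0)"

definition irreducible_kernel :: "nat \<Rightarrow> real mat \<Rightarrow> bool" where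
  "irreducible_kernel d P \<longleftrightarrow> (\<forall>i\<le>d. \<forall>j\<le>d. \<exists>n. 0 < (P ^\<^sub>m n) $$ (i, j))"

definition aperiodic_kernel :: "nat \<Rightarrow> real mat \<Rightarrow> bool" where
  "aperiodic_kernel d P \<longleftrightarrow> (\<forall>i\<le>d. Gcd {n. 1 \<le> n \<and> 0 < (P ^\<^sub>m n) $$ (i, i)} = 1)"

definition ergodic_kernel :: "nat \<Rightarrow> real mat \<Rightarrow> bool" where
  "ergodic_kernel d P \<longleftrightarrow> irreducible_kernel d P \<and> aperiodic_kernel d P"

definition stationary_distribution :: "nat \<Rightarrow> real mat \<Rightarrow> (nat \<Rightarrow> real) \<Rightarrow> bool" where
  "stationary_distribution d P \<pi> \<longleftrightarrow> (\<forall>j\<le>d. 0 \<le> \<pi> j) \<and> (\<Sum>j\<le>d. \<pi> j) = 1 \<and>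
     (\<forall>j\<le>d. (\<Sum>i\<le>d. \<pi> i * P $$ (i, j)) = \<pi> j)"

text \<open>Eigenvalues are counted with algebraic multiplicity.\<close>

definition eigenvalue_list :: "nat \<Rightarrow> real mat \<Rightarrow> (nat \<Rightarrow> real) \<Rightarrow> bool" where
  "eigenvalue_list d P \<theta> \<longleftrightarrow> char_poly P = (\<Prod>i\<le>d. [:- \<theta> i, 1:])"

definition markov_chain :: "'a measure \<Rightarrow> nat \<Rightarrow> real mat \<Rightarrow> (nat \<Rightarrow> 'a \<Rightarrow> nat) \<Rightarrow> bool" where
  "markov_chain M d K Z \<longleftrightarrow>
     (\<forall>t. Z t \<in> M \<rightarrow>\<^sub>M count_space {..d}) \<and>
     (\<forall>t z. \<forall>j\<le>d. 0 < \<P>(\<omega> in M. \<forall>s\<le>t. Z s \<omega> = z s) \<longrightarrow>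
        \<P>(\<omega> in M. Z (Suc t) \<omega> = j \<bar> \<forall>s\<le>t. Z s \<omega> = z s) = K $$ (z t, j))"

definition markov_chain_wrt ::
  "'a measure \<Rightarrow> (nat \<Rightarrow> 'a measure) \<Rightarrow> nat \<Rightarrow> real mat \<Rightarrow> (nat \<Rightarrow> 'a \<Rightarrow> nat) \<Rightarrow> bool" where
  "markov_chain_wrt M F d K Z \<longleftrightarrow>
     filtration (space M) F \<and> (\<forall>t. subalgebra M (F t)) \<and>
     (\<forall>t. Z t \<in> F t \<rightarrow>\<^sub>M count_space {..d}) \<and>
     (\<forall>t. \<forall>j\<le>d. AE \<omega> in M.
        real_cond_exp M (F t) (indicat_real {\<omega> \<in> space M. Z (Suc t) \<omega> = j}) \<omega> = K $$ (Z t \<omega>, j))"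

text \<open>Random times take values in \<open>enat\<close>, so that a time may be infinite on a null event.
  The value of \<open>X\<close> at time \<open>T\<close> is only meaningful where \<open>T\<close> is finite.\<close>

definition strong_stationary_time ::
  "'a measure \<Rightarrow> nat \<Rightarrow> real mat \<Rightarrow> (nat \<Rightarrow> real) \<Rightarrow> (nat \<Rightarrow> 'a \<Rightarrow> nat) \<Rightarrow> ('a \<Rightarrow> enat) \<Rightarrow> bool" where
  "strong_stationary_time M d P \<pi> X T \<longleftrightarrow>
     (\<exists>F. markov_chain_wrt M F d P X \<and> (\<forall>t. Measurable.pred (F t) (\<lambda>\<omega>. T \<omega> \<le> enat t))) \<and>
     (AE \<omega> in M. T \<omega> < \<infinity>) \<and>
     (\<forall>j\<le>d. \<P>(\<omega> in M. X (the_enat (T \<omega>)) \<omega> = j) = \<pi> j) \<and>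
     prob_space.indep_var M (count_space UNIV) (\<lambda>\<omega>. X (the_enat (T \<omega>)) \<omega>) (count_space UNIV) T"

text \<open>The competitors may live on an arbitrary probability space; the type of its points is
  passed as an argument, and a theorem with this type left schematic covers all spaces.\<close>

definition fastest_strong_stationary_time ::
  "'b itself \<Rightarrow> 'a measure \<Rightarrow> nat \<Rightarrow> real mat \<Rightarrow> (nat \<Rightarrow> real) \<Rightarrow> (nat \<Rightarrow> 'a \<Rightarrow> nat) \<Rightarrow> ('a \<Rightarrow> enat) \<Rightarrow> bool" where
  "fastest_strong_stationary_time _ M d P \<pi> X T \<longleftrightarrow>
     strong_stationary_time M d P \<pi> X T \<and>
     (\<forall>(M' :: 'b measure) X' T'.
        prob_space M' \<and> (AE \<omega> in M'. X' 0 \<omega> = 0) \<and> strong_stationary_time M' d P \<pi> X' T' \<longrightarrow>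
        (\<forall>t. \<P>(\<omega> in M. enat t < T \<omega>) \<le> \<P>(\<omega> in M'. enat t < T' \<omega>)))"

definition hitting_time :: "(nat \<Rightarrow> 'a \<Rightarrow> nat) \<Rightarrow> nat \<Rightarrow> 'a \<Rightarrow> enat" where
  "hitting_time Z k \<omega> = (INF t\<in>{t. Z t \<omega> = k}. enat t)"

text \<open>For a pure-birth chain started at \<open>0\<close>, the \<open>k\<close>-th birth occurs when state \<open>k\<close> is hit;
  this is the time between births \<open>k\<close> and \<open>k + 1\<close>, where birth \<open>0\<close> is time \<open>0\<close>.\<close>

definition waiting_time :: "(nat \<Rightarrow> 'a \<Rightarrow> nat) \<Rightarrow> nat \<Rightarrow> 'a \<Rightarrow> enat" where
  "waiting_time Z k \<omega> = hitting_time Z (Suc k) \<omega> - hitting_time Z k \<omega>"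

definition geometric_time :: "'a measure \<Rightarrow> real \<Rightarrow> ('a \<Rightarrow> enat) \<Rightarrow> bool" where
  "geometric_time M \<theta> W \<longleftrightarrow> (\<forall>n\<ge>1. \<P>(\<omega> in M. W \<omega> = enat n) = \<theta> ^ (n - 1) * (1 - \<theta>))"

primrec spectral_poly :: "nat \<Rightarrow> real mat \<Rightarrow> (nat \<Rightarrow> real) \<Rightarrow> nat \<Rightarrow> real mat" where
  "spectral_poly d P \<theta> 0 = 1\<^sub>m (Suc d)"
| "spectral_poly d P \<theta> (Suc k) =
     inverse (1 - \<theta> k) \<cdot>\<^sub>m (spectral_poly d P \<theta> k * (P - \<theta> k \<cdot>\<^sub>m 1\<^sub>m (Suc d)))"

definition link :: "nat \<Rightarrow> real mat \<Rightarrow> (nat \<Rightarrow> real) \<Rightarrow> real mat" where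
  "link d P \<theta> = mat (Suc d) (Suc d) (\<lambda>(k, y). spectral_poly d P \<theta> k $$ (0, y))"

definition pure_birth_kernel :: "nat \<Rightarrow> (nat \<Rightarrow> real) \<Rightarrow> real mat" where
  "pure_birth_kernel d \<theta> = mat (Suc d) (Suc d)
     (\<lambda>(i, j). if j = i then \<theta> i else if j = Suc i then 1 - \<theta> i else 0)"

definition birth_prob :: "nat \<Rightarrow> real mat \<Rightarrow> (nat \<Rightarrow> real) \<Rightarrow> nat \<Rightarrow> nat \<Rightarrow> real" where
  "birth_prob d P \<theta> x y =
     (1 - \<theta> x) * link d P \<theta> $$ (Suc x, y) /
     (\<theta> x * link d P \<theta> $$ (x, y) + (1 - \<theta> x) * link d P \<theta> $$ (Suc x, y))"

text \<open>\<open>Z\<close> is built from \<open>X\<close> by the sampling rule: the value at time \<open>t + 1\<close> is drawn given the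
  earlier values of \<open>Z\<close> and the trajectory of \<open>X\<close>. Conditioning on \<open>X\<close> up to an arbitrary
  horizon \<open>n \<ge> t + 1\<close>, and not only up to \<open>t + 1\<close>, expresses that the extra randomness is
  independent of everything else, including the future of \<open>X\<close>. Nothing is prescribed in the case
  where \<open>X\<close> jumps above \<open>Z + 1\<close>.\<close>

definition dual_construction ::
  "'a measure \<Rightarrow> nat \<Rightarrow> real mat \<Rightarrow> (nat \<Rightarrow> real) \<Rightarrow> (nat \<Rightarrow> 'a \<Rightarrow> nat) \<Rightarrow> (nat \<Rightarrow> 'a \<Rightarrow> nat) \<Rightarrow> bool" where
  "dual_construction M d P \<theta> X Z \<longleftrightarrow>
     (\<forall>t. Z t \<in> M \<rightarrow>\<^sub>M count_space {..d}) \<and>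
     (AE \<omega> in M. Z 0 \<omega> = 0) \<and>
     (\<forall>t n x z. Suc t \<le> n \<longrightarrow>
        0 < \<P>(\<omega> in M. (\<forall>s\<le>n. X s \<omega> = x s) \<and> (\<forall>s\<le>t. Z s \<omega> = z s)) \<longrightarrow>
        (let next_prob = (\<lambda>k. \<P>(\<omega> in M. Z (Suc t) \<omega> = k \<bar>
               (\<forall>s\<le>n. X s \<omega> = x s) \<and> (\<forall>s\<le>t. Z s \<omega> = z s)))
         in (z t = d \<longrightarrow> next_prob d = 1) \<and>
            (z t < d \<and> x (Suc t) \<le> z t \<longrightarrow>
               next_prob (Suc (z t)) = birth_prob d P \<theta> (z t) (x (Suc t)) \<and>
               next_prob (z t) = 1 - birth_prob d P \<theta> (z t) (x (Suc t))) \<and>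
            (z t < d \<and> x (Suc t) = Suc (z t) \<longrightarrow> next_prob (Suc (z t)) = 1)))"

text \<open>The standard realization of the rule, with an independent uniform seed for every step.\<close>

definition uniform_seeds :: "'a measure \<Rightarrow> (nat \<Rightarrow> 'a \<Rightarrow> nat) \<Rightarrow> (nat \<Rightarrow> 'a \<Rightarrow> real) \<Rightarrow> bool" where
  "uniform_seeds M X U \<longleftrightarrow>
     prob_space.indep_vars M (\<lambda>_. borel) U UNIV \<and>
     (\<forall>t. distr M borel (U t) = uniform_measure lborel {0..1}) \<and>
     prob_space.indep_var M
       (\<Pi>\<^sub>M t\<in>UNIV. count_space UNIV) (\<lambda>\<omega> t. X t \<omega>) (\<Pi>\<^sub>M t\<in>UNIV. borel) (\<lambda>\<omega> t. U t \<omega>)"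

primrec dual_path ::
  "nat \<Rightarrow> real mat \<Rightarrow> (nat \<Rightarrow> real) \<Rightarrow> (nat \<Rightarrow> 'a \<Rightarrow> nat) \<Rightarrow> (nat \<Rightarrow> 'a \<Rightarrow> real) \<Rightarrow> nat \<Rightarrow> 'a \<Rightarrow> nat" where
  "dual_path d P \<theta> X U 0 = (\<lambda>\<omega>. 0)"
| "dual_path d P \<theta> X U (Suc t) = (\<lambda>\<omega>.
     let x = dual_path d P \<theta> X U t \<omega>; y = X (Suc t) \<omega>
     in if x = d then d
        else if y \<le> x then (if U (Suc t) \<omega> < birth_prob d P \<theta> x y then Suc x else x)
        else Suc x)"

end

theory Submission
  imports Defs
begin

text \<open>Nonnegativity of the link comes from the spectrum. For a tridiagonal \<open>P\<close>, entry \<open>(0, y)\<close> of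
  \<open>(P - \<theta>\<^sub>0) \<cdots> (P - \<theta>\<^bsub>k-1\<^esub>)\<close> is \<open>P(0,1) \<cdots> P(y-1,y)\<close> times the divided difference at
  \<open>\<theta>\<^sub>k, \<dots>, \<theta>\<^sub>d\<close> of the characteristic polynomial of the block of \<open>P\<close> on \<open>{y+1..d}\<close>. By
  Sturm interlacing the \<open>j\<close>-th largest root of that polynomial is at most the \<open>j\<close>-th largest
  eigenvalue of \<open>P\<close>, and peeling off the smallest point and the smallest root with the Leibniz rule
  then shows that the divided difference is nonnegative.

  The rows of the link satisfy \<open>\<Lambda> P = P' \<Lambda>\<close> for the pure-birth kernel \<open>P'\<close>, and the sampling rule
  is the one that keeps the conditional law of \<open>X\<^sub>t\<close> given the dual path up to \<open>t\<close> equal to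
  row \<open>Xh\<^sub>t\<close> of \<open>\<Lambda>\<close>. So the dual chain is Markov with kernel \<open>P'\<close>, and, the last row of \<open>\<Lambda>\<close>
  being \<open>\<pi>\<close>, its absorption time \<open>T\<close> is strong stationary. Since \<open>\<Lambda>(k, d) = 0\<close> for \<open>k < d\<close>,
  we get \<open>P(X\<^sub>t = d) = \<pi>(d) P(T \<le> t)\<close>, whereas every strong stationary time \<open>T'\<close> satisfies
  \<open>P(X\<^sub>t = d) \<ge> \<pi>(d) P(T' \<le> t)\<close>.\<close>

section \<open>Interlacing roots of Jacobi polynomials\<close>

text \<open>The factors \<open>P - \<theta> i\<close> have entries of both signs, so nonnegativity
  cannot be read off their product. The divided difference originates in the resolvent: entry
  \<open>(0, y)\<close> of the inverse of \<open>x - P\<close> is \<open>P(0,1) ... P(y-1,y)\<close>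
  times the characteristic polynomial of the block on \<open>{y+1..d}\<close>, over that of
  \<open>P\<close>. Multiplying by \<open>(x - \<theta> 0) ... (x - \<theta> (k-1))\<close> leaves
  only the poles \<open>\<theta> k, ..., \<theta> d\<close>, and the residues there sum to a divided
  difference. The formal argument replaces residues by a recursion in \<open>k\<close>:
  multiplication by \<open>P - \<theta> k\<close> drops the node \<open>\<theta> k\<close>.

  The sampling rule is silent on null events and when \<open>X\<close> jumps above
  \<open>Z + 1\<close>. One product formula for the law of \<open>X\<close> up to \<open>n\<close>
  and of the dual up to \<open>t \<le> n\<close> settles both, since \<open>X \<le> Z\<close>
  persists along paths of positive probability. With \<open>n = t + 1\<close> it also shows that the
  randomness of the dual does not bias the next step of \<open>X\<close>: \<open>X\<close> stays
  Markov for the history of the pair, for which the absorption time is a stopping time.\<close>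

fun jacobi_poly :: "(nat \<Rightarrow> real) \<Rightarrow> (nat \<Rightarrow> real) \<Rightarrow> nat \<Rightarrow> real poly" where
  "jacobi_poly b c 0 = 1"
| "jacobi_poly b c (Suc 0) = [:- b 0, 1:]"
| "jacobi_poly b c (Suc (Suc n)) =
     [:- b (Suc n), 1:] * jacobi_poly b c (Suc n) - Polynomial.smult (c n) (jacobi_poly b c n)"

lemma degree_monic_linear_mult:
  fixes p q :: "real poly"
  assumes "degree p = n" "lead_coeff p = 1" "degree q < Suc n"
  shows "degree ([:- a, 1:] * p - q) = Suc n \<and> lead_coeff ([:- a, 1:] * p - q) = 1"
proof -
  have p0: "p \<noteq> 0" using assms by auto
  have l: "[:- a, 1:] \<noteq> 0" by simp
  have dm: "degree ([:- a, 1:] * p) = Suc n"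
    using degree_mult_eq[OF l p0] assms by simp
  have lm: "lead_coeff ([:- a, 1:] * p) = 1"
    using assms by (simp only: lead_coeff_mult) simp
  have "degree ([:- a, 1:] * p - q) = Suc n"
    using degree_add_eq_left[of "- q" "[:- a, 1:] * p"] dm assms(3) by (simp only: degree_minus) simp
  moreover have "coeff q (Suc n) = 0" using assms(3) by (simp add: coeff_eq_0)
  ultimately show ?thesis using lm dm by simp
qed

lemma jacobi_poly_monic:
  "degree (jacobi_poly b c n) = n \<and> lead_coeff (jacobi_poly b c n) = 1"
proof (induction n rule: less_induct)
  case (less n)
  consider "n = 0" | "n = 1" | m where "n = Suc (Suc m)"
    by (metis One_nat_def not0_implies_Suc)
  then show ?case
  proof cases
    case 3
    have "degree (Polynomial.smult (c m) (jacobi_poly b c m)) < Suc (Suc m)"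
      using less[of m] 3 by (metis degree_smult_le le_imp_less_Suc le_SucI lessI less_SucI)
    then show ?thesis
      using degree_monic_linear_mult[of "jacobi_poly b c (Suc m)" "Suc m"] less[of "Suc m"] 3
      unfolding 3 jacobi_poly.simps by blast
  qed auto
qed

text \<open>The difference of two monic polynomials of degree \<open>n\<close> has degree below
  \<open>n\<close>, so it cannot have \<open>n\<close> distinct roots unless it is zero.\<close>

lemma monic_eq_prod_roots:
  fixes q :: "real poly"
  assumes "degree q = n" "lead_coeff q = 1" "inj_on \<nu> {..<n}" "\<And>j. j < n \<Longrightarrow> poly q (\<nu> j) = 0"
  shows "q = (\<Prod>j<n. [:- \<nu> j, 1:])"
proof (rule ccontr)
  let ?s = "\<Prod>j<n. [:- \<nu> j, 1:]"
  assume "q \<noteq> ?s"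
  then have nz: "q - ?s \<noteq> 0" by simp
  have ds: "degree ?s = n"
    by (subst degree_prod_eq_sum_degree) auto
  have ls: "lead_coeff ?s = 1" by (simp add: lead_coeff_prod)
  have r: "\<nu> ` {..<n} \<subseteq> {x. poly (q - ?s) x = 0}"
    using assms(4) by (auto simp: poly_prod)
  have "n = card (\<nu> ` {..<n})" using assms(3) by (simp add: card_image)
  also have "\<dots> \<le> card {x. poly (q - ?s) x = 0}"
    using r nz by (intro card_mono poly_roots_finite) auto
  also have "\<dots> \<le> degree (q - ?s)" using nz by (rule card_poly_roots_bound)
  finally have "n \<le> degree (q - ?s)" .
  moreover have "degree (q - ?s) \<le> n" using assms(1) ds by (intro degree_diff_le) auto
  ultimately have "degree (q - ?s) = n" by simp
  moreover have "coeff (q - ?s) n = 0" using assms(1,2) ds ls by simp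
  ultimately have "lead_coeff (q - ?s) = 0" by metis
  then show False using nz by (metis leading_coeff_0_iff)
qed

text \<open>The sign near minus infinity reduces to the one near plus infinity, because
  \<open>(-1) ^ n * q(- x)\<close> is again monic.\<close>

lemma monic_signs_at_infinity:
  fixes q :: "real poly"
  assumes "degree q = n" "lead_coeff q = 1"
  obtains u v where "u > A" "poly q u > 0" "v < B" "(-1) ^ n * poly q v > 0"
proof -
  obtain N where N: "\<forall>x\<ge>N. lead_coeff q \<le> poly q x"
    using poly_pinfty_gt_lc[of q] assms by auto
  define u where "u = max N (A + 1)"
  let ?q = "Polynomial.smult ((-1) ^ n) (pcompose q [:0, -1:])"
  have "lead_coeff ?q = 1"
    unfolding lead_coeff_smult using assms
    by (subst lead_coeff_comp) (simp_all flip: power_mult_distrib)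
  then obtain N' where N': "\<forall>x\<ge>N'. 1 \<le> poly ?q x"
    using poly_pinfty_gt_lc[of ?q] by auto
  define w where "w = max N' (1 - B)"
  have "1 \<le> poly ?q w" using N' by (simp add: w_def)
  then have "(-1) ^ n * poly q (- w) \<ge> 1" by (simp add: poly_pcompose)
  moreover have "poly q u \<ge> 1" using N assms by (simp add: u_def)
  ultimately show thesis
    by (intro that[of u "- w"]) (auto simp: u_def w_def)
qed

lemma antimono_from_step:
  fixes f :: "nat \<Rightarrow> real"
  assumes "\<And>i. Suc i < n \<Longrightarrow> f (Suc i) < f i" "i \<le> j" "j < n"
  shows "f j \<le> f i"
  using assms(2,3)
proof (induction j)
  case (Suc j)
  then show ?case using assms(1)[of j] by (cases "i = Suc j") force+
qed simp

text \<open>Exactly the first \<open>j\<close> factors are negative.\<close>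

lemma prod_sign_alternates:
  fixes \<mu> :: "nat \<Rightarrow> real"
  assumes "j \<le> n" "\<And>i. i < j \<Longrightarrow> x < \<mu> i" "\<And>i. j \<le> i \<Longrightarrow> i < n \<Longrightarrow> \<mu> i < x"
  shows "(-1) ^ j * (\<Prod>i<n. x - \<mu> i) > 0"
proof -
  have "(\<Prod>i<n. x - \<mu> i) = (\<Prod>i<j. x - \<mu> i) * (\<Prod>i\<in>{j..<n}. x - \<mu> i)"
    using assms(1) by (subst prod.union_disjoint[symmetric]) (auto intro: prod.cong)
  moreover have "(-1) ^ j * (\<Prod>i<j. x - \<mu> i) = (\<Prod>i<j. \<mu> i - x)"
  proof -
    have "(\<Prod>i<j. \<mu> i - x) = (\<Prod>i<j. (-1) * (x - \<mu> i))" by simp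
    also have "\<dots> = (-1) ^ j * (\<Prod>i<j. x - \<mu> i)" by (subst prod.distrib) simp
    finally show ?thesis by simp
  qed
  moreover have "(\<Prod>i<j. \<mu> i - x) > 0" using assms(2) by (intro prod_pos) auto
  moreover have "(\<Prod>i\<in>{j..<n}. x - \<mu> i) > 0" using assms(3) by (intro prod_pos) auto
  ultimately show ?thesis by (metis mult.assoc mult_pos_pos)
qed

text \<open>The intermediate value theorem puts a root into each of \<open>n\<close> disjoint
  intervals, and a monic polynomial of degree \<open>n\<close> has no room for others.\<close>

lemma alternating_signs_roots:
  fixes q :: "real poly"
  assumes "degree q = n" "lead_coeff q = 1"
    and dec: "\<And>j. j < n \<Longrightarrow> e (Suc j) < e j"
    and sgn: "\<And>j. j \<le> n \<Longrightarrow> (-1) ^ j * poly q (e j) > 0"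
  obtains \<nu> where "q = (\<Prod>j<n. [:- \<nu> j, 1:])" "\<And>j. j < n \<Longrightarrow> e (Suc j) < \<nu> j \<and> \<nu> j < e j"
proof -
  have "\<exists>x. e (Suc j) < x \<and> x < e j \<and> poly q x = 0" if "j < n" for j
  proof -
    have "poly q (e (Suc j)) * poly q (e j) < 0"
    proof (cases "even j")
      case True
      then show ?thesis using sgn[of j] sgn[of "Suc j"] that by (simp add: mult_less_0_iff)
    next
      case False
      then show ?thesis using sgn[of j] sgn[of "Suc j"] that by (simp add: mult_less_0_iff)
    qed
    then show ?thesis using poly_IVT[OF dec[OF that], of q] by auto
  qed
  then obtain \<nu> where \<nu>: "\<And>j. j < n \<Longrightarrow> e (Suc j) < \<nu> j \<and> \<nu> j < e j \<and> poly q (\<nu> j) = 0"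
    by metis
  have e_anti: "e j \<le> e i" if "i \<le> j" "j \<le> n" for i j
    using antimono_from_step[of "Suc n" e i j] dec that by auto
  have "\<nu> j < \<nu> i" if "i < j" "j < n" for i j
  proof -
    have "\<nu> j < e j" using \<nu> that by simp
    also have "\<dots> \<le> e (Suc i)" using e_anti that by simp
    also have "\<dots> < \<nu> i" using \<nu> that by simp
    finally show ?thesis .
  qed
  then have "inj_on \<nu> {..<n}"
    by (metis inj_onI lessThan_iff less_irrefl nat_neq_iff)
  then have "q = (\<Prod>j<n. [:- \<nu> j, 1:])"
    using assms(1,2) \<nu> by (intro monic_eq_prod_roots) auto
  then show thesis using \<nu> that by blast
qed

text \<open>At a root of the middle polynomial the recurrence leaves only \<open>- c\<close> times
  the oldest one, whose sign there is known from the interlacing one degree below. So the signs of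
  \<open>q\<close> alternate along the roots \<open>\<kappa>\<close>.\<close>

lemma interlacing_step:
  fixes \<mu> \<kappa> :: "nat \<Rightarrow> real"
  assumes q: "q = [:- a, 1:] * (\<Prod>j<Suc n. [:- \<kappa> j, 1:]) - Polynomial.smult c (\<Prod>j<n. [:- \<mu> j, 1:])"
    and deg: "degree q = Suc (Suc n)" "lead_coeff q = 1" and c: "0 < c"
    and il: "\<And>j. j < n \<Longrightarrow> \<mu> j < \<kappa> j \<and> \<kappa> (Suc j) < \<mu> j"
  obtains \<nu> where "q = (\<Prod>j<Suc (Suc n). [:- \<nu> j, 1:])"
    "\<And>j. j < Suc n \<Longrightarrow> \<kappa> j < \<nu> j \<and> \<nu> (Suc j) < \<kappa> j"
proof -
  obtain u v where uv: "u > \<kappa> 0" "poly q u > 0" "v < \<kappa> n" "(-1) ^ Suc (Suc n) * poly q v > 0"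
    using monic_signs_at_infinity[OF deg] by blast
  \<comment> \<open>The \<open>n + 1\<close> roots \<open>\<kappa>\<close>, bracketed by
    \<open>u\<close> above and \<open>v\<close> below, form the \<open>n + 3\<close> decreasing
    points required for degree \<open>n + 2\<close>.\<close>
  define e where "e j = (if j = 0 then u else if j \<le> Suc n then \<kappa> (j - 1) else v)" for j
  have kdec: "\<kappa> (Suc j) < \<kappa> j" if "j < n" for j using il[OF that] by linarith
  have kanti: "\<kappa> j \<le> \<kappa> i" if "i \<le> j" "j \<le> n" for i j
    using antimono_from_step[of "Suc n" \<kappa> i j] kdec that by auto
  have sgn: "(-1) ^ Suc j * poly q (\<kappa> j) > 0" if "j \<le> n" for j
  proof -
    have "poly q (\<kappa> j) = - c * (\<Prod>i<n. \<kappa> j - \<mu> i)"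
      using that unfolding q by (auto simp: poly_prod prod_zero_iff simp del: mult_pCons_left prod.lessThan_Suc)
    moreover have "(-1) ^ j * (\<Prod>i<n. \<kappa> j - \<mu> i) > 0"
    proof (rule prod_sign_alternates[OF that])
      show "\<kappa> j < \<mu> i" if "i < j" for i
        using kanti[of "Suc i" j] il[of i] that \<open>j \<le> n\<close> by force
      show "\<mu> i < \<kappa> j" if "j \<le> i" "i < n" for i
        using kanti[of j i] il[of i] that by force
    qed
    then have "c * ((-1) ^ j * (\<Prod>i<n. \<kappa> j - \<mu> i)) > 0" using c by simp
    ultimately show ?thesis by (simp add: mult_ac)
  qed
  have "e (Suc j) < e j" if "j < Suc (Suc n)" for j
    using that uv kdec[of "j - 1"] by (cases j) (auto simp: e_def not_le less_Suc_eq)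
  moreover have "(-1) ^ j * poly q (e j) > 0" if "j \<le> Suc (Suc n)" for j
    using that uv sgn[of "j - 1"] by (cases j) (auto simp: e_def le_Suc_eq)
  ultimately obtain \<nu> where \<nu>: "q = (\<Prod>j<Suc (Suc n). [:- \<nu> j, 1:])"
      "\<And>j. j < Suc (Suc n) \<Longrightarrow> e (Suc j) < \<nu> j \<and> \<nu> j < e j"
    using alternating_signs_roots[OF deg, of e] by blast
  have "\<kappa> j < \<nu> j \<and> \<nu> (Suc j) < \<kappa> j" if "j < Suc n" for j
    using \<nu>(2)[of j] \<nu>(2)[of "Suc j"] that by (auto simp: e_def split: if_splits)
  with \<nu>(1) that show thesis by blast
qed

text \<open>Sturm interlacing by induction on the degree. Roots are numbered from the largest down,
  so the first inequality says that the \<open>j\<close>-th largest root rises with the degree; this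
  is the form needed to compare blocks of \<open>P\<close> with \<open>P\<close> itself.\<close>

lemma jacobi_poly_interlacing_roots:
  assumes "\<And>i. Suc i < N \<Longrightarrow> 0 < c i"
  shows "\<exists>\<kappa>. (\<forall>m\<le>N. jacobi_poly b c m = (\<Prod>j<m. [:- \<kappa> m j, 1:])) \<and>
    (\<forall>m<N. \<forall>j<m. \<kappa> m j < \<kappa> (Suc m) j \<and> \<kappa> (Suc m) (Suc j) < \<kappa> m j)"
  using assms
proof (induction N)
  case (Suc N)
  then obtain \<kappa> where k1: "\<And>m. m \<le> N \<Longrightarrow> jacobi_poly b c m = (\<Prod>j<m. [:- \<kappa> m j, 1:])"
    and k2: "\<And>m j. m < N \<Longrightarrow> j < m \<Longrightarrow> \<kappa> m j < \<kappa> (Suc m) j \<and> \<kappa> (Suc m) (Suc j) < \<kappa> m j"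
    by (metis Suc_lessD less_SucI)
  obtain \<nu> where \<nu>: "jacobi_poly b c (Suc N) = (\<Prod>j<Suc N. [:- \<nu> j, 1:])"
    "\<And>j. j < N \<Longrightarrow> \<kappa> N j < \<nu> j \<and> \<nu> (Suc j) < \<kappa> N j"
  proof (cases N)
    case 0
    then show ?thesis using that[of "\<lambda>_. b 0"] by simp
  next
    case (Suc n)
    have "jacobi_poly b c (Suc N) = [:- b (Suc n), 1:] * (\<Prod>j<Suc n. [:- \<kappa> (Suc n) j, 1:])
        - Polynomial.smult (c n) (\<Prod>j<n. [:- \<kappa> n j, 1:])"
      using k1[of n] k1[of "Suc n"] Suc by (simp del: mult_pCons_left prod.lessThan_Suc)
    then show ?thesis
    proof (rule interlacing_step)
      show "degree (jacobi_poly b c (Suc N)) = Suc (Suc n)" "lead_coeff (jacobi_poly b c (Suc N)) = 1"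
        using jacobi_poly_monic[of b c "Suc N"] Suc by metis+
      show "0 < c n" using Suc.prems[of n] Suc by simp
      show "\<kappa> n j < \<kappa> (Suc n) j \<and> \<kappa> (Suc n) (Suc j) < \<kappa> n j" if "j < n" for j
        using k2[of n j] that Suc by simp
    qed (use that Suc in blast)
  qed
  let ?\<kappa> = "\<kappa>(Suc N := \<nu>)"
  have "jacobi_poly b c m = (\<Prod>j<m. [:- ?\<kappa> m j, 1:])" if "m \<le> Suc N" for m
    using that k1[of m] \<nu>(1) by (cases "m = Suc N") (auto simp del: prod.lessThan_Suc)
  moreover have "?\<kappa> m j < ?\<kappa> (Suc m) j \<and> ?\<kappa> (Suc m) (Suc j) < ?\<kappa> m j" if "m < Suc N" "j < m" for m j
    using that k2[of m j] \<nu>(2)[of j] by (cases "m = N") auto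
  ultimately show ?case by blast
qed simp

section \<open>Divided differences\<close>

text \<open>The divided difference at \<open>a 0, \<dots>, a m\<close>, where repeated points are allowed.\<close>

primrec divdiff :: "(nat \<Rightarrow> real) \<Rightarrow> nat \<Rightarrow> real poly \<Rightarrow> real" where
  "divdiff a 0 p = poly p (a 0)"
| "divdiff a (Suc m) p = divdiff a m (synthetic_div p (a (Suc m)))"

lemma synthetic_div_add:
  "synthetic_div (p + q) c = synthetic_div p c + synthetic_div (q :: real poly) c"
proof -
  have "(p + q) + Polynomial.smult c (synthetic_div p c + synthetic_div q c) =
      (p + Polynomial.smult c (synthetic_div p c)) + (q + Polynomial.smult c (synthetic_div q c))"
    by (simp add: smult_add_right)
  also have "\<dots> = pCons (poly p c + poly q c) (synthetic_div p c + synthetic_div q c)"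
    by (simp only: synthetic_div_correct) simp
  finally show ?thesis using synthetic_div_unique by metis
qed

lemma synthetic_div_smult:
  "synthetic_div (Polynomial.smult s p) c = Polynomial.smult s (synthetic_div (p :: real poly) c)"
proof -
  have "Polynomial.smult s p + Polynomial.smult c (Polynomial.smult s (synthetic_div p c)) = Polynomial.smult s (p + Polynomial.smult c (synthetic_div p c))"
    by (simp add: smult_add_right mult.commute)
  also have "\<dots> = pCons (s * poly p c) (Polynomial.smult s (synthetic_div p c))"
    by (simp only: synthetic_div_correct) simp
  finally show ?thesis using synthetic_div_unique by metis
qed

lemma synthetic_div_linear_mult:
  "synthetic_div ([:- c, 1:] * p) c = (p :: real poly)"
proof -
  have "[:- c, 1:] * p + Polynomial.smult c p = pCons 0 p" by simp
  then show ?thesis using synthetic_div_unique by metis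
qed

lemma divdiff_add: "divdiff a m (p + q) = divdiff a m p + divdiff a m q"
  by (induction m arbitrary: p q) (auto simp: synthetic_div_add)

lemma divdiff_smult: "divdiff a m (Polynomial.smult s p) = s * divdiff a m p"
  by (induction m arbitrary: p) (auto simp: synthetic_div_smult)

lemma divdiff_linear_mult:
  "divdiff a (Suc m) ([:- a (Suc m), 1:] * p) = divdiff a m p"
  by (simp only: divdiff.simps synthetic_div_linear_mult)

text \<open>The Leibniz rule for a linear factor: write \<open>x - s\<close> as
  \<open>(a - s) + (x - a)\<close> with \<open>a\<close> the last node; the second summand cancels
  that node.\<close>

lemma divdiff_linear_mult_general:
  "divdiff a (Suc m) ([:- s, 1:] * p) = (a (Suc m) - s) * divdiff a (Suc m) p + divdiff a m p"
proof -
  have "[:- s, 1:] * p = Polynomial.smult (a (Suc m) - s) p + [:- a (Suc m), 1:] * p"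
    by (simp add: algebra_simps flip: smult_add_left)
  then show ?thesis by (simp only: divdiff_add divdiff_smult divdiff_linear_mult)
qed

text \<open>Each synthetic division lowers the degree by one and passes the top coefficient on. This
  evaluates every divided difference with at least as many nodes as the degree plus one, including
  those that vanish.\<close>

lemma divdiff_degree_le:
  "degree p \<le> m \<Longrightarrow> divdiff a m p = coeff p m"
proof (induction m arbitrary: p)
  case 0
  then show ?case by (metis degree_eq_zeroE divdiff.simps(1) le_0_eq mult_zero_right poly_0 poly_pCons coeff_pCons_0 add.right_neutral)
next
  case (Suc m)
  let ?q = "synthetic_div p (a (Suc m))"
  have dq: "degree ?q \<le> m" using Suc.prems by (simp add: degree_synthetic_div)
  have "coeff (p + Polynomial.smult (a (Suc m)) ?q) (Suc m) = coeff (pCons (poly p (a (Suc m))) ?q) (Suc m)"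
    by (simp only: synthetic_div_correct)
  moreover have "coeff ?q (Suc m) = 0" using dq by (simp add: coeff_eq_0)
  ultimately have "coeff ?q m = coeff p (Suc m)" by simp
  then show ?case using Suc.IH[OF dq] by simp
qed

text \<open>Each linear factor is spent on its own node, and the last one vanishes at
  \<open>a 0\<close>. Applied to the characteristic polynomial, this takes the place of the
  Cayley-Hamilton theorem.\<close>

lemma divdiff_annihilates: "divdiff a m (p * (\<Prod>j\<le>m. [:- a j, 1:])) = 0"
proof (induction m)
  case (Suc m)
  have "p * (\<Prod>j\<le>Suc m. [:- a j, 1:]) = [:- a (Suc m), 1:] * (p * (\<Prod>j\<le>m. [:- a j, 1:]))"
    by (simp add: mult_ac del: mult_pCons_left mult_pCons_right)
  then show ?case using Suc by (simp only: divdiff_linear_mult)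
qed (simp add: poly_prod)

text \<open>Induction on the number of roots, for all \<open>m\<close> at once. Once there are at
  most \<open>m\<close> roots the value is a coefficient, 0 or 1. Otherwise the last root and the
  last node are taken off the ends of both lists, so the termwise comparison
  \<open>\<kappa> j \<le> a j\<close> survives for what remains.\<close>

lemma divdiff_prod_nonneg:
  assumes "\<And>i j. i \<le> j \<Longrightarrow> j < n \<Longrightarrow> \<kappa> j \<le> \<kappa> i" "\<And>j. j < n \<Longrightarrow> j \<le> m \<Longrightarrow> \<kappa> j \<le> a j"
  shows "0 \<le> divdiff a m (\<Prod>j<n. [:- \<kappa> j, 1:])"
  using assms
proof (induction n arbitrary: m)
  case 0
  have "divdiff a m 1 = coeff 1 m" by (rule divdiff_degree_le) simp
  then show ?case by simp
next
  case (Suc l)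
  let ?p = "\<lambda>n. \<Prod>j<n. [:- \<kappa> j, 1:]"
  have deg: "degree (?p (Suc l)) = Suc l" by (subst degree_prod_eq_sum_degree) auto
  have lc: "lead_coeff (?p (Suc l)) = 1" by (simp add: lead_coeff_prod del: prod.lessThan_Suc)
  show ?case
  proof (cases "Suc l \<le> m")
    case True
    then have "divdiff a m (?p (Suc l)) = coeff (?p (Suc l)) m"
      using deg by (intro divdiff_degree_le) simp
    then show ?thesis using True deg lc
      by (cases "Suc l = m") (auto simp: coeff_eq_0 simp del: prod.lessThan_Suc)
  next
    case False
    then have "m \<le> l" by simp
    \<comment> \<open>Since \<open>m \<le> l\<close>, the comparison passes through index
      \<open>m\<close>: \<open>\<kappa> l \<le> \<kappa> m \<le> a m\<close>. This makes the Leibniz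
      coefficient nonnegative.\<close>
    have ka: "\<kappa> l \<le> a m" using Suc.prems(1)[of m l] Suc.prems(2)[of m] \<open>m \<le> l\<close> by force
    have eq: "?p (Suc l) = [:- \<kappa> l, 1:] * ?p l"
      by (simp add: mult_ac del: mult_pCons_left mult_pCons_right)
    have ih: "0 \<le> divdiff a m' (?p l)" if "m' \<le> m" for m'
      using Suc.IH[of m'] Suc.prems that by simp
    show ?thesis
    proof (cases m)
      case 0
      have "\<kappa> j \<le> a 0" if "j \<le> l" for j
        using Suc.prems(1)[of 0 j] Suc.prems(2)[of 0] that by force
      then show ?thesis
        unfolding 0 divdiff.simps poly_prod by (intro prod_nonneg) auto
    next
      case (Suc m')
      have "0 \<le> (a m - \<kappa> l) * divdiff a m (?p l) + divdiff a m' (?p l)"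
        using ih[of m] ih[of m'] ka Suc by simp
      then show ?thesis unfolding eq Suc divdiff_linear_mult_general .
    qed
  qed
qed

section \<open>The spectrum of a birth-and-death kernel\<close>

text \<open>A window into an array without bounds: all trailing blocks of one matrix become windows
  with different corners \<open>s\<close>, so that cofactors are again of this form.\<close>

definition shifted_mat :: "(nat \<Rightarrow> nat \<Rightarrow> 'a) \<Rightarrow> nat \<Rightarrow> nat \<Rightarrow> 'a mat" where
  "shifted_mat f n s = mat n n (\<lambda>(i, j). f (s + i) (s + j))"

text \<open>Expansion along the first row leaves two cofactors. The minor for the second has a
  single nonzero entry in its first column, \<open>f (Suc s) s\<close>, along which it is expanded
  once more.\<close>

lemma det_tridiagonal_rec:
  fixes f :: "nat \<Rightarrow> nat \<Rightarrow> 'a :: comm_ring_1"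
  assumes tri: "\<And>i j. Suc i < j \<or> Suc j < i \<Longrightarrow> f i j = 0"
  shows "det (shifted_mat f (Suc (Suc n)) s) =
    f s s * det (shifted_mat f (Suc n) (Suc s))
    - f s (Suc s) * f (Suc s) s * det (shifted_mat f n (Suc (Suc s)))"
proof -
  let ?A = "shifted_mat f (Suc (Suc n)) s"
  let ?B = "mat_delete ?A 0 1"
  have A: "?A \<in> carrier_mat (Suc (Suc n)) (Suc (Suc n))" by (simp add: shifted_mat_def)
  have B: "?B \<in> carrier_mat (Suc n) (Suc n)" using mat_delete_carrier[OF A] by simp
  have "mat_delete ?A 0 0 = shifted_mat f (Suc n) (Suc s)"
    by (rule eq_matI) (auto simp: mat_delete_def shifted_mat_def)
  then have c0: "cofactor ?A 0 0 = det (shifted_mat f (Suc n) (Suc s))"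
    by (simp add: cofactor_def)
  have "mat_delete ?B 0 0 = shifted_mat f n (Suc (Suc s))"
    by (rule eq_matI) (auto simp: mat_delete_def shifted_mat_def)
  then have cB: "cofactor ?B 0 0 = det (shifted_mat f n (Suc (Suc s)))"
    by (simp add: cofactor_def)
  have "det ?B = (\<Sum>i<Suc n. ?B $$ (i, 0) * cofactor ?B i 0)"
    using B by (rule laplace_expansion_column) simp
  also have "\<dots> = ?B $$ (0, 0) * cofactor ?B 0 0"
    by (subst sum.lessThan_Suc_shift) (auto simp: mat_delete_def shifted_mat_def tri intro!: sum.neutral)
  also have "?B $$ (0, 0) = f (Suc s) s" by (simp add: mat_delete_def shifted_mat_def)
  finally have c1: "cofactor ?A 0 (Suc 0) = - (f (Suc s) s * det (shifted_mat f n (Suc (Suc s))))"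
    using cB by (simp add: cofactor_def)
  have "det ?A = (\<Sum>j<Suc (Suc n). ?A $$ (0, j) * cofactor ?A 0 j)"
    using A by (rule laplace_expansion_row) simp
  also have "\<dots> = ?A $$ (0, 0) * cofactor ?A 0 0 + ?A $$ (0, Suc 0) * cofactor ?A 0 (Suc 0)"
    by (simp add: sum.lessThan_Suc_shift shifted_mat_def tri del: sum.lessThan_Suc)
  also have "?A $$ (0, 0) = f s s" by (simp add: shifted_mat_def)
  also have "?A $$ (0, Suc 0) = f s (Suc s)" by (simp add: shifted_mat_def)
  finally show ?thesis by (simp add: c0 c1 mult.assoc)
qed

text \<open>Blocks grow upwards from the lower right corner, hence the reversed indices
  \<open>d - n\<close>. Off the diagonal only the products of opposite entries enter, so the block
  has the characteristic polynomial of a Jacobi matrix.\<close>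

lemma det_tridiagonal_jacobi_poly:
  fixes f :: "nat \<Rightarrow> nat \<Rightarrow> real poly"
  assumes "\<And>i j. Suc i < j \<or> Suc j < i \<Longrightarrow> f i j = 0"
    and "\<And>i. f i i = [:- p i i, 1:]"
    and "\<And>i. f i (Suc i) = [:- p i (Suc i):]" "\<And>i. f (Suc i) i = [:- p (Suc i) i:]"
    and "n \<le> Suc d"
  shows "det (shifted_mat f n (Suc d - n)) =
    jacobi_poly (\<lambda>n. p (d - n) (d - n)) (\<lambda>n. p (d - Suc n) (d - n) * p (d - n) (d - Suc n)) n"
  using assms(5)
proof (induction n rule: less_induct)
  case (less n)
  consider "n = 0" | "n = Suc 0" | m where "n = Suc (Suc m)"
    by (metis not0_implies_Suc)
  then show ?case
  proof cases
    case 1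
    then show ?thesis by (simp add: shifted_mat_def)
  next
    case 2
    then show ?thesis
      by (simp add: shifted_mat_def assms(2) det_single)
  next
    case 3
    define s where "s = d - Suc m"
    have s: "Suc d - n = s" "Suc d - Suc m = Suc s" "Suc d - m = Suc (Suc s)" "d - m = Suc s"
      using 3 less.prems by (auto simp: s_def)
    have "det (shifted_mat f n s) = f s s * det (shifted_mat f (Suc m) (Suc s))
        - f s (Suc s) * f (Suc s) s * det (shifted_mat f m (Suc (Suc s)))"
      unfolding 3 using assms(1) by (rule det_tridiagonal_rec)
    also have "f s (Suc s) * f (Suc s) s * q = Polynomial.smult (p s (Suc s) * p (Suc s) s) q" for q
      by (simp add: assms(3,4) mult.commute)
    finally show ?thesis
      using less.IH[of "Suc m"] less.IH[of m] less.prems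
      unfolding s(1) 3 jacobi_poly.simps by (simp add: s assms(2) del: jacobi_poly.simps mult_pCons_left flip: s_def)
  qed
qed

locale birth_death_spectrum =
  fixes d :: nat and P :: "real mat" and \<theta> :: "nat \<Rightarrow> real"
  assumes bd: "birth_death_kernel d P" and irr: "irreducible_kernel d P"
    and eig: "eigenvalue_list d P \<theta>"
    and th0: "0 \<le> \<theta> 0" and thmono: "\<forall>i<d. \<theta> i \<le> \<theta> (Suc i)"
    and thlt: "\<forall>i<d. \<theta> i < 1" and thd: "\<theta> d = 1"
begin

section \<open>Positive off-diagonal entries and the roots of trailing blocks\<close>

lemma P_carrier: "P \<in> carrier_mat (Suc d) (Suc d)"
  and P_nonneg: "i \<le> d \<Longrightarrow> j \<le> d \<Longrightarrow> 0 \<le> P $$ (i, j)"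
  and P_sum: "i \<le> d \<Longrightarrow> (\<Sum>j\<le>d. P $$ (i, j)) = 1"
  and P_tri: "i \<le> d \<Longrightarrow> j \<le> d \<Longrightarrow> Suc i < j \<or> Suc j < i \<Longrightarrow> P $$ (i, j) = 0"
  using bd unfolding birth_death_kernel_def stochastic_kernel_def by auto

lemma theta_mono: "i \<le> j \<Longrightarrow> j \<le> d \<Longrightarrow> \<theta> i \<le> \<theta> j"
proof (induction j)
  case (Suc j)
  then show ?case using thmono[rule_format, of j] by (cases "i = Suc j") force+
qed simp

lemma theta_nonneg: "i \<le> d \<Longrightarrow> 0 \<le> \<theta> i"
  using theta_mono[of 0 i] th0 by simp

lemma theta_le_1: "i \<le> d \<Longrightarrow> \<theta> i \<le> 1"
  using theta_mono[of i d] thd by simp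

lemma pow_carrier: "P ^\<^sub>m n \<in> carrier_mat (Suc d) (Suc d)"
  using P_carrier by simp

lemma pow_Suc_index:
  assumes "i \<le> d" "j \<le> d"
  shows "(P ^\<^sub>m Suc n) $$ (i, j) = (\<Sum>k\<le>d. (P ^\<^sub>m n) $$ (i, k) * P $$ (k, j))"
  using assms P_carrier pow_carrier[of n]
  by (simp add: scalar_prod_def row_def col_def flip: lessThan_Suc_atMost atLeast0LessThan) 

text \<open>Were this entry zero, the tridiagonal chain could never leave \<open>{0..i}\<close>:
  every power of \<open>P\<close> would vanish at \<open>(a, b)\<close> with
  \<open>a \<le> i < b\<close>, against irreducibility. The entry below the diagonal is treated by
  the mirror image.\<close>

lemma up_pos: assumes i: "i < d" shows "0 < P $$ (i, Suc i)"
proof (rule ccontr)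
  assume "\<not> ?thesis"
  then have z: "P $$ (i, Suc i) = 0" using P_nonneg[of i "Suc i"] i by force
  have "(P ^\<^sub>m n) $$ (a, b) = 0" if "a \<le> i" "i < b" "b \<le> d" for n a b
    using that
  proof (induction n arbitrary: b)
    case 0
    then show ?case using P_carrier by simp
  next
    case (Suc n)
    have "(P ^\<^sub>m n) $$ (a, k) * P $$ (k, b) = 0" if "k \<le> d" for k
    proof (cases "i < k")
      case False
      then have "P $$ (k, b) = 0"
        using z P_tri[of k b] Suc.prems that i by (cases "k = i \<and> b = Suc i") force+
      then show ?thesis by simp
    qed (use Suc that in simp)
    then show ?case using Suc.prems i
      by (simp add: pow_Suc_index sum.neutral del: pow_mat.simps)
  qed
  then have "(P ^\<^sub>m n) $$ (i, Suc i) = 0" for n using i by simp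
  then show False using irr i unfolding irreducible_kernel_def
    by (metis Suc_leI less_imp_le_nat order_less_irrefl)
qed

lemma down_pos: assumes i: "i < d" shows "0 < P $$ (Suc i, i)"
proof (rule ccontr)
  assume "\<not> ?thesis"
  then have z: "P $$ (Suc i, i) = 0" using P_nonneg[of "Suc i" i] i by force
  have "(P ^\<^sub>m n) $$ (a, b) = 0" if "b \<le> i" "i < a" "a \<le> d" for n a b
    using that
  proof (induction n arbitrary: b)
    case 0
    then show ?case using P_carrier by simp
  next
    case (Suc n)
    have "(P ^\<^sub>m n) $$ (a, k) * P $$ (k, b) = 0" if "k \<le> d" for k
    proof (cases "i < k")
      case True
      then have "P $$ (k, b) = 0"
        using z P_tri[of k b] Suc.prems that i by (cases "b = i \<and> k = Suc i") force+
      then show ?thesis by simp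
    qed (use Suc that in simp)
    then show ?case using Suc.prems i
      by (simp add: pow_Suc_index sum.neutral del: pow_mat.simps)
  qed
  then have "(P ^\<^sub>m n) $$ (Suc i, i) = 0" for n using i by simp
  then show False using irr i unfolding irreducible_kernel_def
    by (metis Suc_leI less_imp_le_nat order_less_irrefl)
qed

text \<open>The characteristic polynomial of the trailing \<open>n \<times> n\<close> block of \<open>P\<close>.\<close>

definition trailing_poly :: "nat \<Rightarrow> real poly" where
  "trailing_poly = jacobi_poly (\<lambda>n. P $$ (d - n, d - n))
     (\<lambda>n. P $$ (d - Suc n, d - n) * P $$ (d - n, d - Suc n))"

lemma trailing_poly_full: "trailing_poly (Suc d) = (\<Prod>i\<le>d. [:- \<theta> i, 1:])"
proof -
  \<comment> \<open>The entries of \<open>x - P\<close>, with the tridiagonal shape imposed at all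
    indices, also those outside the matrix.\<close>
  define f :: "nat \<Rightarrow> nat \<Rightarrow> real poly" where
    "f i j = (if i = j then [:- P $$ (i, j), 1:]
       else if j = Suc i \<or> i = Suc j then [:- P $$ (i, j):] else 0)" for i j
  have "det (shifted_mat f (Suc d) (Suc d - Suc d)) = trailing_poly (Suc d)"
    unfolding trailing_poly_def
    by (rule det_tridiagonal_jacobi_poly[where p = "\<lambda>i j. P $$ (i, j)"]) (auto simp: f_def)
  moreover have "char_poly_matrix P = shifted_mat f (Suc d) (Suc d - Suc d)"
    using P_carrier
    by (intro eq_matI) (auto simp: char_poly_matrix_def shifted_mat_def f_def intro!: P_tri)
  ultimately show ?thesis using eig by (simp add: eigenvalue_list_def char_poly_def)
qed

text \<open>By interlacing, the \<open>j\<close>-th largest root can only rise as the block is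
  enlarged, and for the full block it is the \<open>j\<close>-th largest eigenvalue
  \<open>\<theta> (d - j)\<close>.\<close>

lemma trailing_poly_roots:
  assumes "n \<le> Suc d"
  obtains \<kappa> where "trailing_poly n = (\<Prod>j<n. [:- \<kappa> j, 1:])"
    "\<And>i j. i \<le> j \<Longrightarrow> j < n \<Longrightarrow> \<kappa> j \<le> \<kappa> i" "\<And>j. j < n \<Longrightarrow> \<kappa> j \<le> \<theta> (d - j)"
proof -
  have "0 < P $$ (d - Suc i, d - i) * P $$ (d - i, d - Suc i)" if "Suc i < Suc d" for i
    using up_pos[of "d - Suc i"] down_pos[of "d - Suc i"] that by (simp add: Suc_diff_Suc)
  then obtain \<kappa> where k1: "\<And>m. m \<le> Suc d \<Longrightarrow> trailing_poly m = (\<Prod>j<m. [:- \<kappa> m j, 1:])"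
    and k2: "\<And>m j. m < Suc d \<Longrightarrow> j < m \<Longrightarrow> \<kappa> m j < \<kappa> (Suc m) j \<and> \<kappa> (Suc m) (Suc j) < \<kappa> m j"
    using jacobi_poly_interlacing_roots[of "Suc d"
      "\<lambda>n. P $$ (d - Suc n, d - n) * P $$ (d - n, d - Suc n)" "\<lambda>n. P $$ (d - n, d - n)"]
    unfolding trailing_poly_def by blast
  have dec: "\<kappa> m (Suc j) < \<kappa> m j" if "m \<le> Suc d" "Suc j < m" for m j
    using k2[of "m - 1" j] that by (cases m) auto
  have anti: "\<kappa> m j \<le> \<kappa> m i" if "m \<le> Suc d" "i \<le> j" "j < m" for m i j
    using antimono_from_step[of m "\<kappa> m" i j] dec that by auto
  have up: "\<kappa> m j \<le> \<kappa> (m + l) j" if "m + l \<le> Suc d" "j < m" for m l j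
    using that
  proof (induction l)
    case (Suc l)
    then show ?case using k2[of "m + l" j] by force
  qed simp
  \<comment> \<open>Equal products have equal root sets. Interlacing makes the \<open>d + 1\<close>
    roots distinct, hence \<open>\<theta>\<close> is injective too, and the two increasing
    enumerations of one set coincide.\<close>
  have top: "\<kappa> (Suc d) j = \<theta> (d - j)" if "j < Suc d" for j
  proof -
    have eq: "(\<Prod>j<Suc d. [:- \<kappa> (Suc d) j, 1:]) = (\<Prod>i\<le>d. [:- \<theta> i, 1:])"
      using k1[of "Suc d"] trailing_poly_full by simp
    have "x \<in> \<kappa> (Suc d) ` {..<Suc d} \<longleftrightarrow> x \<in> \<theta> ` {..d}" for x
    proof -
      have "poly (\<Prod>j<Suc d. [:- \<kappa> (Suc d) j, 1:]) x = 0 \<longleftrightarrow> poly (\<Prod>i\<le>d. [:- \<theta> i, 1:]) x = 0"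
        by (simp only: eq)
      then show ?thesis
        by (auto simp: poly_prod prod_zero_iff image_iff simp del: prod.lessThan_Suc)
    qed
    then have im: "\<kappa> (Suc d) ` {..<Suc d} = \<theta> ` {..d}" by blast
    have str: "\<kappa> (Suc d) j < \<kappa> (Suc d) i" if "i < j" "j < Suc d" for i j
      using anti[of "Suc d" "Suc i" j] dec[of "Suc d" i] that by simp
    then have "inj_on (\<kappa> (Suc d)) {..<Suc d}"
      by (metis inj_onI lessThan_iff less_irrefl nat_neq_iff)
    then have "card (\<theta> ` {..d}) = Suc d" using im by (metis card_image card_lessThan)
    then have inj: "inj_on \<theta> {..d}" by (intro eq_card_imp_inj_on) auto
    let ?l1 = "map (\<lambda>j. \<kappa> (Suc d) (d - j)) [0..<Suc d]" and ?l2 = "map \<theta> [0..<Suc d]"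
    have "?l1 = ?l2"
    proof (rule sorted_distinct_set_unique)
      show "sorted ?l1" unfolding sorted_iff_nth_mono
        using anti[of "Suc d"] by (auto simp: nth_append less_Suc_eq_le simp del: upt_Suc)
      show "sorted ?l2" unfolding sorted_iff_nth_mono
        using theta_mono by (auto simp: less_Suc_eq_le simp del: upt_Suc)
      show "distinct ?l2" using inj by (simp add: distinct_map atLeast0LessThan lessThan_Suc_atMost del: upt_Suc)
      have "(-) d ` {0..<Suc d} = {..<Suc d}"
        by (auto simp: image_iff) (metis atLeastLessThan_iff diff_diff_cancel diff_le_self le0 less_Suc_eq_le)
      then have "set ?l1 = \<kappa> (Suc d) ` {..<Suc d}"
        by (simp add: image_image[symmetric] del: upt_Suc lessThan_Suc)
      then show "set ?l1 = set ?l2" using im by (simp add: atLeast0LessThan lessThan_Suc_atMost del: upt_Suc)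
      then show "distinct ?l1" using \<open>distinct ?l2\<close>
        by (metis (no_types, lifting) card_distinct distinct_card length_map)
    qed
    then have "?l1 ! (d - j) = ?l2 ! (d - j)" by (rule arg_cong)
    moreover have "[0..<Suc d] ! (d - j) = d - j" "d - (d - j) = j" using that by (simp_all del: upt_Suc)
    ultimately show ?thesis by (simp del: upt_Suc)
  qed
  show thesis
  proof (rule that[of "\<kappa> n"])
    show "\<kappa> n j \<le> \<theta> (d - j)" if "j < n" for j
      using up[of n "Suc d - n" j] top[of j] that assms by simp
  qed (use k1 anti assms in auto)
qed

section \<open>Rows of the link as divided differences\<close>

abbreviation top_eig :: "nat \<Rightarrow> real" where
  "top_eig j \<equiv> \<theta> (d - j)"

definition up_prod :: "nat \<Rightarrow> real" where
  "up_prod y = (\<Prod>i<y. P $$ (i, Suc i))"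

text \<open>Row \<open>k\<close> of the link before normalization. The nodes
  \<open>top_eig 0, ..., top_eig (d - k)\<close> are \<open>\<theta> d\<close> down to
  \<open>\<theta> k\<close>, so that the node lost when \<open>k\<close> increases is always the
  last one, where \<open>divdiff\<close> starts dividing.\<close>

definition row_poly :: "nat \<Rightarrow> nat \<Rightarrow> real" where
  "row_poly k y = up_prod y * divdiff top_eig (d - k) (trailing_poly (d - y))"

lemma up_prod_pos: "y \<le> d \<Longrightarrow> 0 < up_prod y"
  unfolding up_prod_def by (intro prod_pos) (auto intro: up_pos)

lemma row_poly_nonneg: "k \<le> d \<Longrightarrow> y \<le> d \<Longrightarrow> 0 \<le> row_poly k y"
proof -
  assume "k \<le> d" "y \<le> d"
  obtain \<kappa> where k: "trailing_poly (d - y) = (\<Prod>j<d - y. [:- \<kappa> j, 1:])"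
    "\<And>i j. i \<le> j \<Longrightarrow> j < d - y \<Longrightarrow> \<kappa> j \<le> \<kappa> i" "\<And>j. j < d - y \<Longrightarrow> \<kappa> j \<le> \<theta> (d - j)"
    by (rule trailing_poly_roots[of "d - y"]) auto
  show ?thesis
    unfolding row_poly_def k(1) using up_prod_pos[OF \<open>y \<le> d\<close>] k(2,3)
    by (intro mult_nonneg_nonneg divdiff_prod_nonneg) auto
qed

lemma sum_column:
  assumes "y \<le> d"
  shows "(\<Sum>x\<le>d. g x * P $$ (x, y)) = (if y = 0 then 0 else g (y - 1) * P $$ (y - 1, y))
    + g y * P $$ (y, y) + (if y = d then 0 else g (Suc y) * P $$ (Suc y, y))"
proof -
  let ?S = "(if y = 0 then {} else {y - 1}) \<union> {y} \<union> (if y = d then {} else {Suc y})"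
  have "(\<Sum>x\<le>d. g x * P $$ (x, y)) = (\<Sum>x\<in>?S. g x * P $$ (x, y))"
  proof (rule sum.mono_neutral_right)
    show "\<forall>x\<in>{..d} - ?S. g x * P $$ (x, y) = 0"
    proof
      fix x assume "x \<in> {..d} - ?S"
      then have "P $$ (x, y) = 0" using assms by (intro P_tri) (auto split: if_splits)
      then show "g x * P $$ (x, y) = 0" by simp
    qed
  qed (use assms in auto)
  also have "\<dots> = (if y = 0 then 0 else g (y - 1) * P $$ (y - 1, y))
    + g y * P $$ (y, y) + (if y = d then 0 else g (Suc y) * P $$ (Suc y, y))"
    by (auto simp: insert_commute)
  finally show ?thesis .
qed

text \<open>Multiplying the row by \<open>P\<close> multiplies the underlying polynomial by
  \<open>x\<close>: this is the three-term recurrence of \<open>trailing_poly\<close>, solved for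
  \<open>x\<close> times the middle term.\<close>

lemma row_poly_mult:
  assumes "k \<le> d" "y \<le> d"
  shows "(\<Sum>x\<le>d. row_poly k x * P $$ (x, y)) =
    up_prod y * divdiff top_eig (d - k) ([:0, 1:] * trailing_poly (d - y))"
proof -
  let ?D = "divdiff top_eig (d - k)"
  \<comment> \<open>At \<open>y = 0\<close> there is no left neighbour, while the recurrence still
    produces \<open>trailing_poly (Suc d)\<close>. This is the characteristic polynomial, which
    contains all nodes as roots and so contributes zero.\<close>
  have prev: "(if y = 0 then 0 else row_poly k (y - 1) * P $$ (y - 1, y)) =
      up_prod y * ?D (trailing_poly (Suc d - y))"
  proof (cases y)
    case 0
    have "(\<Prod>i\<le>d. [:- \<theta> i, 1:]) = (\<Prod>j\<le>d. [:- top_eig j, 1:])"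
      by (rule prod.reindex_bij_witness[of _ "\<lambda>j. d - j" "\<lambda>j. d - j"]) auto
    also have "\<dots> = (\<Prod>j\<in>{Suc (d - k)..d}. [:- top_eig j, 1:]) * (\<Prod>j\<le>d - k. [:- top_eig j, 1:])"
      by (subst prod.union_disjoint[symmetric]) (auto intro: prod.cong)
    finally show ?thesis using 0 by (simp add: trailing_poly_full divdiff_annihilates)
  next
    case (Suc x)
    then show ?thesis using assms by (simp add: row_poly_def up_prod_def Suc_diff_Suc)
  qed
  have rec: "?D (trailing_poly (Suc d - y)) + P $$ (y, y) * ?D (trailing_poly (d - y)) +
      (if y = d then 0 else P $$ (y, Suc y) * P $$ (Suc y, y) * ?D (trailing_poly (d - Suc y))) =
      ?D ([:0, 1:] * trailing_poly (d - y))"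
  proof (cases "y = d")
    case True
    have "[:0, 1:] * trailing_poly 0 = trailing_poly (Suc 0) + Polynomial.smult (P $$ (d, d)) (trailing_poly 0)"
      by (simp add: trailing_poly_def)
    then show ?thesis using True by (simp add: divdiff_add divdiff_smult Suc_diff_Suc)
  next
    case False
    define n where "n = d - Suc y"
    have n: "d - y = Suc n" "Suc d - y = Suc (Suc n)" "d - Suc n = y" "d - n = Suc y"
      using False assms by (auto simp: n_def)
    have "[:0, 1:] * trailing_poly (Suc n) = trailing_poly (Suc (Suc n))
        + Polynomial.smult (P $$ (y, y)) (trailing_poly (Suc n))
        + Polynomial.smult (P $$ (y, Suc y) * P $$ (Suc y, y)) (trailing_poly n)"
      by (simp add: trailing_poly_def n)
    then show ?thesis using False n
      by (simp add: divdiff_add divdiff_smult del: mult_pCons_left flip: n_def)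
  qed
  have "(\<Sum>x\<le>d. row_poly k x * P $$ (x, y)) = up_prod y * ?D (trailing_poly (Suc d - y))
      + row_poly k y * P $$ (y, y) + (if y = d then 0 else row_poly k (Suc y) * P $$ (Suc y, y))"
    using sum_column[OF assms(2), of "row_poly k"] prev by simp
  also have "\<dots> = up_prod y * ?D ([:0, 1:] * trailing_poly (d - y))"
    unfolding rec[symmetric] by (auto simp: row_poly_def up_prod_def algebra_simps)
  finally show ?thesis .
qed

text \<open>The Leibniz rule for the factor \<open>x\<close> at the last node
  \<open>\<theta> k\<close>: subtracting \<open>\<theta> k\<close> times the row leaves the divided
  difference without that node.\<close>

lemma row_poly_step:
  assumes "k < d" "y \<le> d"
  shows "row_poly (Suc k) y = (\<Sum>x\<le>d. row_poly k x * P $$ (x, y)) - \<theta> k * row_poly k y"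
proof -
  define m where "m = d - Suc k"
  have m: "d - k = Suc m" "d - Suc m = k" using assms by (auto simp: m_def)
  have "divdiff top_eig (Suc m) ([:- 0, 1:] * trailing_poly (d - y)) =
    \<theta> k * divdiff top_eig (Suc m) (trailing_poly (d - y)) + divdiff top_eig m (trailing_poly (d - y))"
    unfolding divdiff_linear_mult_general using m by simp
  then show ?thesis
    using row_poly_mult[of k y] assms m
    by (simp add: row_poly_def algebra_simps del: divdiff.simps mult_pCons_left flip: m_def)
qed

lemma degree_trailing: "degree (trailing_poly n) = n" "coeff (trailing_poly n) n = 1"
  using jacobi_poly_monic unfolding trailing_poly_def by (metis+)

text \<open>With all \<open>d + 1\<close> nodes the divided difference reads off coefficient
  \<open>d\<close> of a monic polynomial of degree \<open>d - y\<close>.\<close>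

lemma row_poly_0: "y \<le> d \<Longrightarrow> row_poly 0 y = (if y = 0 then 1 else 0)"
  unfolding row_poly_def
  by (subst divdiff_degree_le) (auto simp: degree_trailing up_prod_def coeff_eq_0)

lemma spectral_poly_carrier: "spectral_poly d P \<theta> k \<in> carrier_mat (Suc d) (Suc d)"
  using P_carrier by (induction k) auto

lemma spectral_poly_step:
  assumes "y \<le> d"
  shows "spectral_poly d P \<theta> (Suc k) $$ (0, y) = inverse (1 - \<theta> k) *
    ((\<Sum>x\<le>d. spectral_poly d P \<theta> k $$ (0, x) * P $$ (x, y)) - \<theta> k * spectral_poly d P \<theta> k $$ (0, y))"
proof -
  let ?Q = "spectral_poly d P \<theta> k" and ?R = "P - \<theta> k \<cdot>\<^sub>m 1\<^sub>m (Suc d)"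
  have c: "?Q \<in> carrier_mat (Suc d) (Suc d)" "?R \<in> carrier_mat (Suc d) (Suc d)"
    using spectral_poly_carrier P_carrier by auto
  have "(?Q * ?R) $$ (0, y) = (\<Sum>x\<in>{0..<Suc d}. ?Q $$ (0, x) * ?R $$ (x, y))"
    using c assms by (simp add: scalar_prod_def del: sum.op_ivl_Suc)
  also have "\<dots> = (\<Sum>x\<le>d. ?Q $$ (0, x) * (P $$ (x, y) - (if x = y then \<theta> k else 0)))"
    using assms P_carrier by (intro sum.cong) auto
  also have "\<dots> = (\<Sum>x\<le>d. ?Q $$ (0, x) * P $$ (x, y)) - (\<Sum>x\<le>d. if x = y then \<theta> k * ?Q $$ (0, x) else 0)"
    unfolding sum_subtractf[symmetric] by (intro sum.cong) (auto simp: algebra_simps)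
  finally show ?thesis using c assms by simp
qed

text \<open>Both families start from the unit vector at 0 and obey the same recursion in
  \<open>k\<close>, up to the normalizing factors \<open>1 - \<theta> i\<close>.\<close>

lemma link_row_poly:
  assumes "k \<le> d" "y \<le> d"
  shows "link d P \<theta> $$ (k, y) = row_poly k y / (\<Prod>i<k. 1 - \<theta> i)"
proof -
  have "spectral_poly d P \<theta> k $$ (0, y) = row_poly k y / (\<Prod>i<k. 1 - \<theta> i)"
    using assms
  proof (induction k arbitrary: y)
    case 0
    then show ?case by (simp add: row_poly_0)
  next
    case (Suc k)
    let ?c = "\<Prod>i<k. 1 - \<theta> i"
    have "spectral_poly d P \<theta> (Suc k) $$ (0, y) = inverse (1 - \<theta> k) *
        ((\<Sum>x\<le>d. row_poly k x / ?c * P $$ (x, y)) - \<theta> k * (row_poly k y / ?c))"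
      using Suc by (simp add: spectral_poly_step del: spectral_poly.simps)
    also have "\<dots> = inverse (1 - \<theta> k) * (row_poly (Suc k) y / ?c)"
      using row_poly_step[of k y] Suc.prems by (simp add: diff_divide_distrib flip: sum_divide_distrib)
    finally show ?case by (simp add: field_simps del: spectral_poly.simps)
  qed
  then show ?thesis using assms by (simp add: link_def)
qed

lemma link_nonneg: "k \<le> d \<Longrightarrow> y \<le> d \<Longrightarrow> 0 \<le> link d P \<theta> $$ (k, y)"
  by (auto simp: link_row_poly intro!: divide_nonneg_nonneg row_poly_nonneg prod_nonneg theta_le_1)

text \<open>For \<open>k < y\<close> the polynomial has degree \<open>d - y\<close>, below the order
  \<open>d - k\<close> of the divided difference.\<close>

lemma link_eq_0: "k \<le> d \<Longrightarrow> y \<le> d \<Longrightarrow> k < y \<Longrightarrow> link d P \<theta> $$ (k, y) = 0"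
  by (simp add: link_row_poly row_poly_def divdiff_degree_le degree_trailing coeff_eq_0)

lemma link_0: "y \<le> d \<Longrightarrow> link d P \<theta> $$ (0, y) = (if y = 0 then 1 else 0)"
  by (simp add: link_row_poly row_poly_0)

text \<open>The recursion defining \<open>spectral_poly\<close>, solved for the product of row
  \<open>k\<close> with \<open>P\<close>. It is row \<open>k < d\<close> of the intertwining of
  \<open>P\<close> with the pure-birth kernel.\<close>

lemma link_intertwines:
  assumes "k < d" "y \<le> d"
  shows "(\<Sum>x\<le>d. link d P \<theta> $$ (k, x) * P $$ (x, y)) =
    \<theta> k * link d P \<theta> $$ (k, y) + (1 - \<theta> k) * link d P \<theta> $$ (Suc k, y)"
proof -
  have "1 - \<theta> k \<noteq> 0" using thlt assms by auto
  then have "(1 - \<theta> k) * spectral_poly d P \<theta> (Suc k) $$ (0, y) =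
      (\<Sum>x\<le>d. spectral_poly d P \<theta> k $$ (0, x) * P $$ (x, y)) - \<theta> k * spectral_poly d P \<theta> k $$ (0, y)"
    unfolding spectral_poly_step[OF assms(2)] by (simp only: mult.assoc[symmetric] right_inverse) simp
  then show ?thesis using assms by (simp add: link_def del: spectral_poly.simps)
qed

text \<open>Summing the intertwining over \<open>y\<close> gives
  \<open>1 = \<theta> k + (1 - \<theta> k) * s\<close>, with \<open>s\<close> the next row sum, and
  \<open>\<theta> k < 1\<close>.\<close>

lemma link_sum: "k \<le> d \<Longrightarrow> (\<Sum>y\<le>d. link d P \<theta> $$ (k, y)) = 1"
proof (induction k)
  case 0
  then show ?case by (simp add: link_0)
next
  case (Suc k)
  let ?L = "\<lambda>k y. link d P \<theta> $$ (k, y)"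
  have "(\<Sum>y\<le>d. \<theta> k * ?L k y + (1 - \<theta> k) * ?L (Suc k) y) =
      (\<Sum>y\<le>d. \<Sum>x\<le>d. ?L k x * P $$ (x, y))"
    using Suc.prems by (intro sum.cong) (auto simp: link_intertwines)
  also have "\<dots> = (\<Sum>x\<le>d. ?L k x * (\<Sum>y\<le>d. P $$ (x, y)))"
    by (subst sum.swap) (simp add: sum_distrib_left)
  also have "\<dots> = 1" using Suc by (simp add: P_sum)
  finally have "\<theta> k + (1 - \<theta> k) * (\<Sum>y\<le>d. ?L (Suc k) y) = 1"
    using Suc by (simp add: sum.distrib flip: sum_distrib_left)
  moreover have "1 - \<theta> k \<noteq> 0" using thlt Suc.prems by (auto dest: spec[of _ k])
  ultimately show ?case by (metis add_diff_cancel_left' mult_cancel_left2)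
qed

text \<open>In the last row the only node left is \<open>\<theta> d = 1\<close>, where
  multiplication by \<open>x\<close> changes nothing.\<close>

lemma link_last_invariant:
  assumes "y \<le> d"
  shows "(\<Sum>x\<le>d. link d P \<theta> $$ (d, x) * P $$ (x, y)) = link d P \<theta> $$ (d, y)"
proof -
  have "(\<Sum>x\<le>d. row_poly d x * P $$ (x, y)) = row_poly d y"
    using row_poly_mult[of d y] assms by (simp add: row_poly_def thd)
  then show ?thesis using assms by (simp add: link_row_poly flip: sum_divide_distrib)
qed

lemma link_last_last_pos: "0 < link d P \<theta> $$ (d, d)"
proof -
  have "row_poly d d = up_prod d" by (simp add: row_poly_def trailing_poly_def)
  moreover have "0 < (\<Prod>i<d. 1 - \<theta> i)" using thlt by (intro prod_pos) auto
  ultimately show ?thesis using up_prod_pos[of d] by (simp add: link_row_poly)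
qed

text \<open>Column \<open>x\<close> of the invariance equation determines \<open>g (Suc x)\<close>
  from the two earlier values, because \<open>P(x+1, x) > 0\<close>. An invariant vector is
  therefore fixed by its value at 0.\<close>

lemma invariant_eq_0:
  assumes inv: "\<And>y. y \<le> d \<Longrightarrow> (\<Sum>x\<le>d. g x * P $$ (x, y)) = g y" and g0: "g 0 = 0" and "y \<le> d"
  shows "g y = 0"
  using assms(3)
proof (induction y rule: less_induct)
  case (less y)
  show ?case
  proof (cases y)
    case (Suc x)
    have "(if x = 0 then 0 else g (x - 1) * P $$ (x - 1, x)) + g x * P $$ (x, x) +
        g (Suc x) * P $$ (Suc x, x) = g x"
      using inv[of x] sum_column[of x g] less.prems Suc by simp
    moreover have "g x = 0" "x \<noteq> 0 \<Longrightarrow> g (x - 1) = 0" using less Suc by auto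
    ultimately have "g (Suc x) * P $$ (Suc x, x) = 0" by (auto split: if_splits)
    then show ?thesis using down_pos[of x] Suc less.prems by auto
  qed (use g0 in simp)
qed

text \<open>The combination of the two invariant vectors that cancels at 0 is zero everywhere, so
  they are proportional; both have total mass 1.\<close>

lemma stationary_eq_link:
  assumes st: "stationary_distribution d P \<pi>" and y: "y \<le> d"
  shows "\<pi> y = link d P \<theta> $$ (d, y)"
proof -
  let ?l = "\<lambda>y. link d P \<theta> $$ (d, y)"
  have inv: "(\<Sum>x\<le>d. \<pi> x * P $$ (x, y)) = \<pi> y" if "y \<le> d" for y
    using st that by (simp add: stationary_distribution_def)
  have s: "(\<Sum>y\<le>d. \<pi> y) = 1" using st by (simp add: stationary_distribution_def)
  have "?l 0 * \<pi> y - \<pi> 0 * ?l y = 0" if "y \<le> d" for y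
  proof (rule invariant_eq_0[OF _ _ that])
    fix y assume "y \<le> d"
    then show "(\<Sum>x\<le>d. (?l 0 * \<pi> x - \<pi> 0 * ?l x) * P $$ (x, y)) = ?l 0 * \<pi> y - \<pi> 0 * ?l y"
      using inv link_last_invariant
      by (simp add: left_diff_distrib sum_subtractf mult.assoc flip: sum_distrib_left)
  qed simp
  then have eq: "?l 0 * \<pi> y = \<pi> 0 * ?l y" if "y \<le> d" for y using that by simp
  have "(\<Sum>y\<le>d. ?l 0 * \<pi> y) = (\<Sum>y\<le>d. \<pi> 0 * ?l y)" using eq by (intro sum.cong) auto
  then have l0: "?l 0 = \<pi> 0" using s link_sum[of d] by (simp flip: sum_distrib_left)
  have "?l 0 \<noteq> 0"
    using invariant_eq_0[of ?l d] link_last_invariant link_last_last_pos by auto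
  then show ?thesis using eq[OF y] l0 by simp
qed

end

section \<open>Path events and the joint law of the chain and its dual\<close>

context prob_space
begin

text \<open>A history event is encoded as a predicate \<open>Q\<close> on whole paths that ignores
  times after \<open>t\<close>. With finitely many states it splits into finitely many path atoms,
  represented by functions restricted to \<open>{..t}\<close>.\<close>

lemma path_event_decomposition:
  fixes V :: "nat \<Rightarrow> 'a \<Rightarrow> 'b"
  assumes S: "finite S" "\<And>s \<omega>. \<omega> \<in> space M \<Longrightarrow> V s \<omega> \<in> S"
    and V: "\<And>s v. {\<omega> \<in> space M. V s \<omega> = v} \<in> events"
    and Q: "\<And>f g. (\<And>s. s \<le> t \<Longrightarrow> f s = g s) \<Longrightarrow> Q f \<longleftrightarrow> Q g"
    and R: "{\<omega> \<in> space M. R \<omega>} \<in> events"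
  shows "\<P>(\<omega> in M. Q (\<lambda>s. V s \<omega>) \<and> R \<omega>) =
      (\<Sum>v\<in>{v \<in> {..t} \<rightarrow>\<^sub>E S. Q v}. \<P>(\<omega> in M. (\<forall>s\<le>t. V s \<omega> = v s) \<and> R \<omega>))"
    and "{\<omega> \<in> space M. Q (\<lambda>s. V s \<omega>)} \<in> events"
proof -
  let ?I = "{v \<in> {..t} \<rightarrow>\<^sub>E S. Q v}"
  have fin: "finite ?I" using S(1) by (simp add: finite_PiE)
  have atom: "{\<omega> \<in> space M. \<forall>s\<le>t. V s \<omega> = v s} \<in> events" for v
  proof -
    have "{\<omega> \<in> space M. \<forall>s\<in>{..t}. V s \<omega> = v s} \<in> events"
    proof (rule sets.sets_Collect_finite_All[of "{..t}" M "\<lambda>s \<omega>. V s \<omega> = v s"])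
      show "{\<omega> \<in> space M. V s \<omega> = v s} \<in> events" for s by (rule V)
    qed simp_all
    then show ?thesis by (simp only: Ball_def atMost_iff)
  qed
  have ev: "{\<omega> \<in> space M. (\<forall>s\<le>t. V s \<omega> = v s) \<and> R \<omega>} \<in> events" for v
    by (rule sets.sets_Collect_conj[OF R atom])
  have restr: "Q (restrict f {..t}) \<longleftrightarrow> Q f" for f by (rule Q) simp
  have mem: "restrict (\<lambda>s. V s \<omega>) {..t} \<in> {..t} \<rightarrow>\<^sub>E S" if "\<omega> \<in> space M" for \<omega>
    using S(2) that by auto
  have un: "{\<omega> \<in> space M. Q (\<lambda>s. V s \<omega>) \<and> R \<omega>} =
      (\<Union>v\<in>?I. {\<omega> \<in> space M. (\<forall>s\<le>t. V s \<omega> = v s) \<and> R \<omega>})" for R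
  proof (intro Set.set_eqI iffI)
    fix \<omega> assume "\<omega> \<in> {\<omega> \<in> space M. Q (\<lambda>s. V s \<omega>) \<and> R \<omega>}"
    then show "\<omega> \<in> (\<Union>v\<in>?I. {\<omega> \<in> space M. (\<forall>s\<le>t. V s \<omega> = v s) \<and> R \<omega>})"
      using mem restr by (intro UN_I[of "restrict (\<lambda>s. V s \<omega>) {..t}"]) auto
  next
    fix \<omega> assume "\<omega> \<in> (\<Union>v\<in>?I. {\<omega> \<in> space M. (\<forall>s\<le>t. V s \<omega> = v s) \<and> R \<omega>})"
    then obtain v where "Q v" "\<omega> \<in> space M" "\<forall>s\<le>t. V s \<omega> = v s" "R \<omega>" by auto
    moreover from this have "Q (\<lambda>s. V s \<omega>)" using Q[of "\<lambda>s. V s \<omega>" v] by auto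
    ultimately show "\<omega> \<in> {\<omega> \<in> space M. Q (\<lambda>s. V s \<omega>) \<and> R \<omega>}" by simp
  qed
  have disj: "disjoint_family_on (\<lambda>v. {\<omega> \<in> space M. (\<forall>s\<le>t. V s \<omega> = v s) \<and> R \<omega>}) ?I"
  proof (unfold disjoint_family_on_def, intro ballI impI)
    fix v w assume vw: "v \<in> ?I" "w \<in> ?I" "v \<noteq> w"
    have "\<exists>s\<le>t. v s \<noteq> w s"
    proof (rule ccontr)
      assume "\<not> ?thesis"
      then have "v = w" using vw(1,2) by (intro PiE_ext[of v "{..t}" "\<lambda>_. S" w]) auto
      then show False using vw(3) by simp
    qed
    then obtain s where "s \<le> t" "v s \<noteq> w s" by blast
    then show "{\<omega> \<in> space M. (\<forall>s\<le>t. V s \<omega> = v s) \<and> R \<omega>} \<inter>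
        {\<omega> \<in> space M. (\<forall>s\<le>t. V s \<omega> = w s) \<and> R \<omega>} = {}" by auto
  qed
  show "\<P>(\<omega> in M. Q (\<lambda>s. V s \<omega>) \<and> R \<omega>) =
      (\<Sum>v\<in>?I. \<P>(\<omega> in M. (\<forall>s\<le>t. V s \<omega> = v s) \<and> R \<omega>))"
    unfolding un[of R] using ev by (intro finite_measure_finite_Union fin disj) blast
  have "{\<omega> \<in> space M. Q (\<lambda>s. V s \<omega>)} = (\<Union>v\<in>?I. {\<omega> \<in> space M. \<forall>s\<le>t. V s \<omega> = v s})"
    using un[of "\<lambda>_. True"] by (simp only: simp_thms)
  also have "\<dots> \<in> events" using atom by (intro sets.finite_UN fin) blast
  finally show "{\<omega> \<in> space M. Q (\<lambda>s. V s \<omega>)} \<in> events" .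
qed

text \<open>A conditional probability that has the same value \<open>c\<close> on each atom of a
  history event has that value on the event. Markov-type identities thus need checking on single
  paths only.\<close>

lemma path_event_scale:
  fixes V :: "nat \<Rightarrow> 'a \<Rightarrow> 'b"
  assumes "finite S" "\<And>s \<omega>. \<omega> \<in> space M \<Longrightarrow> V s \<omega> \<in> S"
    and "\<And>s v. {\<omega> \<in> space M. V s \<omega> = v} \<in> events"
    and "\<And>f g. (\<And>s. s \<le> t \<Longrightarrow> f s = g s) \<Longrightarrow> Q f \<longleftrightarrow> Q g"
    and "{\<omega> \<in> space M. R \<omega>} \<in> events" "{\<omega> \<in> space M. R' \<omega>} \<in> events"
    and "\<And>v. Q v \<Longrightarrow> \<P>(\<omega> in M. (\<forall>s\<le>t. V s \<omega> = v s) \<and> R \<omega>) = c * \<P>(\<omega> in M. (\<forall>s\<le>t. V s \<omega> = v s) \<and> R' \<omega>)"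
  shows "\<P>(\<omega> in M. Q (\<lambda>s. V s \<omega>) \<and> R \<omega>) = c * \<P>(\<omega> in M. Q (\<lambda>s. V s \<omega>) \<and> R' \<omega>)"
proof -
  let ?I = "{v \<in> {..t} \<rightarrow>\<^sub>E S. Q v}"
  have "\<P>(\<omega> in M. Q (\<lambda>s. V s \<omega>) \<and> R \<omega>) = (\<Sum>v\<in>?I. \<P>(\<omega> in M. (\<forall>s\<le>t. V s \<omega> = v s) \<and> R \<omega>))"
    by (rule path_event_decomposition(1)[of S V t Q R]) (fact assms)+
  also have "\<dots> = (\<Sum>v\<in>?I. c * \<P>(\<omega> in M. (\<forall>s\<le>t. V s \<omega> = v s) \<and> R' \<omega>))"
    by (intro sum.cong refl assms(7)) simp
  also have "\<dots> = c * (\<Sum>v\<in>?I. \<P>(\<omega> in M. (\<forall>s\<le>t. V s \<omega> = v s) \<and> R' \<omega>))"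
    by (rule sum_distrib_left[symmetric])
  also have "(\<Sum>v\<in>?I. \<P>(\<omega> in M. (\<forall>s\<le>t. V s \<omega> = v s) \<and> R' \<omega>)) = \<P>(\<omega> in M. Q (\<lambda>s. V s \<omega>) \<and> R' \<omega>)"
    by (rule path_event_decomposition(1)[of S V t Q R', symmetric]) (fact assms)+
  finally show ?thesis .
qed

lemma prob_pos_witness:
  assumes "0 < \<P>(\<omega> in M. R \<omega>)"
  obtains \<omega> where "\<omega> \<in> space M" "R \<omega>"
proof (cases "{\<omega> \<in> space M. R \<omega>} = {}")
  case True
  then have "\<P>(\<omega> in M. R \<omega>) = 0" by (simp only: measure_empty)
  then show ?thesis using assms by linarith
qed (use that in blast)

lemma prob_sum_values:
  assumes "\<And>\<omega>. \<omega> \<in> space M \<Longrightarrow> Y \<omega> \<le> (d::nat)" "\<And>y. {\<omega> \<in> space M. Y \<omega> = y} \<in> events"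
    and "{\<omega> \<in> space M. R \<omega>} \<in> events"
  shows "\<P>(\<omega> in M. R \<omega>) = (\<Sum>y\<le>d. \<P>(\<omega> in M. R \<omega> \<and> Y \<omega> = y))"
proof -
  have un: "{\<omega> \<in> space M. R \<omega>} = (\<Union>y\<in>{..d}. {\<omega> \<in> space M. R \<omega> \<and> Y \<omega> = y})"
    using assms(1) by auto
  have "{\<omega> \<in> space M. R \<omega> \<and> Y \<omega> = y} \<in> events" for y
    by (rule sets.sets_Collect_conj[OF assms(2,3)])
  then show ?thesis
    by (subst un) (intro finite_measure_finite_Union, auto simp: disjoint_family_on_def)
qed

lemma bounded_nat_measurable:
  assumes "Y \<in> M \<rightarrow>\<^sub>M count_space {..d::nat}"
  shows "Y \<in> M \<rightarrow>\<^sub>M count_space UNIV" "\<omega> \<in> space M \<Longrightarrow> Y \<omega> \<le> d"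
    "{\<omega> \<in> space M. Y \<omega> = k} \<in> events"
proof -
  show *: "Y \<in> M \<rightarrow>\<^sub>M count_space UNIV"
    using measurable_compose[OF assms, of "\<lambda>x. x" "count_space UNIV"] by simp
  show "\<omega> \<in> space M \<Longrightarrow> Y \<omega> \<le> d" using measurable_space[OF assms] by simp
  show "{\<omega> \<in> space M. Y \<omega> = k} \<in> events" using * by measurable
qed

text \<open>The Markov property in product form, which also holds on null paths, where both sides
  vanish.\<close>

lemma markov_chain_path_step:
  assumes mc: "markov_chain M d K Z" and l: "l \<le> d"
  shows "\<P>(\<omega> in M. (\<forall>s\<le>t. Z s \<omega> = z s) \<and> Z (Suc t) \<omega> = l) =
    K $$ (z t, l) * \<P>(\<omega> in M. \<forall>s\<le>t. Z s \<omega> = z s)"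
proof -
  have Zm: "Z s \<in> M \<rightarrow>\<^sub>M count_space {..d}" for s using mc by (simp add: markov_chain_def)
  note [measurable] = bounded_nat_measurable(1)[OF Zm]
  show ?thesis
  proof (cases "0 < \<P>(\<omega> in M. \<forall>s\<le>t. Z s \<omega> = z s)")
    case True
    then have "\<P>(\<omega> in M. Z (Suc t) \<omega> = l \<bar> \<forall>s\<le>t. Z s \<omega> = z s) = K $$ (z t, l)"
      using mc l unfolding markov_chain_def by blast
    then show ?thesis using True by (simp add: cond_prob_def divide_eq_eq conj_commute[of "_ = l"])
  next
    case False
    then have 0: "\<P>(\<omega> in M. \<forall>s\<le>t. Z s \<omega> = z s) = 0"
      using leI[OF False] by (intro antisym measure_nonneg)
    have "\<P>(\<omega> in M. (\<forall>s\<le>t. Z s \<omega> = z s) \<and> Z (Suc t) \<omega> = l) \<le> \<P>(\<omega> in M. \<forall>s\<le>t. Z s \<omega> = z s)"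
      by (intro finite_measure_mono) auto
    then show ?thesis using 0 by (simp add: measure_le_0_iff)
  qed
qed

text \<open>The conjunct \<open>True\<close> is the trivial event \<open>R'\<close> of
  \<open>path_event_scale\<close>.\<close>

lemma markov_chain_history_step:
  assumes mc: "markov_chain M d K Z" and l: "l \<le> d"
    and Q: "\<And>f g. (\<And>s. s \<le> t \<Longrightarrow> f s = g s) \<Longrightarrow> Q f \<longleftrightarrow> Q g"
  shows "\<P>(\<omega> in M. (Q (\<lambda>s. Z s \<omega>) \<and> Z t \<omega> = k) \<and> Z (Suc t) \<omega> = l) =
    K $$ (k, l) * \<P>(\<omega> in M. (Q (\<lambda>s. Z s \<omega>) \<and> Z t \<omega> = k) \<and> True)"
proof -
  have Zm: "Z s \<in> M \<rightarrow>\<^sub>M count_space {..d}" for s using mc by (simp add: markov_chain_def)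
  have cong: "(Q f \<and> f t = k) \<longleftrightarrow> (Q g \<and> g t = k)" if "\<And>s. s \<le> t \<Longrightarrow> f s = g s" for f g
    using Q[of f g, OF that] that[of t] by simp
  have step: "\<P>(\<omega> in M. (\<forall>s\<le>t. Z s \<omega> = v s) \<and> Z (Suc t) \<omega> = l) =
        K $$ (k, l) * \<P>(\<omega> in M. (\<forall>s\<le>t. Z s \<omega> = v s) \<and> True)" if "Q v \<and> v t = k" for v
    using markov_chain_path_step[OF mc l, of t v] that by simp
  show ?thesis
  proof (rule path_event_scale[of "{..d}" Z t "\<lambda>f. Q f \<and> f t = k" "\<lambda>\<omega>. Z (Suc t) \<omega> = l" "\<lambda>_. True"], goal_cases)
    case (4 f g)
    then show ?case by (rule cong)
  next
    case (7 v)
    then show ?case by (rule step)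
  qed (use bounded_nat_measurable(2,3)[OF Zm] in simp_all)
qed

end

text \<open>The probability that the rule moves the dual from \<open>k\<close> to \<open>l\<close>
  when the new value of \<open>X\<close> is \<open>y\<close>. The last branch gives
  \<open>y > Suc k\<close> the same value as \<open>y = Suc k\<close>; the rule fixes nothing
  there.\<close>

definition dual_step :: "nat \<Rightarrow> real mat \<Rightarrow> (nat \<Rightarrow> real) \<Rightarrow> nat \<Rightarrow> nat \<Rightarrow> nat \<Rightarrow> real" where
  "dual_step d P \<theta> k y l =
     (if k = d then of_bool (l = d)
      else if y \<le> k then
        (if l = Suc k then birth_prob d P \<theta> k y else if l = k then 1 - birth_prob d P \<theta> k y else 0)
      else of_bool (l = Suc k))"

section \<open>The joint law of the chain and its dual\<close>

locale dual_chain = birth_death_spectrum d P \<theta> + prob_space M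
  for d P \<theta> and M :: "'a measure" +
  fixes X Z :: "nat \<Rightarrow> 'a \<Rightarrow> nat"
  assumes mcX: "markov_chain M d P X" and X0: "AE \<omega> in M. X 0 \<omega> = 0"
    and dual: "dual_construction M d P \<theta> X Z"
begin

lemma Xm: "X t \<in> M \<rightarrow>\<^sub>M count_space {..d}" and Zm: "Z t \<in> M \<rightarrow>\<^sub>M count_space {..d}"
  using mcX dual by (auto simp: markov_chain_def dual_construction_def)

lemmas X_meas [measurable] = bounded_nat_measurable(1)[OF Xm]
lemmas Z_meas [measurable] = bounded_nat_measurable(1)[OF Zm]
lemmas X_le = bounded_nat_measurable(2)[OF Xm]
lemmas Z_le = bounded_nat_measurable(2)[OF Zm]

lemma Z0: "AE \<omega> in M. Z 0 \<omega> = 0"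
  using dual by (simp add: dual_construction_def)

text \<open>Any property that holds almost surely on a path event of positive probability is
  witnessed by one of its points, and so is a property of the path itself.\<close>

lemma X_path_support:
  assumes "0 < \<P>(\<omega> in M. \<forall>s\<le>n. X s \<omega> = x s)"
  shows "x 0 = 0" "\<And>s. s \<le> n \<Longrightarrow> x s \<le> d" "\<And>s. s < n \<Longrightarrow> x (Suc s) \<le> Suc (x s)"
proof -
  have pos: "0 < \<P>(\<omega> in M. R \<omega>)"
    if "Measurable.pred M R" "AE \<omega> in M. (\<forall>s\<le>n. X s \<omega> = x s) \<longrightarrow> R \<omega>" for R
  proof -
    have "\<P>(\<omega> in M. \<forall>s\<le>n. X s \<omega> = x s) \<le> \<P>(\<omega> in M. R \<omega>)"
    proof (rule finite_measure_mono_AE)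
      show "AE \<omega> in M. \<omega> \<in> {\<omega> \<in> space M. \<forall>s\<le>n. X s \<omega> = x s} \<longrightarrow> \<omega> \<in> {\<omega> \<in> space M. R \<omega>}"
        using that(2) by eventually_elim auto
    qed (use that(1) in measurable)
    then show ?thesis using assms by simp
  qed
  have "0 < \<P>(\<omega> in M. X 0 \<omega> = x 0 \<and> X 0 \<omega> = 0)"
  proof (rule pos)
    show "AE \<omega> in M. (\<forall>s\<le>n. X s \<omega> = x s) \<longrightarrow> X 0 \<omega> = x 0 \<and> X 0 \<omega> = 0"
      using X0 by eventually_elim auto
  qed measurable
  then show "x 0 = 0" by (rule prob_pos_witness) simp
  show le: "x s \<le> d" if "s \<le> n" for s
  proof -
    have "0 < \<P>(\<omega> in M. X s \<omega> = x s)" using that by (intro pos) auto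
    then show ?thesis by (rule prob_pos_witness) (metis X_le)
  qed
  show "x (Suc s) \<le> Suc (x s)" if "s < n" for s
  proof (rule ccontr)
    assume "\<not> ?thesis"
    then have "P $$ (x s, x (Suc s)) = 0" using le that by (intro P_tri) auto
    moreover have "0 < \<P>(\<omega> in M. (\<forall>r\<le>s. X r \<omega> = x r) \<and> X (Suc s) \<omega> = x (Suc s))"
      using that by (intro pos) auto
    ultimately show False using markov_chain_path_step[OF mcX, of "x (Suc s)" s x] le[of "Suc s"] that by simp
  qed
qed

text \<open>One step of the invariant \<open>X \<le> Z\<close>; the premise
  \<open>y \<le> Suc k\<close> comes from the unit jumps of \<open>X\<close> and the invariant one
  step before.\<close>

lemma dual_step_support:
  assumes "dual_step d P \<theta> k y l \<noteq> 0" "k \<le> d" "y \<le> d" "y \<le> Suc k"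
  shows "y \<le> l"
  using assms by (auto simp: dual_step_def split: if_splits)

text \<open>The rule gives probabilities only for the admissible successors. These already add up to
  1, so every other value has conditional probability 0.\<close>

lemma next_prob_eq:
  assumes tn: "Suc t \<le> n" and pos: "0 < \<P>(\<omega> in M. (\<forall>s\<le>n. X s \<omega> = x s) \<and> (\<forall>s\<le>t. Z s \<omega> = z s))"
    and le: "x (Suc t) \<le> Suc (z t)"
  shows "\<P>(\<omega> in M. Z (Suc t) \<omega> = l \<and> (\<forall>s\<le>n. X s \<omega> = x s) \<and> (\<forall>s\<le>t. Z s \<omega> = z s)) =
    dual_step d P \<theta> (z t) (x (Suc t)) l * \<P>(\<omega> in M. (\<forall>s\<le>n. X s \<omega> = x s) \<and> (\<forall>s\<le>t. Z s \<omega> = z s))"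
proof -
  let ?E = "\<lambda>\<omega>. (\<forall>s\<le>n. X s \<omega> = x s) \<and> (\<forall>s\<le>t. Z s \<omega> = z s)"
  let ?np = "\<lambda>l. \<P>(\<omega> in M. Z (Suc t) \<omega> = l \<bar> ?E \<omega>)"
  have E: "\<P>(\<omega> in M. Z (Suc t) \<omega> = l \<and> ?E \<omega>) = ?np l * \<P>(\<omega> in M. ?E \<omega>)" for l
    using pos by (simp add: cond_prob_def)
  have dc: "(z t = d \<longrightarrow> ?np d = 1) \<and>
            (z t < d \<and> x (Suc t) \<le> z t \<longrightarrow>
               ?np (Suc (z t)) = birth_prob d P \<theta> (z t) (x (Suc t)) \<and>
               ?np (z t) = 1 - birth_prob d P \<theta> (z t) (x (Suc t))) \<and>
            (z t < d \<and> x (Suc t) = Suc (z t) \<longrightarrow> ?np (Suc (z t)) = 1)"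
    using dual tn pos unfolding dual_construction_def Let_def by blast
  have zt: "z t \<le> d"
  proof -
    obtain \<omega> where "\<omega> \<in> space M" "?E \<omega>"
      using pos by (rule prob_pos_witness)
    then show ?thesis using Z_le[of \<omega> t] by simp
  qed
  have total: "(\<Sum>l\<in>A. ?np l) \<le> 1" if "finite A" for A
  proof -
    have "(\<Sum>l\<in>A. \<P>(\<omega> in M. Z (Suc t) \<omega> = l \<and> ?E \<omega>)) =
        measure M (\<Union>l\<in>A. {\<omega> \<in> space M. Z (Suc t) \<omega> = l \<and> ?E \<omega>})"
      using that by (intro finite_measure_finite_Union[symmetric]) (auto simp: disjoint_family_on_def)
    also have "\<dots> \<le> \<P>(\<omega> in M. ?E \<omega>)" using that by (intro finite_measure_mono) auto
    finally have "(\<Sum>l\<in>A. ?np l) * \<P>(\<omega> in M. ?E \<omega>) \<le> 1 * \<P>(\<omega> in M. ?E \<omega>)"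
      unfolding E by (simp add: sum_distrib_right)
    then show ?thesis using pos by simp
  qed
  have nn: "0 \<le> ?np l" for l by (simp add: cond_prob_def)
  have zero: "?np l = 0" if "finite A" "(\<Sum>l\<in>A. ?np l) = 1" "l \<notin> A" for A l
    using total[of "insert l A"] nn[of l] that by simp
  have "?np l = dual_step d P \<theta> (z t) (x (Suc t)) l"
  proof (cases "z t = d")
    case True
    then show ?thesis using dc zero[of "{d}" l] by (cases "l = d") (auto simp: dual_step_def)
  next
    case False
    then have lt: "z t < d" using zt by simp
    show ?thesis
    proof (cases "x (Suc t) \<le> z t")
      case True
      then show ?thesis using dc lt zero[of "{z t, Suc (z t)}" l]
        by (cases "l \<in> {z t, Suc (z t)}") (auto simp: dual_step_def)
    next
      case gt: False
      then show ?thesis using dc lt le zero[of "{Suc (z t)}" l]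
        by (cases "l = Suc (z t)") (auto simp: dual_step_def)
    qed
  qed
  then show ?thesis using E by simp
qed

text \<open>Induction on \<open>t\<close> with the horizon \<open>n\<close> fixed, so the factor for
  the path of \<open>X\<close> is never touched and only sampling weights accumulate. Null events
  stay null.\<close>

lemma joint_path_prob:
  assumes "t \<le> n"
  shows "\<P>(\<omega> in M. (\<forall>s\<le>n. X s \<omega> = x s) \<and> (\<forall>s\<le>t. Z s \<omega> = z s)) =
    \<P>(\<omega> in M. \<forall>s\<le>n. X s \<omega> = x s) * of_bool (z 0 = 0) *
    (\<Prod>s<t. dual_step d P \<theta> (z s) (x (Suc s)) (z (Suc s)))"
  using assms
proof (induction t)
  case 0
  have "\<P>(\<omega> in M. (\<forall>s\<le>n. X s \<omega> = x s) \<and> (\<forall>s\<le>0. Z s \<omega> = z s)) =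
      \<P>(\<omega> in M. (\<forall>s\<le>n. X s \<omega> = x s) \<and> z 0 = 0)"
  proof (rule finite_measure_eq_AE)
    show "AE \<omega> in M. \<omega> \<in> {\<omega> \<in> space M. (\<forall>s\<le>n. X s \<omega> = x s) \<and> (\<forall>s\<le>0. Z s \<omega> = z s)} \<longleftrightarrow>
        \<omega> \<in> {\<omega> \<in> space M. (\<forall>s\<le>n. X s \<omega> = x s) \<and> z 0 = 0}"
      using Z0 by eventually_elim auto
  qed measurable
  then show ?case by simp
next
  case (Suc t)
  let ?pE = "\<P>(\<omega> in M. (\<forall>s\<le>n. X s \<omega> = x s) \<and> (\<forall>s\<le>t. Z s \<omega> = z s))"
  let ?w = "\<lambda>s. dual_step d P \<theta> (z s) (x (Suc s)) (z (Suc s))"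
  have IH: "?pE = \<P>(\<omega> in M. \<forall>s\<le>n. X s \<omega> = x s) * of_bool (z 0 = 0) * (\<Prod>s<t. ?w s)"
    using Suc by simp
  have split: "\<P>(\<omega> in M. (\<forall>s\<le>n. X s \<omega> = x s) \<and> (\<forall>s\<le>Suc t. Z s \<omega> = z s)) =
      \<P>(\<omega> in M. Z (Suc t) \<omega> = z (Suc t) \<and> (\<forall>s\<le>n. X s \<omega> = x s) \<and> (\<forall>s\<le>t. Z s \<omega> = z s))"
    by (rule arg_cong[where f = "measure M"]) (auto simp: le_Suc_eq)
  show ?case
  proof (cases "?pE > 0")
    case True
    have "?pE \<le> \<P>(\<omega> in M. \<forall>s\<le>n. X s \<omega> = x s)" by (intro finite_measure_mono) auto
    then have Xpos: "0 < \<P>(\<omega> in M. \<forall>s\<le>n. X s \<omega> = x s)" using True by linarith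
    note sup = X_path_support[OF Xpos]
    have "(\<Prod>s<t. ?w s) \<noteq> 0"
    proof
      assume "(\<Prod>s<t. ?w s) = 0"
      then have "?pE = 0" unfolding IH by (simp only: mult_zero_right)
      then show False using True by linarith
    qed
    then have wpos: "?w s \<noteq> 0" if "s < t" for s using that by (auto simp: prod_zero_iff)
    have zle: "z s \<le> d" if "s \<le> t" for s
    proof -
      obtain \<omega> where "\<omega> \<in> space M" "\<forall>s\<le>t. Z s \<omega> = z s"
        using True by (rule prob_pos_witness) blast
      then show ?thesis using Z_le[of \<omega> s] that by simp
    qed
    \<comment> \<open>On a path of positive probability all earlier weights are nonzero, which
      carries \<open>X \<le> Z\<close> from time 0 up to \<open>t\<close>. The next step therefore
      falls under a case that the rule prescribes.\<close>
    have "x s \<le> z s" if "s \<le> t" for s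
      using that
    proof (induction s)
      case 0
      then show ?case using sup(1) by simp
    next
      case (Suc s)
      then show ?case
        using dual_step_support[OF wpos[of s]] sup(2)[of "Suc s"] sup(3)[of s] zle[of s] \<open>Suc t \<le> n\<close> by simp
    qed
    then have "x (Suc t) \<le> Suc (z t)" using sup(3)[of t] Suc.prems by (metis Suc_le_eq Suc_le_mono le_trans order_refl)
    from next_prob_eq[OF Suc.prems True this, of "z (Suc t)"] show ?thesis
      unfolding split IH by (simp add: mult_ac)
  next
    case False
    then have 0: "?pE = 0" using leI[OF False] by (intro antisym measure_nonneg)
    have "\<P>(\<omega> in M. (\<forall>s\<le>n. X s \<omega> = x s) \<and> (\<forall>s\<le>Suc t. Z s \<omega> = z s)) \<le> ?pE"
      by (intro finite_measure_mono) auto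
    then show ?thesis using 0 unfolding IH by (auto simp: measure_le_0_iff)
  qed
qed

text \<open>The pair is itself a Markov chain: \<open>X\<close> moves by \<open>P\<close>, and the
  dual then reacts to the new value. The product formulas at \<open>t + 1\<close> and at
  \<open>t\<close> differ by just this factor.\<close>

lemma pair_path_step:
  assumes y: "y \<le> d"
  shows "\<P>(\<omega> in M. (\<forall>s\<le>t. (X s \<omega>, Z s \<omega>) = v s) \<and> X (Suc t) \<omega> = y \<and> Z (Suc t) \<omega> = l) =
    P $$ (fst (v t), y) * dual_step d P \<theta> (snd (v t)) y l * \<P>(\<omega> in M. \<forall>s\<le>t. (X s \<omega>, Z s \<omega>) = v s)"
proof -
  let ?x = "\<lambda>s. if s \<le> t then fst (v s) else y" and ?z = "\<lambda>s. if s \<le> t then snd (v s) else l"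
  have "\<P>(\<omega> in M. (\<forall>s\<le>t. (X s \<omega>, Z s \<omega>) = v s) \<and> X (Suc t) \<omega> = y \<and> Z (Suc t) \<omega> = l) =
      \<P>(\<omega> in M. (\<forall>s\<le>Suc t. X s \<omega> = ?x s) \<and> (\<forall>s\<le>Suc t. Z s \<omega> = ?z s))"
    by (rule arg_cong[where f = "measure M"]) (auto simp: le_Suc_eq prod_eq_iff)
  also have "\<dots> = \<P>(\<omega> in M. \<forall>s\<le>Suc t. X s \<omega> = ?x s) * of_bool (?z 0 = 0) *
    (\<Prod>s<Suc t. dual_step d P \<theta> (?z s) (?x (Suc s)) (?z (Suc s)))"
    by (rule joint_path_prob) simp
  also have "\<P>(\<omega> in M. \<forall>s\<le>Suc t. X s \<omega> = ?x s) =
      \<P>(\<omega> in M. (\<forall>s\<le>t. X s \<omega> = ?x s) \<and> X (Suc t) \<omega> = y)"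
    by (rule arg_cong[where f = "measure M"]) (auto simp: le_Suc_eq)
  also have "\<dots> = P $$ (fst (v t), y) * \<P>(\<omega> in M. \<forall>s\<le>t. X s \<omega> = ?x s)"
    using markov_chain_path_step[OF mcX y, of t ?x] by simp
  also have "P $$ (fst (v t), y) * \<P>(\<omega> in M. \<forall>s\<le>t. X s \<omega> = ?x s) * of_bool (?z 0 = 0) *
      (\<Prod>s<Suc t. dual_step d P \<theta> (?z s) (?x (Suc s)) (?z (Suc s))) =
      P $$ (fst (v t), y) * dual_step d P \<theta> (snd (v t)) y l *
      (\<P>(\<omega> in M. \<forall>s\<le>t. X s \<omega> = ?x s) * of_bool (?z 0 = 0) *
       (\<Prod>s<t. dual_step d P \<theta> (?z s) (?x (Suc s)) (?z (Suc s))))"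
    by simp
  also have "\<P>(\<omega> in M. \<forall>s\<le>t. X s \<omega> = ?x s) * of_bool (?z 0 = 0) *
       (\<Prod>s<t. dual_step d P \<theta> (?z s) (?x (Suc s)) (?z (Suc s))) =
      \<P>(\<omega> in M. (\<forall>s\<le>t. X s \<omega> = ?x s) \<and> (\<forall>s\<le>t. Z s \<omega> = ?z s))"
    by (rule joint_path_prob[symmetric]) simp
  also have "\<dots> = \<P>(\<omega> in M. \<forall>s\<le>t. (X s \<omega>, Z s \<omega>) = v s)"
    by (rule arg_cong[where f = "measure M"]) (auto simp: prod_eq_iff)
  finally show ?thesis .
qed

abbreviation pair :: "'a \<Rightarrow> nat \<Rightarrow> nat \<times> nat" where
  "pair \<omega> \<equiv> \<lambda>s. (X s \<omega>, Z s \<omega>)"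

lemma pair_finite:
  "finite ({..d} \<times> {..d})" "\<omega> \<in> space M \<Longrightarrow> pair \<omega> s \<in> {..d} \<times> {..d}"
  "{\<omega> \<in> space M. pair \<omega> s = v} \<in> events"
proof -
  show "finite ({..d} \<times> {..d})" by simp
  show "\<omega> \<in> space M \<Longrightarrow> pair \<omega> s \<in> {..d} \<times> {..d}" using X_le[of \<omega> s] Z_le[of \<omega> s] by simp
  have "{\<omega> \<in> space M. X s \<omega> = fst v \<and> Z s \<omega> = snd v} \<in> events" by measurable
  then show "{\<omega> \<in> space M. pair \<omega> s = v} \<in> events" by (simp add: prod_eq_iff)
qed

lemma pair_history_step:
  assumes y: "y \<le> d" and Q: "\<And>f g. (\<And>s. s \<le> t \<Longrightarrow> f s = g s) \<Longrightarrow> Q f \<longleftrightarrow> Q g"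
  shows "\<P>(\<omega> in M. (Q (pair \<omega>) \<and> pair \<omega> t = (x, k)) \<and> X (Suc t) \<omega> = y \<and> Z (Suc t) \<omega> = l) =
    P $$ (x, y) * dual_step d P \<theta> k y l * \<P>(\<omega> in M. (Q (pair \<omega>) \<and> pair \<omega> t = (x, k)) \<and> True)"
proof -
  have cong: "(Q f \<and> f t = (x, k)) \<longleftrightarrow> (Q g \<and> g t = (x, k))" if "\<And>s. s \<le> t \<Longrightarrow> f s = g s" for f g
    using Q[of f g, OF that] that[of t] by simp
  have step: "\<P>(\<omega> in M. (\<forall>s\<le>t. pair \<omega> s = v s) \<and> X (Suc t) \<omega> = y \<and> Z (Suc t) \<omega> = l) =
      P $$ (x, y) * dual_step d P \<theta> k y l * \<P>(\<omega> in M. (\<forall>s\<le>t. pair \<omega> s = v s) \<and> True)"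
    if "Q v \<and> v t = (x, k)" for v
    using pair_path_step[OF y, of t v l] that by simp
  have ev: "{\<omega> \<in> space M. X (Suc t) \<omega> = y \<and> Z (Suc t) \<omega> = l} \<in> events" by measurable
  show ?thesis
  proof (rule path_event_scale[of "{..d} \<times> {..d}" "\<lambda>s \<omega>. pair \<omega> s" t "\<lambda>f. Q f \<and> f t = (x, k)"
          "\<lambda>\<omega>. X (Suc t) \<omega> = y \<and> Z (Suc t) \<omega> = l" "\<lambda>_. True"], goal_cases)
    case (4 f g)
    then show ?case by (rule cong)
  next
    case (7 v)
    then show ?case by (rule step)
  qed (rule pair_finite ev sets.top | simp only: simp_thms Collect_mem_eq)+
qed

text \<open>Bayes' rule behind the sampling probabilities. If \<open>X\<close> has law
  \<open>\<Lambda>(k, .)\<close>, its next law is the mixture of rows \<open>k\<close> and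
  \<open>k + 1\<close> with weights \<open>\<theta> k\<close> and \<open>1 - \<theta> k\<close>, and
  \<open>birth_prob\<close> is the posterior probability that \<open>y\<close> came from row
  \<open>k + 1\<close>.\<close>

lemma link_dual_step:
  assumes "k \<le> d" "y \<le> d" "l \<le> d"
  shows "(\<Sum>x\<le>d. link d P \<theta> $$ (k, x) * P $$ (x, y)) * dual_step d P \<theta> k y l =
    pure_birth_kernel d \<theta> $$ (k, l) * link d P \<theta> $$ (l, y)"
proof (cases "k = d")
  case True
  then show ?thesis using assms by (auto simp: link_last_invariant dual_step_def pure_birth_kernel_def thd)
next
  case False
  then have k: "k < d" using assms by simp
  let ?L = "\<lambda>k. link d P \<theta> $$ (k, y)"
  let ?D = "\<theta> k * ?L k + (1 - \<theta> k) * ?L (Suc k)"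
  have nn: "0 \<le> \<theta> k * ?L k" "0 \<le> (1 - \<theta> k) * ?L (Suc k)"
    using k assms by (auto intro!: mult_nonneg_nonneg link_nonneg theta_nonneg theta_le_1)
  \<comment> \<open>If the denominator is zero, both of its nonnegative summands are zero, so the
    value of the quotient is immaterial.\<close>
  have 1: "?D * birth_prob d P \<theta> k y = (1 - \<theta> k) * ?L (Suc k)"
  proof (cases "?D = 0")
    case True
    then have "(1 - \<theta> k) * ?L (Suc k) = 0" using nn by linarith
    then show ?thesis using True by (simp only: mult_zero_left)
  qed (simp add: birth_prob_def)
  have 2: "?D * (1 - birth_prob d P \<theta> k y) = \<theta> k * ?L k"
    using 1 by (simp add: right_diff_distrib)
  have 3: "k < y \<Longrightarrow> ?L k = 0" "Suc k < y \<Longrightarrow> ?L (Suc k) = 0"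
    using link_eq_0 k assms by auto
  have "?D * dual_step d P \<theta> k y l = pure_birth_kernel d \<theta> $$ (k, l) * ?L l"
    using 1 2 3 k assms by (auto simp: dual_step_def pure_birth_kernel_def)
  then show ?thesis using k assms by (simp add: link_intertwines)
qed

text \<open>Summing the pair transition over the hidden value of \<open>X\<close> at time
  \<open>t\<close> turns the row of the current dual state into that of the next one. Summing also
  over the new value of \<open>X\<close> leaves the pure-birth transition, as rows of the link have
  mass 1.\<close>

lemma Z_path_link_step:
  assumes IH: "\<And>x. x \<le> d \<Longrightarrow> \<P>(\<omega> in M. (\<forall>s\<le>t. Z s \<omega> = z s) \<and> X t \<omega> = x) =
      link d P \<theta> $$ (z t, x) * \<P>(\<omega> in M. \<forall>s\<le>t. Z s \<omega> = z s)"
    and zle: "z t \<le> d" "z (Suc t) \<le> d"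
  shows "y \<le> d \<Longrightarrow> \<P>(\<omega> in M. (\<forall>s\<le>Suc t. Z s \<omega> = z s) \<and> X (Suc t) \<omega> = y) =
      pure_birth_kernel d \<theta> $$ (z t, z (Suc t)) * link d P \<theta> $$ (z (Suc t), y) * \<P>(\<omega> in M. \<forall>s\<le>t. Z s \<omega> = z s)"
    and "\<P>(\<omega> in M. \<forall>s\<le>Suc t. Z s \<omega> = z s) =
      pure_birth_kernel d \<theta> $$ (z t, z (Suc t)) * \<P>(\<omega> in M. \<forall>s\<le>t. Z s \<omega> = z s)"
proof -
  let ?pZ = "\<P>(\<omega> in M. \<forall>s\<le>t. Z s \<omega> = z s)" and ?K = "pure_birth_kernel d \<theta> $$ (z t, z (Suc t))"
  let ?A = "\<lambda>y \<omega>. (\<forall>s\<le>Suc t. Z s \<omega> = z s) \<and> X (Suc t) \<omega> = y"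
  show step: "\<P>(\<omega> in M. ?A y \<omega>) = ?K * link d P \<theta> $$ (z (Suc t), y) * ?pZ" if y: "y \<le> d" for y
  proof -
    have "\<P>(\<omega> in M. ?A y \<omega> \<and> X t \<omega> = x) =
        link d P \<theta> $$ (z t, x) * P $$ (x, y) * (dual_step d P \<theta> (z t) y (z (Suc t)) * ?pZ)"
      if x: "x \<le> d" for x
    proof -
      let ?Q = "\<lambda>f. \<forall>s\<le>t. snd (f s) = z s"
      have "\<P>(\<omega> in M. ?A y \<omega> \<and> X t \<omega> = x) =
        \<P>(\<omega> in M. (?Q (pair \<omega>) \<and> pair \<omega> t = (x, z t)) \<and> X (Suc t) \<omega> = y \<and> Z (Suc t) \<omega> = z (Suc t))"
        by (rule arg_cong[where f = "measure M"]) (auto simp: le_Suc_eq)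
      also have "\<dots> = P $$ (x, y) * dual_step d P \<theta> (z t) y (z (Suc t)) *
          \<P>(\<omega> in M. (?Q (pair \<omega>) \<and> pair \<omega> t = (x, z t)) \<and> True)"
        by (rule pair_history_step[OF y, of t ?Q x "z t" "z (Suc t)"]) simp
      also have "\<P>(\<omega> in M. (?Q (pair \<omega>) \<and> pair \<omega> t = (x, z t)) \<and> True) =
          \<P>(\<omega> in M. (\<forall>s\<le>t. Z s \<omega> = z s) \<and> X t \<omega> = x)"
        by (rule arg_cong[where f = "measure M"]) auto
      also have "\<dots> = link d P \<theta> $$ (z t, x) * ?pZ" by (rule IH[OF x])
      finally show ?thesis by (simp add: mult_ac)
    qed
    moreover have "\<P>(\<omega> in M. ?A y \<omega>) = (\<Sum>x\<le>d. \<P>(\<omega> in M. ?A y \<omega> \<and> X t \<omega> = x))"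
      by (rule prob_sum_values[of "X t" d "?A y"]) (use X_le in simp, measurable)
    ultimately have "\<P>(\<omega> in M. ?A y \<omega>) =
        (\<Sum>x\<le>d. link d P \<theta> $$ (z t, x) * P $$ (x, y)) * dual_step d P \<theta> (z t) y (z (Suc t)) * ?pZ"
      by (simp add: sum_distrib_right mult.assoc)
    then show ?thesis unfolding link_dual_step[OF zle(1) y zle(2)] by simp
  qed
  have "\<P>(\<omega> in M. \<forall>s\<le>Suc t. Z s \<omega> = z s) = (\<Sum>y\<le>d. \<P>(\<omega> in M. ?A y \<omega>))"
    by (rule prob_sum_values[of "X (Suc t)" d "\<lambda>\<omega>. \<forall>s\<le>Suc t. Z s \<omega> = z s"]) (use X_le in simp, measurable)
  also have "\<dots> = (\<Sum>y\<le>d. link d P \<theta> $$ (z (Suc t), y)) * (?K * ?pZ)"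
    unfolding sum_distrib_right using step by (intro sum.cong) (auto simp: mult_ac)
  finally show "\<P>(\<omega> in M. \<forall>s\<le>Suc t. Z s \<omega> = z s) = ?K * ?pZ"
    by (simp add: link_sum[OF zle(2)])
qed

text \<open>The first and second parts of \<open>Z_path_link_step\<close> share the factor of the
  pure-birth kernel, which cancels. Null paths are split off because the step needs path values at
  most \<open>d\<close>.\<close>

lemma Z_path_link:
  assumes "y \<le> d"
  shows "\<P>(\<omega> in M. (\<forall>s\<le>t. Z s \<omega> = z s) \<and> X t \<omega> = y) =
     link d P \<theta> $$ (z t, y) * \<P>(\<omega> in M. \<forall>s\<le>t. Z s \<omega> = z s)"
  using assms
proof (induction t arbitrary: y)
  case 0
  have "\<P>(\<omega> in M. (\<forall>s\<le>0. Z s \<omega> = z s) \<and> X 0 \<omega> = y) = \<P>(\<omega> in M. z 0 = 0 \<and> y = 0)"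
  proof (rule finite_measure_eq_AE)
    show "AE \<omega> in M. \<omega> \<in> {\<omega> \<in> space M. (\<forall>s\<le>0. Z s \<omega> = z s) \<and> X 0 \<omega> = y} \<longleftrightarrow>
        \<omega> \<in> {\<omega> \<in> space M. z 0 = 0 \<and> y = 0}"
      using X0 Z0 by eventually_elim auto
  qed measurable
  moreover have "\<P>(\<omega> in M. (\<forall>s\<le>0. Z s \<omega> = z s)) = \<P>(\<omega> in M. z 0 = 0)"
  proof (rule finite_measure_eq_AE)
    show "AE \<omega> in M. \<omega> \<in> {\<omega> \<in> space M. \<forall>s\<le>0. Z s \<omega> = z s} \<longleftrightarrow> \<omega> \<in> {\<omega> \<in> space M. z 0 = 0}"
      using Z0 by eventually_elim auto
  qed measurable
  ultimately show ?case using 0 by (cases "z 0 = 0"; cases "y = 0") (simp_all add: link_0 prob_space)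
next
  case (Suc t)
  show ?case
  proof (cases "0 < \<P>(\<omega> in M. \<forall>s\<le>Suc t. Z s \<omega> = z s)")
    case False
    then have 0: "\<P>(\<omega> in M. \<forall>s\<le>Suc t. Z s \<omega> = z s) = 0"
      using leI[OF False] by (intro antisym measure_nonneg)
    have "\<P>(\<omega> in M. (\<forall>s\<le>Suc t. Z s \<omega> = z s) \<and> X (Suc t) \<omega> = y) \<le> \<P>(\<omega> in M. \<forall>s\<le>Suc t. Z s \<omega> = z s)"
      by (intro finite_measure_mono) auto
    then show ?thesis using 0 by (simp add: measure_le_0_iff)
  next
    case True
    then obtain \<omega> where "\<omega> \<in> space M" "\<forall>s\<le>Suc t. Z s \<omega> = z s" by (rule prob_pos_witness)
    then have zle: "z t \<le> d" "z (Suc t) \<le> d" using Z_le[of \<omega> t] Z_le[of \<omega> "Suc t"] by auto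
    show ?thesis
      using Z_path_link_step(1)[OF Suc.IH zle Suc.prems] Z_path_link_step(2)[OF Suc.IH zle] by simp
  qed
qed

lemma Z_history_link:
  assumes y: "y \<le> d" and Q: "\<And>f g. (\<And>s. s \<le> t \<Longrightarrow> f s = g s) \<Longrightarrow> Q f \<longleftrightarrow> Q g"
  shows "\<P>(\<omega> in M. (Q (\<lambda>s. Z s \<omega>) \<and> Z t \<omega> = k) \<and> X t \<omega> = y) =
    link d P \<theta> $$ (k, y) * \<P>(\<omega> in M. (Q (\<lambda>s. Z s \<omega>) \<and> Z t \<omega> = k) \<and> True)"
proof -
  have cong: "(Q f \<and> f t = k) \<longleftrightarrow> (Q g \<and> g t = k)" if "\<And>s. s \<le> t \<Longrightarrow> f s = g s" for f g
    using Q[of f g, OF that] that[of t] by simp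
  have step: "\<P>(\<omega> in M. (\<forall>s\<le>t. Z s \<omega> = v s) \<and> X t \<omega> = y) =
      link d P \<theta> $$ (k, y) * \<P>(\<omega> in M. (\<forall>s\<le>t. Z s \<omega> = v s) \<and> True)"
    if "Q v \<and> v t = k" for v
    using Z_path_link[OF y, of t v] that by simp
  show ?thesis
  proof (rule path_event_scale[of "{..d}" Z t "\<lambda>f. Q f \<and> f t = k" "\<lambda>\<omega>. X t \<omega> = y" "\<lambda>_. True"], goal_cases)
    case (4 f g)
    then show ?case by (rule cong)
  next
    case (7 v)
    then show ?case by (rule step)
  qed (use bounded_nat_measurable(2,3)[OF Zm] bounded_nat_measurable(3)[OF Xm] in simp_all)
qed

lemma Z_markov: "markov_chain M d (pure_birth_kernel d \<theta>) Z"
  unfolding markov_chain_def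
proof (intro conjI allI impI)
  fix t z j
  assume j: "j \<le> d" and pos: "0 < \<P>(\<omega> in M. \<forall>s\<le>t. Z s \<omega> = z s)"
  from pos obtain \<omega> where "\<omega> \<in> space M" "\<forall>s\<le>t. Z s \<omega> = z s" by (rule prob_pos_witness)
  then have zt: "z t \<le> d" using Z_le[of \<omega> t] by auto
  let ?z = "z(Suc t := j)"
  have zz: "\<P>(\<omega> in M. \<forall>s\<le>t. Z s \<omega> = ?z s) = \<P>(\<omega> in M. \<forall>s\<le>t. Z s \<omega> = z s)"
    by (rule arg_cong[where f = "measure M"]) auto
  have "\<P>(\<omega> in M. \<forall>s\<le>Suc t. Z s \<omega> = ?z s) =
      pure_birth_kernel d \<theta> $$ (?z t, ?z (Suc t)) * \<P>(\<omega> in M. \<forall>s\<le>t. Z s \<omega> = ?z s)"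
    by (rule Z_path_link_step(2)[OF Z_path_link]) (use zt j in auto)
  moreover have "\<P>(\<omega> in M. \<forall>s\<le>Suc t. Z s \<omega> = ?z s) =
      \<P>(\<omega> in M. Z (Suc t) \<omega> = j \<and> (\<forall>s\<le>t. Z s \<omega> = z s))"
    by (rule arg_cong[where f = "measure M"]) (auto simp: le_Suc_eq)
  ultimately have "\<P>(\<omega> in M. Z (Suc t) \<omega> = j \<and> (\<forall>s\<le>t. Z s \<omega> = z s)) =
      pure_birth_kernel d \<theta> $$ (z t, j) * \<P>(\<omega> in M. \<forall>s\<le>t. Z s \<omega> = z s)"
    using zz by simp
  then show "\<P>(\<omega> in M. Z (Suc t) \<omega> = j \<bar> \<forall>s\<le>t. Z s \<omega> = z s) = pure_birth_kernel d \<theta> $$ (z t, j)"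
    using pos by (simp add: cond_prob_def)
qed (rule Zm)

text \<open>A pair of states at which the link is zero is occupied with probability 0, and there are
  finitely many pairs. The order \<open>X \<le> Z\<close> then follows because the link vanishes
  above its diagonal.\<close>

lemma link_pos_AE: "AE \<omega> in M. \<forall>t. 0 < link d P \<theta> $$ (Z t \<omega>, X t \<omega>) \<and> X t \<omega> \<le> Z t \<omega>"
  unfolding AE_all_countable
proof
  fix t
  have "AE \<omega> in M. \<forall>k\<in>{..d}. \<forall>y\<in>{..d}. Z t \<omega> = k \<and> X t \<omega> = y \<longrightarrow> 0 < link d P \<theta> $$ (k, y)"
  proof (intro AE_ball_countable[THEN iffD2] countable_finite finite_atMost ballI)
    fix k y assume ky: "k \<in> {..d}" "y \<in> {..d}"
    show "AE \<omega> in M. Z t \<omega> = k \<and> X t \<omega> = y \<longrightarrow> 0 < link d P \<theta> $$ (k, y)"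
    proof (cases "0 < link d P \<theta> $$ (k, y)")
      case False
      then have "link d P \<theta> $$ (k, y) = 0" using link_nonneg[of k y] ky by simp
      then have "\<P>(\<omega> in M. (True \<and> Z t \<omega> = k) \<and> X t \<omega> = y) = 0"
        using Z_history_link[of y t "\<lambda>_. True" k] ky by simp
      then have "AE \<omega> in M. \<not> (Z t \<omega> = k \<and> X t \<omega> = y)"
        by (subst prob_Collect_eq_0[symmetric]) simp_all
      then show ?thesis by eventually_elim auto
    qed simp
  qed
  then show "AE \<omega> in M. 0 < link d P \<theta> $$ (Z t \<omega>, X t \<omega>) \<and> X t \<omega> \<le> Z t \<omega>"
  proof (rule AE_mp, intro AE_I2 impI)
    fix \<omega> assume \<omega>: "\<omega> \<in> space M"
      and *: "\<forall>k\<in>{..d}. \<forall>y\<in>{..d}. Z t \<omega> = k \<and> X t \<omega> = y \<longrightarrow> 0 < link d P \<theta> $$ (k, y)"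
    have le: "Z t \<omega> \<le> d" "X t \<omega> \<le> d" using \<omega> X_le Z_le by auto
    then have "0 < link d P \<theta> $$ (Z t \<omega>, X t \<omega>)" using * by auto
    moreover from this have "X t \<omega> \<le> Z t \<omega>" using link_eq_0[of "Z t \<omega>" "X t \<omega>"] le by force
    ultimately show "0 < link d P \<theta> $$ (Z t \<omega>, X t \<omega>) \<and> X t \<omega> \<le> Z t \<omega>" by simp
  qed
qed

lemma X_jump_AE: "AE \<omega> in M. \<forall>t. X (Suc t) \<omega> \<le> Suc (X t \<omega>)"
  unfolding AE_all_countable
proof
  fix t
  have "AE \<omega> in M. \<forall>x\<in>{..d}. \<forall>y\<in>{..d}. X t \<omega> = x \<and> X (Suc t) \<omega> = y \<longrightarrow> y \<le> Suc x"
  proof (intro AE_ball_countable[THEN iffD2] countable_finite finite_atMost ballI)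
    fix x y assume xy: "x \<in> {..d}" "y \<in> {..d}"
    show "AE \<omega> in M. X t \<omega> = x \<and> X (Suc t) \<omega> = y \<longrightarrow> y \<le> Suc x"
    proof (cases "y \<le> Suc x")
      case False
      then have "P $$ (x, y) = 0" using xy by (intro P_tri) auto
      then have "\<P>(\<omega> in M. (True \<and> X t \<omega> = x) \<and> X (Suc t) \<omega> = y) = 0"
        using markov_chain_history_step[OF mcX, of y t "\<lambda>_. True" x] xy by simp
      then have "AE \<omega> in M. \<not> (X t \<omega> = x \<and> X (Suc t) \<omega> = y)"
        by (subst prob_Collect_eq_0[symmetric]) simp_all
      then show ?thesis by eventually_elim auto
    qed simp
  qed
  then show "AE \<omega> in M. X (Suc t) \<omega> \<le> Suc (X t \<omega>)"
    by (rule AE_mp) (intro AE_I2 impI, use X_le in auto)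
qed

lemma cases_exhaustive_AE:
  "AE \<omega> in M. \<forall>t. Z t \<omega> = d \<or> X (Suc t) \<omega> \<le> Z t \<omega> \<or> X (Suc t) \<omega> = Suc (Z t \<omega>)"
  using link_pos_AE X_jump_AE
proof eventually_elim
  case (elim \<omega>)
  then have "X (Suc t) \<omega> \<le> Suc (Z t \<omega>)" for t by (meson Suc_le_mono le_trans)
  then show ?case by (metis le_SucE)
qed

end

section \<open>Waiting times of a pure-birth chain\<close>

text \<open>Hitting and waiting times as functions of one deterministic path, so that they can also
  be evaluated on a modified path, such as one frozen at a given time.\<close>

definition path_hit :: "(nat \<Rightarrow> nat) \<Rightarrow> nat \<Rightarrow> enat" where
  "path_hit f k = (INF t\<in>{t. f t = k}. enat t)"

definition path_wait :: "(nat \<Rightarrow> nat) \<Rightarrow> nat \<Rightarrow> enat" where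
  "path_wait f k = path_hit f (Suc k) - path_hit f k"

lemma hitting_time_path: "hitting_time Z k \<omega> = path_hit (\<lambda>t. Z t \<omega>) k"
  by (simp add: hitting_time_def path_hit_def)

lemma waiting_time_path: "waiting_time Z k \<omega> = path_wait (\<lambda>t. Z t \<omega>) k"
  by (simp add: waiting_time_def path_wait_def hitting_time_path)

lemma path_hit_eq_enat:
  "path_hit f k = enat m \<longleftrightarrow> f m = k \<and> (\<forall>s<m. f s \<noteq> k)"
proof
  assume *: "f m = k \<and> (\<forall>s<m. f s \<noteq> k)"
  show "path_hit f k = enat m"
    unfolding path_hit_def
  proof (rule antisym)
    show "(INF t\<in>{t. f t = k}. enat t) \<le> enat m" using * by (intro INF_lower) simp
    show "enat m \<le> (INF t\<in>{t. f t = k}. enat t)"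
      using * by (intro INF_greatest) (auto simp: not_less[symmetric])
  qed
next
  assume *: "path_hit f k = enat m"
  have ne: "\<exists>t. f t = k"
  proof (rule ccontr)
    assume "\<not> ?thesis"
    then have "path_hit f k = Inf {}" unfolding path_hit_def by simp
    then show False using * by (simp add: Inf_enat_def)
  qed
  have lo: "enat m \<le> enat t" if "f t = k" for t
    unfolding *[symmetric] path_hit_def using that by (intro INF_lower) simp
  then have 1: "\<forall>s<m. f s \<noteq> k" by (metis enat_ord_simps(1) not_less)
  have "f m = k"
  proof (rule ccontr)
    assume "f m \<noteq> k"
    then have "Suc m \<le> t" if "f t = k" for t using that lo[OF that] by (cases "t = m") auto
    then have "enat (Suc m) \<le> path_hit f k" unfolding path_hit_def by (intro INF_greatest) auto
    then show False using * by simp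
  qed
  with 1 show "f m = k \<and> (\<forall>s<m. f s \<noteq> k)" by simp
qed

lemma path_hit_finite: "(\<exists>m. path_hit f k = enat m) \<longleftrightarrow> (\<exists>t. f t = k)"
proof
  assume "\<exists>t. f t = k"
  then have "f (LEAST t. f t = k) = k" by (rule LeastI_ex)
  then have "path_hit f k = enat (LEAST t. f t = k)"
    unfolding path_hit_eq_enat using not_less_Least by blast
  then show "\<exists>m. path_hit f k = enat m" by blast
qed (auto simp: path_hit_eq_enat)

lemma path_hit_le_iff: "path_hit f k \<le> enat t \<longleftrightarrow> (\<exists>s\<le>t. f s = k)"
proof
  assume "path_hit f k \<le> enat t"
  then obtain m where "path_hit f k = enat m" "m \<le> t" by (cases "path_hit f k") auto
  then show "\<exists>s\<le>t. f s = k" using path_hit_eq_enat by blast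
next
  assume "\<exists>s\<le>t. f s = k"
  then obtain s where "s \<le> t" "f s = k" by blast
  then have "path_hit f k \<le> enat s" unfolding path_hit_def by (intro INF_lower) simp
  also have "\<dots> \<le> enat t" using \<open>s \<le> t\<close> by simp
  finally show "path_hit f k \<le> enat t" .
qed

definition birth_path :: "(nat \<Rightarrow> nat) \<Rightarrow> bool" where
  "birth_path f \<longleftrightarrow> f 0 = 0 \<and> (\<forall>t. f (Suc t) = f t \<or> f (Suc t) = Suc (f t))"

lemma birth_path_mono: "birth_path f \<Longrightarrow> s \<le> t \<Longrightarrow> f s \<le> f t"
proof (rule lift_Suc_mono_le[of f])
  fix n assume "birth_path f"
  then have "f (Suc n) = f n \<or> f (Suc n) = Suc (f n)" by (simp add: birth_path_def)
  then show "f n \<le> f (Suc n)" by auto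
qed

lemma birth_path_visits: "birth_path f \<Longrightarrow> k \<le> f n \<Longrightarrow> \<exists>m\<le>n. f m = k"
proof (induction n)
  case (Suc n)
  show ?case
  proof (cases "k \<le> f n")
    case True
    then show ?thesis using Suc.IH[OF Suc.prems(1)] le_SucI by blast
  next
    case False
    have "f (Suc n) = f n \<or> f (Suc n) = Suc (f n)" using Suc.prems(1) by (simp add: birth_path_def)
    then have "f (Suc n) = k" using False Suc.prems(2) by auto
    then show ?thesis by blast
  qed
qed (auto simp: birth_path_def)

text \<open>Makes hitting times that have occurred by \<open>m\<close>, and the waits between them,
  functions of the path up to \<open>m\<close>.\<close>

lemma path_hit_stopped:
  assumes "\<exists>t\<le>m. f t = k"
  shows "path_hit (\<lambda>s. f (min s m)) k = path_hit f k"
proof -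
  obtain r where r: "path_hit f k = enat r" using assms path_hit_finite by blast
  moreover have "r \<le> m" using assms r path_hit_le_iff[of f k m] by simp
  moreover have "path_hit (\<lambda>s. f (min s m)) k = enat r"
    using r \<open>r \<le> m\<close> by (simp add: path_hit_eq_enat min_def)
  ultimately show ?thesis by simp
qed

text \<open>Monotonicity and unit jumps turn a first passage into a condition on
  \<open>n + 1\<close> consecutive values, to which the Markov property applies directly.\<close>

lemma birth_path_wait_eq:
  assumes b: "birth_path f" and h: "path_hit f k = enat m" and n: "n \<ge> 1"
  shows "path_wait f k = enat n \<longleftrightarrow> (\<forall>i<n. f (m + i) = k) \<and> f (m + n) = Suc k"
proof -
  have m: "f m = k" "\<And>s. s < m \<Longrightarrow> f s \<noteq> k" using h by (auto simp: path_hit_eq_enat)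
  have "path_wait f k = enat n \<longleftrightarrow> path_hit f (Suc k) = enat (m + n)"
    using n by (cases "path_hit f (Suc k)") (auto simp: path_wait_def h)
  also have "\<dots> \<longleftrightarrow> (\<forall>i<n. f (m + i) = k) \<and> f (m + n) = Suc k"
    unfolding path_hit_eq_enat
  proof (intro iffI conjI allI impI)
    fix i assume *: "f (m + n) = Suc k \<and> (\<forall>s<m + n. f s \<noteq> Suc k)" and i: "i < n"
    have "k \<le> f (m + i)" using birth_path_mono[OF b, of m "m + i"] m by simp
    moreover have "f (m + i) \<le> k"
    proof (rule ccontr)
      assume "\<not> ?thesis"
      then obtain s where "s \<le> m + i" "f s = Suc k" using birth_path_visits[OF b, of "Suc k" "m + i"] by auto
      then show False using * i by auto
    qed
    ultimately show "f (m + i) = k" by simp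
  next
    fix s assume *: "(\<forall>i<n. f (m + i) = k) \<and> f (m + n) = Suc k" and s: "s < m + n"
    have "f s \<le> f (m + (n - 1))" using s n by (intro birth_path_mono[OF b]) auto
    also have "f (m + (n - 1)) = k" using *[THEN conjunct1, rule_format, of "n - 1"] n by simp
    finally show "f s \<noteq> Suc k" by simp
  qed auto
  finally show ?thesis .
qed

text \<open>Telescoping. Finite hitting times in increasing order keep the truncated subtraction on
  \<open>enat\<close> exact.\<close>

lemma sum_path_wait:
  assumes b: "birth_path f" and fin: "\<And>j. j \<le> k \<Longrightarrow> path_hit f j < \<infinity>"
  shows "(\<Sum>j<k. path_wait f j) = path_hit f k"
  using fin
proof (induction k)
  case 0
  have "path_hit f 0 = enat 0" unfolding path_hit_eq_enat using b by (simp add: birth_path_def)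
  then show ?case by (simp add: zero_enat_def)
next
  case (Suc k)
  obtain a c where ac: "path_hit f k = enat a" "path_hit f (Suc k) = enat c"
    using Suc.prems[of k] Suc.prems[of "Suc k"] by (auto simp: less_infinityE)
  have "f c = Suc k" using ac(2) by (simp add: path_hit_eq_enat)
  then have "\<exists>s\<le>c. f s = k" using birth_path_visits[OF b, of k c] by simp
  then have "a \<le> c" using path_hit_le_iff[of f k c] ac by simp
  then show ?case using Suc ac by (simp add: path_wait_def)
qed

context prob_space
begin

text \<open>Decomposition over the values of an almost surely finite time. The map \<open>g\<close>
  lists its range: the identity for hitting times, \<open>Suc\<close> for waiting times, which are
  at least 1.\<close>

lemma prob_sums_enat:
  assumes Y [measurable]: "Y \<in> M \<rightarrow>\<^sub>M count_space (UNIV :: enat set)"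
    and R [measurable]: "Measurable.pred M R"
    and inj: "inj g" and fin: "AE \<omega> in M. \<exists>n. Y \<omega> = enat (g n)"
  shows "(\<lambda>n. \<P>(\<omega> in M. R \<omega> \<and> Y \<omega> = enat (g n))) sums \<P>(\<omega> in M. R \<omega>)"
proof -
  have "(\<lambda>n. \<P>(\<omega> in M. R \<omega> \<and> Y \<omega> = enat (g n))) sums
      measure M (\<Union>n. {\<omega> \<in> space M. R \<omega> \<and> Y \<omega> = enat (g n)})"
  proof (rule finite_measure_UNION)
    show "range (\<lambda>n. {\<omega> \<in> space M. R \<omega> \<and> Y \<omega> = enat (g n)}) \<subseteq> events" by auto
    show "disjoint_family (\<lambda>n. {\<omega> \<in> space M. R \<omega> \<and> Y \<omega> = enat (g n)})"
      using inj by (auto simp: disjoint_family_on_def inj_eq)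
  qed
  also have "measure M (\<Union>n. {\<omega> \<in> space M. R \<omega> \<and> Y \<omega> = enat (g n)}) = \<P>(\<omega> in M. R \<omega>)"
  proof (rule finite_measure_eq_AE)
    show "AE \<omega> in M. \<omega> \<in> (\<Union>n. {\<omega> \<in> space M. R \<omega> \<and> Y \<omega> = enat (g n)}) \<longleftrightarrow> \<omega> \<in> {\<omega> \<in> space M. R \<omega>}"
      using fin by eventually_elim auto
  qed measurable
  finally show ?thesis .
qed

end

section \<open>Law and independence of the waiting times\<close>

locale pure_birth_chain = prob_space M for M :: "'a measure" +
  fixes d :: nat and \<theta> :: "nat \<Rightarrow> real" and Z :: "nat \<Rightarrow> 'a \<Rightarrow> nat"
  assumes mc: "markov_chain M d (pure_birth_kernel d \<theta>) Z" and Z0: "AE \<omega> in M. Z 0 \<omega> = 0"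
    and thlt: "\<And>i. i < d \<Longrightarrow> \<theta> i < 1" and thnn: "\<And>i. i < d \<Longrightarrow> 0 \<le> \<theta> i"
begin

abbreviation path :: "'a \<Rightarrow> nat \<Rightarrow> nat" where "path \<omega> \<equiv> \<lambda>t. Z t \<omega>"

lemma Zm: "Z t \<in> M \<rightarrow>\<^sub>M count_space {..d}" using mc by (simp add: markov_chain_def)

lemmas Z_meas [measurable] = bounded_nat_measurable(1)[OF Zm]
lemmas Z_le = bounded_nat_measurable(2)[OF Zm]

lemma birth_path_AE: "AE \<omega> in M. birth_path (path \<omega>)"
proof -
  have "AE \<omega> in M. \<forall>t. Z (Suc t) \<omega> = Z t \<omega> \<or> Z (Suc t) \<omega> = Suc (Z t \<omega>)"
    unfolding AE_all_countable
  proof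
    fix t
    have "AE \<omega> in M. \<forall>x\<in>{..d}. \<forall>y\<in>{..d}. Z t \<omega> = x \<and> Z (Suc t) \<omega> = y \<longrightarrow> y = x \<or> y = Suc x"
    proof (intro AE_ball_countable[THEN iffD2] countable_finite finite_atMost ballI)
      fix x y assume xy: "x \<in> {..d}" "y \<in> {..d}"
      show "AE \<omega> in M. Z t \<omega> = x \<and> Z (Suc t) \<omega> = y \<longrightarrow> y = x \<or> y = Suc x"
      proof (cases "y = x \<or> y = Suc x")
        case False
        then have "pure_birth_kernel d \<theta> $$ (x, y) = 0" using xy by (simp add: pure_birth_kernel_def)
        then have "\<P>(\<omega> in M. (True \<and> Z t \<omega> = x) \<and> Z (Suc t) \<omega> = y) = 0"
          using markov_chain_history_step[OF mc, of y t "\<lambda>_. True" x] xy by simp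
        then have "AE \<omega> in M. \<not> (Z t \<omega> = x \<and> Z (Suc t) \<omega> = y)"
          by (subst prob_Collect_eq_0[symmetric]) simp_all
        then show ?thesis by eventually_elim auto
      qed simp
    qed
    then show "AE \<omega> in M. Z (Suc t) \<omega> = Z t \<omega> \<or> Z (Suc t) \<omega> = Suc (Z t \<omega>)"
      by (rule AE_mp) (intro AE_I2 impI, use Z_le in auto)
  qed
  then show ?thesis using Z0 by eventually_elim (simp add: birth_path_def)
qed

lemma hit_measurable [measurable]: "(\<lambda>\<omega>. path_hit (path \<omega>) k) \<in> M \<rightarrow>\<^sub>M count_space UNIV"
proof (subst measurable_count_space_eq2_countable, intro conjI ballI)
  fix v :: enat
  show "(\<lambda>\<omega>. path_hit (path \<omega>) k) -` {v} \<inter> space M \<in> events"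
  proof (cases v)
    case (enat m)
    have "(\<lambda>\<omega>. path_hit (path \<omega>) k) -` {v} \<inter> space M = {\<omega> \<in> space M. Z m \<omega> = k \<and> (\<forall>s<m. Z s \<omega> \<noteq> k)}"
      using enat by (auto simp: path_hit_eq_enat)
    also have "\<dots> \<in> events" by measurable
    finally show ?thesis .
  next
    case infinity
    have "path_hit f k = \<infinity> \<longleftrightarrow> (\<forall>t. f t \<noteq> k)" for f
      using path_hit_finite[of f k] by (cases "path_hit f k") auto
    then have "(\<lambda>\<omega>. path_hit (path \<omega>) k) -` {v} \<inter> space M = {\<omega> \<in> space M. \<forall>t. Z t \<omega> \<noteq> k}"
      using infinity by auto
    also have "\<dots> \<in> events" by measurable
    finally show ?thesis .
  qed
qed auto

lemma wait_measurable [measurable]: "(\<lambda>\<omega>. path_wait (path \<omega>) k) \<in> M \<rightarrow>\<^sub>M count_space UNIV"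
proof (subst measurable_count_space_eq2_countable, intro conjI ballI)
  fix v :: enat
  have "(\<lambda>\<omega>. path_wait (path \<omega>) k) -` {v} \<inter> space M =
    {\<omega> \<in> space M. \<exists>a b. path_hit (path \<omega>) (Suc k) = a \<and> path_hit (path \<omega>) k = b \<and> a - b = v}"
    by (auto simp: path_wait_def)
  also have "\<dots> \<in> events" by measurable
  finally show "(\<lambda>\<omega>. path_wait (path \<omega>) k) -` {v} \<inter> space M \<in> events" .
qed auto

text \<open>The \<open>r + 1\<close> visits at times \<open>m, ..., m + r\<close> involve only
  \<open>r\<close> transitions from \<open>k\<close> to \<open>k\<close>.\<close>

lemma holding_prob:
  assumes k: "k < d" and Q: "\<And>f g. (\<And>s. s \<le> m \<Longrightarrow> f s = g s) \<Longrightarrow> Q f \<longleftrightarrow> Q g"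
  shows "\<P>(\<omega> in M. Q (path \<omega>) \<and> (\<forall>i<Suc r. Z (m + i) \<omega> = k)) =
    \<theta> k ^ r * \<P>(\<omega> in M. Q (path \<omega>) \<and> Z m \<omega> = k)"
proof (induction r)
  case (Suc r)
  let ?Q = "\<lambda>f. Q f \<and> (\<forall>i<Suc r. f (m + i) = k)"
  have cong: "?Q f \<longleftrightarrow> ?Q g" if *: "\<And>s. s \<le> m + r \<Longrightarrow> f s = g s" for f g
  proof -
    have "Q f \<longleftrightarrow> Q g" by (rule Q) (use * in auto)
    then show ?thesis using * by auto
  qed
  have "\<P>(\<omega> in M. Q (path \<omega>) \<and> (\<forall>i<Suc (Suc r). Z (m + i) \<omega> = k)) =
      \<P>(\<omega> in M. (?Q (path \<omega>) \<and> Z (m + r) \<omega> = k) \<and> Z (Suc (m + r)) \<omega> = k)"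
    by (rule arg_cong[where f = "measure M"]) (auto simp: less_Suc_eq)
  also have "\<dots> = pure_birth_kernel d \<theta> $$ (k, k) * \<P>(\<omega> in M. (?Q (path \<omega>) \<and> Z (m + r) \<omega> = k) \<and> True)"
    by (rule markov_chain_history_step[OF mc, of k "m + r" ?Q k, OF _ cong]) (use k in auto)
  also have "\<P>(\<omega> in M. (?Q (path \<omega>) \<and> Z (m + r) \<omega> = k) \<and> True) =
      \<P>(\<omega> in M. Q (path \<omega>) \<and> (\<forall>i<Suc r. Z (m + i) \<omega> = k))"
    by (rule arg_cong[where f = "measure M"]) auto
  finally show ?case using Suc k by (simp add: pure_birth_kernel_def)
qed simp

lemma birth_after_holding_prob:
  assumes k: "k < d" and Q: "\<And>f g. (\<And>s. s \<le> m \<Longrightarrow> f s = g s) \<Longrightarrow> Q f \<longleftrightarrow> Q g"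
  shows "\<P>(\<omega> in M. Q (path \<omega>) \<and> (\<forall>i<Suc r. Z (m + i) \<omega> = k) \<and> Z (m + Suc r) \<omega> = Suc k) =
    \<theta> k ^ r * (1 - \<theta> k) * \<P>(\<omega> in M. Q (path \<omega>) \<and> Z m \<omega> = k)"
proof -
  let ?Q = "\<lambda>f. Q f \<and> (\<forall>i<Suc r. f (m + i) = k)"
  have cong: "?Q f \<longleftrightarrow> ?Q g" if *: "\<And>s. s \<le> m + r \<Longrightarrow> f s = g s" for f g
  proof -
    have "Q f \<longleftrightarrow> Q g" by (rule Q) (use * in auto)
    then show ?thesis using * by auto
  qed
  have "\<P>(\<omega> in M. Q (path \<omega>) \<and> (\<forall>i<Suc r. Z (m + i) \<omega> = k) \<and> Z (m + Suc r) \<omega> = Suc k) =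
      \<P>(\<omega> in M. (?Q (path \<omega>) \<and> Z (m + r) \<omega> = k) \<and> Z (Suc (m + r)) \<omega> = Suc k)"
    by (rule arg_cong[where f = "measure M"]) auto
  also have "\<dots> = pure_birth_kernel d \<theta> $$ (k, Suc k) * \<P>(\<omega> in M. (?Q (path \<omega>) \<and> Z (m + r) \<omega> = k) \<and> True)"
    by (rule markov_chain_history_step[OF mc, of "Suc k" "m + r" ?Q k, OF _ cong]) (use k in auto)
  also have "\<P>(\<omega> in M. (?Q (path \<omega>) \<and> Z (m + r) \<omega> = k) \<and> True) =
      \<P>(\<omega> in M. Q (path \<omega>) \<and> (\<forall>i<Suc r. Z (m + i) \<omega> = k))"
    by (rule arg_cong[where f = "measure M"]) auto
  also have "\<dots> = \<theta> k ^ r * \<P>(\<omega> in M. Q (path \<omega>) \<and> Z m \<omega> = k)"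
    using k Q by (rule holding_prob)
  finally show ?thesis using k by (simp add: pure_birth_kernel_def)
qed

abbreviation early_waits :: "nat \<Rightarrow> (nat \<Rightarrow> enat set) \<Rightarrow> (nat \<Rightarrow> nat) \<Rightarrow> bool" where
  "early_waits k S f \<equiv> \<forall>j<k. path_wait f j \<in> S j"

lemma early_waits_pred [measurable]: "Measurable.pred M (\<lambda>\<omega>. early_waits k S (path \<omega>))"
  by measurable

text \<open>The strong Markov property at the hit of \<open>k\<close>, obtained by fixing the value
  \<open>m\<close> of the hitting time: the wait is \<open>r + 1\<close> if \<open>r\<close>
  holdings are followed by a birth.\<close>

lemma wait_given_hit:
  assumes k: "k < d"
  shows "\<P>(\<omega> in M. (early_waits k S (path \<omega>) \<and> path_wait (path \<omega>) k = enat (Suc r)) \<and> path_hit (path \<omega>) k = enat m) =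
    \<theta> k ^ r * (1 - \<theta> k) * \<P>(\<omega> in M. early_waits k S (path \<omega>) \<and> path_hit (path \<omega>) k = enat m)"
proof -
  \<comment> \<open>Evaluating the earlier waiting times on the path stopped at \<open>m\<close> makes this an event of the
    history up to \<open>m\<close>.\<close>
  define Q where "Q f = (early_waits k S (\<lambda>s. f (min s m)) \<and> (\<forall>s<m. f s \<noteq> k))" for f
  have cong: "Q f \<longleftrightarrow> Q g" if "\<And>s. s \<le> m \<Longrightarrow> f s = g s" for f g
  proof -
    have "(\<lambda>s. f (min s m)) = (\<lambda>s. g (min s m))" using that by auto
    then show ?thesis using that by (auto simp: Q_def)
  qed
  have Q: "early_waits k S f \<and> path_hit f k = enat m \<longleftrightarrow> Q f \<and> f m = k" if b: "birth_path f" for f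
  proof (cases "path_hit f k = enat m")
    case True
    then have m: "f m = k" "\<forall>s<m. f s \<noteq> k" by (auto simp: path_hit_eq_enat)
    have "path_hit (\<lambda>s. f (min s m)) j = path_hit f j" if "j \<le> k" for j
      using birth_path_visits[OF b, of j m] m that by (intro path_hit_stopped) auto
    then have "path_wait (\<lambda>s. f (min s m)) j = path_wait f j" if "j < k" for j
      using that by (simp add: path_wait_def)
    then show ?thesis using True m by (auto simp: Q_def)
  next
    case False
    then show ?thesis by (auto simp: path_hit_eq_enat Q_def)
  qed
  have Qpred: "Measurable.pred M (\<lambda>\<omega>. Q (path \<omega>))"
    unfolding pred_def
  proof (rule path_event_decomposition(2)[of "{..d}" Z m Q "\<lambda>_. True"], goal_cases)
    case (4 f g)
    then show ?case by (rule cong)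
  qed (use bounded_nat_measurable(2,3)[OF Zm] in simp_all)
  have 1: "\<P>(\<omega> in M. (early_waits k S (path \<omega>) \<and> path_wait (path \<omega>) k = enat (Suc r)) \<and> path_hit (path \<omega>) k = enat m) =
      \<P>(\<omega> in M. Q (path \<omega>) \<and> (\<forall>i<Suc r. Z (m + i) \<omega> = k) \<and> Z (m + Suc r) \<omega> = Suc k)"
  proof (rule finite_measure_eq_AE)
    show "AE \<omega> in M. \<omega> \<in> {\<omega> \<in> space M. (early_waits k S (path \<omega>) \<and> path_wait (path \<omega>) k = enat (Suc r)) \<and> path_hit (path \<omega>) k = enat m} \<longleftrightarrow>
      \<omega> \<in> {\<omega> \<in> space M. Q (path \<omega>) \<and> (\<forall>i<Suc r. Z (m + i) \<omega> = k) \<and> Z (m + Suc r) \<omega> = Suc k}"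
      using birth_path_AE
    proof eventually_elim
      case (elim \<omega>)
      show ?case
      proof (cases "path_hit (path \<omega>) k = enat m")
        case True
        then show ?thesis using Q[OF elim] birth_path_wait_eq[OF elim True, of "Suc r"]
          by (simp add: path_hit_eq_enat)
      next
        case False
        have "\<not> (Q (path \<omega>) \<and> Z m \<omega> = k)" using Q[OF elim] False by auto
        then show ?thesis using False by (auto dest: spec[of _ 0])
      qed
    qed
  qed (use Qpred in measurable)
  have 2: "\<P>(\<omega> in M. early_waits k S (path \<omega>) \<and> path_hit (path \<omega>) k = enat m) =
      \<P>(\<omega> in M. Q (path \<omega>) \<and> Z m \<omega> = k)"
  proof (rule finite_measure_eq_AE)
    show "AE \<omega> in M. \<omega> \<in> {\<omega> \<in> space M. early_waits k S (path \<omega>) \<and> path_hit (path \<omega>) k = enat m} \<longleftrightarrow>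
      \<omega> \<in> {\<omega> \<in> space M. Q (path \<omega>) \<and> Z m \<omega> = k}"
      using birth_path_AE by eventually_elim (use Q in simp)
  qed (use Qpred in measurable)
  show ?thesis unfolding 1 2 using k cong by (rule birth_after_holding_prob)
qed

lemma wait_prob:
  assumes k: "k < d" and fin: "AE \<omega> in M. \<exists>m. path_hit (path \<omega>) k = enat m"
  shows "\<P>(\<omega> in M. early_waits k S (path \<omega>) \<and> path_wait (path \<omega>) k = enat (Suc r)) =
    \<theta> k ^ r * (1 - \<theta> k) * \<P>(\<omega> in M. early_waits k S (path \<omega>))"
proof -
  have "(\<lambda>m. \<P>(\<omega> in M. (early_waits k S (path \<omega>) \<and> path_wait (path \<omega>) k = enat (Suc r)) \<and> path_hit (path \<omega>) k = enat m)) sums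
      \<P>(\<omega> in M. early_waits k S (path \<omega>) \<and> path_wait (path \<omega>) k = enat (Suc r))"
    using fin by (intro prob_sums_enat[where g = "\<lambda>n. n"]) simp_all
  moreover have "(\<lambda>m. \<theta> k ^ r * (1 - \<theta> k) * \<P>(\<omega> in M. early_waits k S (path \<omega>) \<and> path_hit (path \<omega>) k = enat m)) sums
      (\<theta> k ^ r * (1 - \<theta> k) * \<P>(\<omega> in M. early_waits k S (path \<omega>)))"
    using fin by (intro sums_mult prob_sums_enat[where g = "\<lambda>n. n"]) simp_all
  ultimately show ?thesis unfolding wait_given_hit[OF k] by (rule sums_unique2)
qed

text \<open>The geometric weights sum to 1 because \<open>\<theta> k < 1\<close>, leaving no mass
  for 0 or infinity. Finite waits then propagate finite hitting times from state to state.\<close>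

lemma wait_finite_AE:
  assumes k: "k < d" and fin: "AE \<omega> in M. \<exists>m. path_hit (path \<omega>) k = enat m"
  shows "AE \<omega> in M. \<exists>n. path_wait (path \<omega>) k = enat (Suc n)"
proof -
  have p: "\<P>(\<omega> in M. path_wait (path \<omega>) k = enat (Suc r)) = \<theta> k ^ r * (1 - \<theta> k)" for r
    using wait_prob[OF k fin, of "\<lambda>_. UNIV" r] by (simp add: prob_space)
  have "(\<lambda>r. \<theta> k ^ r * (1 - \<theta> k)) sums (1 / (1 - \<theta> k) * (1 - \<theta> k))"
    using thlt[OF k] thnn[OF k] by (intro sums_mult2 geometric_sums) simp
  then have 1: "(\<lambda>r. \<theta> k ^ r * (1 - \<theta> k)) sums 1" using thlt[OF k] by simp
  have "(\<lambda>r. \<P>(\<omega> in M. path_wait (path \<omega>) k = enat (Suc r))) sums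
      measure M (\<Union>r. {\<omega> \<in> space M. path_wait (path \<omega>) k = enat (Suc r)})"
    by (rule finite_measure_UNION) (auto simp: disjoint_family_on_def)
  then have "measure M (\<Union>r. {\<omega> \<in> space M. path_wait (path \<omega>) k = enat (Suc r)}) = 1"
    unfolding p using 1 by (rule sums_unique2)
  from AE_prob_1[OF this] show ?thesis by eventually_elim auto
qed

lemma hit_finite_AE: "k \<le> d \<Longrightarrow> AE \<omega> in M. \<exists>m. path_hit (path \<omega>) k = enat m"
proof (induction k)
  case 0
  show ?case using Z0 by eventually_elim (auto simp: path_hit_finite)
next
  case (Suc k)
  then have fin: "AE \<omega> in M. \<exists>m. path_hit (path \<omega>) k = enat m" by simp
  have "AE \<omega> in M. \<exists>n. path_wait (path \<omega>) k = enat (Suc n)"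
    using Suc.prems fin by (intro wait_finite_AE) auto
  then show ?case using fin
  proof eventually_elim
    case (elim \<omega>)
    then show ?case by (cases "path_hit (path \<omega>) (Suc k)") (auto simp: path_wait_def)
  qed
qed

lemma wait_geometric: "k < d \<Longrightarrow> geometric_time M (\<theta> k) (waiting_time Z k)"
  unfolding geometric_time_def waiting_time_path
proof (intro allI impI)
  fix n :: nat assume k: "k < d" and n: "1 \<le> n"
  have "\<P>(\<omega> in M. path_wait (path \<omega>) k = enat (Suc (n - 1))) = \<theta> k ^ (n - 1) * (1 - \<theta> k)"
    using wait_prob[OF k hit_finite_AE, of "\<lambda>_. UNIV" "n - 1"] k by (simp add: prob_space)
  then show "\<P>(\<omega> in M. path_wait (path \<omega>) k = enat n) = \<theta> k ^ (n - 1) * (1 - \<theta> k)"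
    using n by simp
qed

text \<open>The series over the values of the wait has the common factor
  \<open>P(early waits)\<close>. The same series for unrestricted early waits identifies the
  cofactor as the probability that the wait lies in \<open>B\<close>.\<close>

lemma wait_indep_step:
  assumes k: "k < d"
  shows "\<P>(\<omega> in M. early_waits k S (path \<omega>) \<and> path_wait (path \<omega>) k \<in> B) =
    \<P>(\<omega> in M. early_waits k S (path \<omega>)) * \<P>(\<omega> in M. path_wait (path \<omega>) k \<in> B)"
proof -
  have fin: "AE \<omega> in M. \<exists>m. path_hit (path \<omega>) k = enat m" using k by (intro hit_finite_AE) simp
  have sums: "(\<lambda>n. of_bool (enat (Suc n) \<in> B) * (\<theta> k ^ n * (1 - \<theta> k)) * \<P>(\<omega> in M. early_waits k S (path \<omega>))) sums
      \<P>(\<omega> in M. early_waits k S (path \<omega>) \<and> path_wait (path \<omega>) k \<in> B)" for S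
  proof -
    have "(\<lambda>n. \<P>(\<omega> in M. (early_waits k S (path \<omega>) \<and> path_wait (path \<omega>) k \<in> B) \<and> path_wait (path \<omega>) k = enat (Suc n))) sums
      \<P>(\<omega> in M. early_waits k S (path \<omega>) \<and> path_wait (path \<omega>) k \<in> B)"
      using wait_finite_AE[OF k fin] by (intro prob_sums_enat[where g = Suc]) simp_all
    moreover have "\<P>(\<omega> in M. (early_waits k S (path \<omega>) \<and> path_wait (path \<omega>) k \<in> B) \<and> path_wait (path \<omega>) k = enat (Suc n)) =
      of_bool (enat (Suc n) \<in> B) * (\<theta> k ^ n * (1 - \<theta> k)) * \<P>(\<omega> in M. early_waits k S (path \<omega>))" for n
    proof (cases "enat (Suc n) \<in> B")
      case True
      then have "\<P>(\<omega> in M. (early_waits k S (path \<omega>) \<and> path_wait (path \<omega>) k \<in> B) \<and> path_wait (path \<omega>) k = enat (Suc n)) =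
        \<P>(\<omega> in M. early_waits k S (path \<omega>) \<and> path_wait (path \<omega>) k = enat (Suc n))"
        by (intro arg_cong[where f = "measure M"]) auto
      then show ?thesis using True wait_prob[OF k fin, of S n] by simp
    next
      case False
      then have "{\<omega> \<in> space M. (early_waits k S (path \<omega>) \<and> path_wait (path \<omega>) k \<in> B) \<and> path_wait (path \<omega>) k = enat (Suc n)} = {}"
        by auto
      then show ?thesis using False by (simp only: measure_empty) simp
    qed
    ultimately show ?thesis by simp
  qed
  have "(\<lambda>n. of_bool (enat (Suc n) \<in> B) * (\<theta> k ^ n * (1 - \<theta> k))) sums \<P>(\<omega> in M. path_wait (path \<omega>) k \<in> B)"
    using sums[of "\<lambda>_. UNIV"] by (simp add: prob_space)
  from sums_mult2[OF this, of "\<P>(\<omega> in M. early_waits k S (path \<omega>))"] sums[of S]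
  have "\<P>(\<omega> in M. path_wait (path \<omega>) k \<in> B) * \<P>(\<omega> in M. early_waits k S (path \<omega>)) =
      \<P>(\<omega> in M. early_waits k S (path \<omega>) \<and> path_wait (path \<omega>) k \<in> B)"
    by (rule sums_unique2)
  then show ?thesis by (simp add: mult.commute)
qed

lemma waits_prod:
  "k \<le> d \<Longrightarrow> \<P>(\<omega> in M. early_waits k S (path \<omega>)) = (\<Prod>j<k. \<P>(\<omega> in M. path_wait (path \<omega>) j \<in> S j))"
proof (induction k)
  case (Suc k)
  have "\<P>(\<omega> in M. early_waits (Suc k) S (path \<omega>)) =
      \<P>(\<omega> in M. early_waits k S (path \<omega>) \<and> path_wait (path \<omega>) k \<in> S k)"
    by (intro arg_cong[where f = "measure M"]) (auto simp: less_Suc_eq)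
  then show ?case using wait_indep_step[of k S "S k"] Suc by simp
qed (simp add: prob_space)

text \<open>Each family of preimages contains the whole space, so the product rule for all
  \<open>d\<close> indices at once suffices. Subfamilies arise by taking \<open>UNIV\<close> at the
  remaining indices.\<close>

lemma waits_indep: "indep_vars (\<lambda>_. count_space UNIV) (waiting_time Z) {..<d}"
  unfolding indep_vars_def2
proof (intro conjI ballI)
  show "random_variable (count_space UNIV) (waiting_time Z k)" for k
    unfolding waiting_time_path[abs_def] by measurable
  let ?F = "\<lambda>i. {waiting_time Z i -` A \<inter> space M | A. A \<in> sets (count_space UNIV)}"
  show "indep_sets ?F {..<d}"
  proof (cases "d = 0")
    case True
    then show ?thesis by (simp add: indep_sets_def)
  next
    case False
    show ?thesis
    proof (subst indep_sets_finite)
      show "{..<d} \<noteq> {}" using False by (auto simp: lessThan_empty_iff)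
      show "?F i \<subseteq> events" for i
      proof
        fix B assume "B \<in> ?F i"
        then obtain A where B: "B = waiting_time Z i -` A \<inter> space M" by blast
        have "waiting_time Z i \<in> M \<rightarrow>\<^sub>M count_space UNIV"
          unfolding waiting_time_path[abs_def] by measurable
        then show "B \<in> events" unfolding B by (rule measurable_sets) simp
      qed
      show "space M \<in> ?F i" for i by (auto intro!: exI[of _ UNIV])
      show "\<forall>A\<in>Pi {..<d} ?F. prob (\<Inter>j\<in>{..<d}. A j) = (\<Prod>j\<in>{..<d}. prob (A j))"
      proof
        fix A assume "A \<in> Pi {..<d} ?F"
        then have "\<forall>j\<in>{..<d}. \<exists>S. A j = waiting_time Z j -` S \<inter> space M" by auto
        then obtain S where S: "\<And>j. j < d \<Longrightarrow> A j = waiting_time Z j -` S j \<inter> space M"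
          by (metis lessThan_iff)
        have "(\<Inter>j\<in>{..<d}. A j) = {\<omega> \<in> space M. early_waits d S (path \<omega>)}"
          using S False by (auto simp: waiting_time_path)
        moreover have "A j = {\<omega> \<in> space M. path_wait (path \<omega>) j \<in> S j}" if "j < d" for j
          using S[OF that] by (auto simp: waiting_time_path)
        ultimately show "prob (\<Inter>j\<in>{..<d}. A j) = (\<Prod>j\<in>{..<d}. prob (A j))"
          using waits_prod[of d S] by simp
      qed
    qed simp
  qed
qed

lemma waits_sum_AE: "AE \<omega> in M. (\<Sum>k<d. waiting_time Z k \<omega>) = hitting_time Z d \<omega>"
proof -
  have "AE \<omega> in M. \<forall>k\<in>{..d}. \<exists>m. path_hit (path \<omega>) k = enat m"
    by (intro AE_ball_countable[THEN iffD2] countable_finite finite_atMost ballI hit_finite_AE) simp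
  then show ?thesis using birth_path_AE
  proof eventually_elim
    case (elim \<omega>)
    have "path_hit (path \<omega>) j < \<infinity>" if j: "j \<le> d" for j
    proof -
      obtain m where "path_hit (path \<omega>) j = enat m" using elim(1) j by auto
      then show ?thesis by simp
    qed
    then show ?case unfolding waiting_time_path hitting_time_path by (rule sum_path_wait[OF elim(2)])
  qed
qed

end

section \<open>Strong stationary times\<close>

context prob_space
begin

lemma set_integral_finite_valued:
  fixes g :: "nat \<Rightarrow> real"
  assumes A: "A \<in> events" and Y: "Y \<in> M \<rightarrow>\<^sub>M count_space {..d}"
  shows "(\<integral>\<omega>\<in>A. g (Y \<omega>) \<partial>M) = (\<Sum>x\<le>d. g x * prob (A \<inter> {\<omega> \<in> space M. Y \<omega> = x}))"
proof -
  note Yf = bounded_nat_measurable[OF Y]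
  have AY: "A \<inter> {\<omega> \<in> space M. Y \<omega> = x} \<in> events" for x using A Yf(3) by auto
  have "(\<integral>\<omega>\<in>A. g (Y \<omega>) \<partial>M) = (\<integral>\<omega>. (\<Sum>x\<le>d. g x * indicator (A \<inter> {\<omega> \<in> space M. Y \<omega> = x}) \<omega>) \<partial>M)"
    unfolding set_lebesgue_integral_def
  proof (rule Bochner_Integration.integral_cong[OF refl])
    fix \<omega> assume \<omega>: "\<omega> \<in> space M"
    have "(\<Sum>x\<le>d. g x * indicator (A \<inter> {\<omega> \<in> space M. Y \<omega> = x}) \<omega>) =
        (\<Sum>x\<le>d. if x = Y \<omega> then g x * indicator A \<omega> else 0)"
      using \<omega> by (intro sum.cong) (auto simp: indicator_def)
    then show "indicat_real A \<omega> *\<^sub>R g (Y \<omega>) = (\<Sum>x\<le>d. g x * indicator (A \<inter> {\<omega> \<in> space M. Y \<omega> = x}) \<omega>)"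
      using Yf(2)[OF \<omega>] by simp
  qed
  also have "\<dots> = (\<Sum>x\<le>d. \<integral>\<omega>. g x * indicator (A \<inter> {\<omega> \<in> space M. Y \<omega> = x}) \<omega> \<partial>M)"
    using AY by (intro Bochner_Integration.integral_sum integrable_mult_right) (simp add: integrable_real_indicator emeasure_eq_measure)
  also have "\<dots> = (\<Sum>x\<le>d. g x * prob (A \<inter> {\<omega> \<in> space M. Y \<omega> = x}))"
    using AY by (intro sum.cong refl) (simp add: emeasure_eq_measure)
  finally show ?thesis .
qed

text \<open>Translates the conditional Markov property into finite sums over events of the
  filtration. One direction exploits the unknown filtration of a competitor, the other verifies the
  property for the history of the pair.\<close>

lemma real_cond_exp_indicator_iff:
  fixes g :: "nat \<Rightarrow> real"
  assumes sub: "subalgebra M F" and Y: "Y \<in> F \<rightarrow>\<^sub>M count_space {..d}" and B: "B \<in> events"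
  shows "(AE \<omega> in M. real_cond_exp M F (indicat_real B) \<omega> = g (Y \<omega>)) \<longleftrightarrow>
    (\<forall>A\<in>sets F. prob (A \<inter> B) = (\<Sum>x\<le>d. g x * prob (A \<inter> {\<omega> \<in> space M. Y \<omega> = x})))"
proof -
  interpret F: finite_measure "restr_to_subalg M F"
    using finite_measure_restr_to_subalg[OF sub] finite_measure_axioms by blast
  interpret sigma_finite_subalgebra M F
    using sub F.sigma_finite_measure by (intro sigma_finite_subalgebra.intro) auto
  have YM: "Y \<in> M \<rightarrow>\<^sub>M count_space {..d}" using measurable_from_subalg[OF sub Y] .
  have AM: "A \<in> events" if "A \<in> sets F" for A using sub that by (auto simp: subalgebra_def)
  have gY: "(\<lambda>\<omega>. g (Y \<omega>)) \<in> borel_measurable F"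
    using Y by (rule measurable_compose) simp
  have gYM: "(\<lambda>\<omega>. g (Y \<omega>)) \<in> borel_measurable M"
    using YM by (rule measurable_compose) simp
  have gint: "integrable M (\<lambda>\<omega>. g (Y \<omega>))"
  proof (rule integrable_const_bound[where B = "\<Sum>x\<le>d. \<bar>g x\<bar>"])
    show "AE \<omega> in M. norm (g (Y \<omega>)) \<le> (\<Sum>x\<le>d. \<bar>g x\<bar>)"
    proof (rule AE_I2)
      fix \<omega> assume "\<omega> \<in> space M"
      then have "Y \<omega> \<in> {..d}" using bounded_nat_measurable(2)[OF YM] by simp
      then show "norm (g (Y \<omega>)) \<le> (\<Sum>x\<le>d. \<bar>g x\<bar>)"
        using member_le_sum[of "Y \<omega>" "{..d}" "\<lambda>x. \<bar>g x\<bar>"] by simp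
    qed
  qed (rule gYM)
  have Bint: "integrable M (indicat_real B)" using B by (simp add: integrable_real_indicator emeasure_eq_measure)
  have indB: "(\<integral>\<omega>\<in>A. indicat_real B \<omega> \<partial>M) = prob (A \<inter> B)" if "A \<in> sets F" for A
  proof -
    have "(\<integral>\<omega>\<in>A. indicat_real B \<omega> \<partial>M) = (\<integral>\<omega>. indicat_real (A \<inter> B) \<omega> \<partial>M)"
      unfolding set_lebesgue_integral_def
      by (intro Bochner_Integration.integral_cong refl) (simp add: indicator_inter_arith)
    then show ?thesis using AM[OF that] B by (simp add: emeasure_eq_measure)
  qed
  note gA = set_integral_finite_valued[OF AM YM, of _ g]
  show ?thesis
  proof
    assume ae: "AE \<omega> in M. real_cond_exp M F (indicat_real B) \<omega> = g (Y \<omega>)"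
    show "\<forall>A\<in>sets F. prob (A \<inter> B) = (\<Sum>x\<le>d. g x * prob (A \<inter> {\<omega> \<in> space M. Y \<omega> = x}))"
    proof
      fix A assume A: "A \<in> sets F"
      have "prob (A \<inter> B) = (\<integral>\<omega>\<in>A. real_cond_exp M F (indicat_real B) \<omega> \<partial>M)"
        using real_cond_exp_intA[OF Bint A] indB[OF A] by simp
      also have "\<dots> = (\<integral>\<omega>\<in>A. g (Y \<omega>) \<partial>M)"
        unfolding set_lebesgue_integral_def
      proof (rule integral_cong_AE)
        show "AE \<omega> in M. indicat_real A \<omega> *\<^sub>R real_cond_exp M F (indicat_real B) \<omega> = indicat_real A \<omega> *\<^sub>R g (Y \<omega>)"
          using ae by eventually_elim simp
      qed (use AM[OF A] gYM in measurable)
      finally show "prob (A \<inter> B) = (\<Sum>x\<le>d. g x * prob (A \<inter> {\<omega> \<in> space M. Y \<omega> = x}))"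
        using gA[OF A] by simp
    qed
  next
    assume *: "\<forall>A\<in>sets F. prob (A \<inter> B) = (\<Sum>x\<le>d. g x * prob (A \<inter> {\<omega> \<in> space M. Y \<omega> = x}))"
    show "AE \<omega> in M. real_cond_exp M F (indicat_real B) \<omega> = g (Y \<omega>)"
    proof (rule real_cond_exp_charact[OF _ Bint gint gY])
      fix A assume A: "A \<in> sets F"
      show "(\<integral>\<omega>\<in>A. indicat_real B \<omega> \<partial>M) = (\<integral>\<omega>\<in>A. g (Y \<omega>) \<partial>M)"
        using indB[OF A] gA[OF A] * A by simp
    qed
  qed
qed

lemma indep_var_count_spaceI:
  fixes Y T :: "'a \<Rightarrow> 'c"
  assumes Y: "Y \<in> M \<rightarrow>\<^sub>M count_space UNIV" and T: "T \<in> M \<rightarrow>\<^sub>M count_space UNIV"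
    and eq: "\<And>A B. \<P>(\<omega> in M. T \<omega> \<in> B \<and> Y \<omega> \<in> A) = \<P>(\<omega> in M. Y \<omega> \<in> A) * \<P>(\<omega> in M. T \<omega> \<in> B)"
  shows "indep_var (count_space UNIV) Y (count_space UNIV) T"
proof -
  have st: "Int_stable {W -` A \<inter> space M |A. A \<in> sets (count_space UNIV)}" for W :: "'a \<Rightarrow> 'c"
    unfolding Int_stable_def
  proof (intro ballI)
    fix a b assume "a \<in> {W -` A \<inter> space M |A. A \<in> sets (count_space UNIV)}"
      "b \<in> {W -` A \<inter> space M |A. A \<in> sets (count_space UNIV)}"
    then obtain A B where "a = W -` A \<inter> space M" "b = W -` B \<inter> space M" by blast
    then have "a \<inter> b = W -` (A \<inter> B) \<inter> space M" by auto
    then show "a \<inter> b \<in> {W -` A \<inter> space M |A. A \<in> sets (count_space UNIV)}"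
      by (intro CollectI exI[of _ "A \<inter> B"]) simp
  qed
  have "indep_set {Y -` A \<inter> space M |A. A \<in> sets (count_space UNIV)} {T -` A \<inter> space M |A. A \<in> sets (count_space UNIV)}"
  proof (rule indep_setI)
    show "{Y -` A \<inter> space M |A. A \<in> sets (count_space UNIV)} \<subseteq> events"
      using measurable_sets[OF Y] by blast
    show "{T -` A \<inter> space M |A. A \<in> sets (count_space UNIV)} \<subseteq> events"
      using measurable_sets[OF T] by blast
    fix a b assume "a \<in> {Y -` A \<inter> space M |A. A \<in> sets (count_space UNIV)}"
      "b \<in> {T -` A \<inter> space M |A. A \<in> sets (count_space UNIV)}"
    then obtain A B where ab: "a = Y -` A \<inter> space M" "b = T -` B \<inter> space M" by blast
    then have "a \<inter> b = {\<omega> \<in> space M. T \<omega> \<in> B \<and> Y \<omega> \<in> A}" "a = {\<omega> \<in> space M. Y \<omega> \<in> A}"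
      "b = {\<omega> \<in> space M. T \<omega> \<in> B}" by auto
    then show "prob (a \<inter> b) = prob a * prob b" using eq[of B A] by simp
  qed
  then show ?thesis unfolding indep_var_eq using Y T st by (blast intro: indep_set_sigma_sets)
qed

end

text \<open>The law of the chain started at 0, computed from the kernel alone. It is the common
  quantity through which times on different probability spaces are compared.\<close>

primrec chain_law :: "nat \<Rightarrow> real mat \<Rightarrow> nat \<Rightarrow> nat \<Rightarrow> real" where
  "chain_law d K 0 y = of_bool (y = 0)"
| "chain_law d K (Suc t) y = (\<Sum>x\<le>d. K $$ (x, y) * chain_law d K t x)"

section \<open>The bound satisfied by every strong stationary time\<close>

context prob_space
begin

lemma markov_chain_wrt_measurable:
  assumes "markov_chain_wrt M F d K X"
  shows "X t \<in> M \<rightarrow>\<^sub>M count_space {..d}" "A \<in> sets (F t) \<Longrightarrow> A \<in> events" "space (F t) = space M"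
proof -
  have sub: "subalgebra M (F t)" and Xt: "X t \<in> F t \<rightarrow>\<^sub>M count_space {..d}"
    using assms by (auto simp: markov_chain_wrt_def)
  show "X t \<in> M \<rightarrow>\<^sub>M count_space {..d}" by (rule measurable_from_subalg[OF sub Xt])
  show "A \<in> sets (F t) \<Longrightarrow> A \<in> events" "space (F t) = space M"
    using sub by (auto simp: subalgebra_def)
qed

lemma markov_chain_wrt_step:
  assumes mw: "markov_chain_wrt M F d K X" and A: "A \<in> sets (F t)" and y: "y \<le> d"
  shows "prob (A \<inter> {\<omega> \<in> space M. X (Suc t) \<omega> = y}) =
    (\<Sum>x\<le>d. K $$ (x, y) * prob (A \<inter> {\<omega> \<in> space M. X t \<omega> = x}))"
proof -
  have sub: "subalgebra M (F t)" and Xt: "X t \<in> F t \<rightarrow>\<^sub>M count_space {..d}"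
    and ae: "AE \<omega> in M. real_cond_exp M (F t) (indicat_real {\<omega> \<in> space M. X (Suc t) \<omega> = y}) \<omega> = K $$ (X t \<omega>, y)"
    using mw y by (auto simp: markov_chain_wrt_def)
  have B: "{\<omega> \<in> space M. X (Suc t) \<omega> = y} \<in> events"
    by (rule bounded_nat_measurable(3)[OF markov_chain_wrt_measurable(1)[OF mw]])
  show ?thesis
    using real_cond_exp_indicator_iff[OF sub Xt B, of "\<lambda>x. K $$ (x, y)"] ae A by blast
qed

lemma markov_chain_wrt_law:
  assumes mw: "markov_chain_wrt M F d K X" and X0: "AE \<omega> in M. X 0 \<omega> = 0" and y: "y \<le> d"
  shows "\<P>(\<omega> in M. X t \<omega> = y) = chain_law d K t y"
  using y
proof (induction t arbitrary: y)
  case 0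
  have [measurable]: "X 0 \<in> M \<rightarrow>\<^sub>M count_space UNIV"
    by (rule bounded_nat_measurable(1)[OF markov_chain_wrt_measurable(1)[OF mw]])
  have "\<P>(\<omega> in M. X 0 \<omega> = y) = \<P>(\<omega> in M. y = 0)"
  proof (rule finite_measure_eq_AE)
    show "AE \<omega> in M. \<omega> \<in> {\<omega> \<in> space M. X 0 \<omega> = y} \<longleftrightarrow> \<omega> \<in> {\<omega> \<in> space M. y = 0}"
      using X0 by eventually_elim auto
  qed measurable
  then show ?case by (cases "y = 0") (simp_all add: prob_space)
next
  case (Suc t)
  have in1: "space M \<inter> {\<omega> \<in> space M. R \<omega>} = {\<omega> \<in> space M. R \<omega>}" for R by auto
  have "space M \<in> sets (F t)" using markov_chain_wrt_measurable(3)[OF mw, of t] by (metis sets.top)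
  from markov_chain_wrt_step[OF mw this Suc.prems] show ?case using Suc.IH by (simp add: in1)
qed

lemma strong_stationary_time_joint:
  assumes sst: "strong_stationary_time M d K \<pi> X T" and y: "y \<le> d"
  shows "\<P>(\<omega> in M. T \<omega> = enat s \<and> X s \<omega> = y) = \<pi> y * \<P>(\<omega> in M. T \<omega> = enat s)"
proof -
  let ?Y = "\<lambda>\<omega>. X (the_enat (T \<omega>)) \<omega>"
  \<comment> \<open>\<open>indep_var\<close> wants both variables of one type, so the state is coerced to \<open>enat\<close>.\<close>
  have ind: "indep_var (count_space UNIV) (\<lambda>\<omega>. enat (?Y \<omega>)) (count_space UNIV) T"
    and law: "\<P>(\<omega> in M. ?Y \<omega> = y) = \<pi> y"
    using sst y by (auto simp: strong_stationary_time_def)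
  have "prob ((\<lambda>\<omega>. (enat (?Y \<omega>), T \<omega>)) -` ({enat y} \<times> {enat s}) \<inter> space M) =
      prob ((\<lambda>\<omega>. enat (?Y \<omega>)) -` {enat y} \<inter> space M) * prob (T -` {enat s} \<inter> space M)"
    by (rule indep_varD[OF ind]) simp_all
  moreover have "(\<lambda>\<omega>. (enat (?Y \<omega>), T \<omega>)) -` ({enat y} \<times> {enat s}) \<inter> space M =
      {\<omega> \<in> space M. T \<omega> = enat s \<and> X s \<omega> = y}"
    by auto
  moreover have "(\<lambda>\<omega>. enat (?Y \<omega>)) -` {enat y} \<inter> space M = {\<omega> \<in> space M. ?Y \<omega> = y}"
    "T -` {enat s} \<inter> space M = {\<omega> \<in> space M. T \<omega> = enat s}"
    by auto
  ultimately show ?thesis using law by simp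
qed

text \<open>At a strong stationary time the chain is already stationary and stays so; hence
  \<open>X\<^sub>t\<close> puts at least the mass \<open>P(T \<le> t) \<pi> y\<close> on every state \<open>y\<close>.\<close>

lemma strong_stationary_time_bound:
  assumes sst: "strong_stationary_time M d K \<pi> X T" and X0: "AE \<omega> in M. X 0 \<omega> = 0"
    and st: "\<And>y. y \<le> d \<Longrightarrow> (\<Sum>x\<le>d. \<pi> x * K $$ (x, y)) = \<pi> y" and y: "y \<le> d"
  shows "\<pi> y * \<P>(\<omega> in M. T \<omega> \<le> enat t) \<le> chain_law d K t y"
proof -
  obtain F where mw: "markov_chain_wrt M F d K X" and TF: "\<And>t. Measurable.pred (F t) (\<lambda>\<omega>. T \<omega> \<le> enat t)"
    using sst by (auto simp: strong_stationary_time_def)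
  have [measurable]: "T \<in> M \<rightarrow>\<^sub>M count_space UNIV"
    using sst indep_var_rv2 by (auto simp: strong_stationary_time_def)
  have [measurable]: "X t \<in> M \<rightarrow>\<^sub>M count_space UNIV" for t
    by (rule bounded_nat_measurable(1)[OF markov_chain_wrt_measurable(1)[OF mw]])
  have TA: "{\<omega> \<in> space M. T \<omega> \<le> enat t} \<in> sets (F t)" for t
    using TF[of t] markov_chain_wrt_measurable(3)[OF mw, of t] by (simp add: pred_def)
  \<comment> \<open>Induction on \<open>t\<close>: the event \<open>T \<le> t\<close> belongs to
    \<open>F t\<close>, so one step of the kernel there preserves \<open>\<pi>\<close>, and the new
    part \<open>T = t + 1\<close> is independent of the state at that time.\<close>
  have eq: "\<P>(\<omega> in M. T \<omega> \<le> enat t \<and> X t \<omega> = y) = \<pi> y * \<P>(\<omega> in M. T \<omega> \<le> enat t)" if "y \<le> d" for y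
    using that
  proof (induction t arbitrary: y)
    case 0
    have "T \<omega> \<le> enat 0 \<longleftrightarrow> T \<omega> = enat 0" for \<omega> by (simp add: zero_enat_def[symmetric])
    then show ?case using strong_stationary_time_joint[OF sst 0, of 0] by (simp only:)
  next
    case (Suc t)
    let ?A = "{\<omega> \<in> space M. T \<omega> \<le> enat t}"
    have le: "T \<omega> \<le> enat (Suc t) \<longleftrightarrow> T \<omega> \<le> enat t \<or> T \<omega> = enat (Suc t)" for \<omega>
      by (cases "T \<omega>") auto
    have split: "\<P>(\<omega> in M. T \<omega> \<le> enat (Suc t) \<and> R \<omega>) =
        \<P>(\<omega> in M. T \<omega> \<le> enat t \<and> R \<omega>) + \<P>(\<omega> in M. T \<omega> = enat (Suc t) \<and> R \<omega>)"
      if [measurable]: "Measurable.pred M R" for R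
    proof -
      have "{\<omega> \<in> space M. T \<omega> \<le> enat (Suc t) \<and> R \<omega>} =
          {\<omega> \<in> space M. T \<omega> \<le> enat t \<and> R \<omega>} \<union> {\<omega> \<in> space M. T \<omega> = enat (Suc t) \<and> R \<omega>}"
        using le by auto
      then show ?thesis by (simp only:) (rule finite_measure_Union, auto)
    qed
    have in1: "?A \<inter> {\<omega> \<in> space M. R \<omega>} = {\<omega> \<in> space M. T \<omega> \<le> enat t \<and> R \<omega>}" for R by auto
    have "\<P>(\<omega> in M. T \<omega> \<le> enat t \<and> X (Suc t) \<omega> = y) =
        (\<Sum>x\<le>d. K $$ (x, y) * \<P>(\<omega> in M. T \<omega> \<le> enat t \<and> X t \<omega> = x))"
      using markov_chain_wrt_step[OF mw TA Suc.prems, of t] unfolding in1 .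
    also have "\<dots> = (\<Sum>x\<le>d. \<pi> x * K $$ (x, y)) * \<P>(\<omega> in M. T \<omega> \<le> enat t)"
      unfolding sum_distrib_right using Suc.IH by (intro sum.cong) (auto simp: mult_ac)
    also have "\<dots> = \<pi> y * \<P>(\<omega> in M. T \<omega> \<le> enat t)" using st[OF Suc.prems] by simp
    finally have "\<P>(\<omega> in M. T \<omega> \<le> enat (Suc t) \<and> X (Suc t) \<omega> = y) =
        \<pi> y * (\<P>(\<omega> in M. T \<omega> \<le> enat t) + \<P>(\<omega> in M. T \<omega> = enat (Suc t)))"
      using split[of "\<lambda>\<omega>. X (Suc t) \<omega> = y"] strong_stationary_time_joint[OF sst Suc.prems, of "Suc t"]
      by (simp add: distrib_left)
    then show ?case using split[of "\<lambda>_. True"] by simp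
  qed
  have "\<P>(\<omega> in M. T \<omega> \<le> enat t \<and> X t \<omega> = y) \<le> \<P>(\<omega> in M. X t \<omega> = y)"
    by (intro finite_measure_mono) auto
  then show ?thesis using eq[OF y] markov_chain_wrt_law[OF mw X0 y] by simp
qed

end

section \<open>The absorption time is strong stationary and fastest\<close>

context dual_chain
begin

definition hist :: "nat \<Rightarrow> 'a measure" where
  "hist t = vimage_algebra (space M) (\<lambda>\<omega>. restrict (pair \<omega>) {..t}) (count_space UNIV)"

lemma space_hist: "space (hist t) = space M" by (simp add: hist_def)

lemma sets_hist: "sets (hist t) = {{\<omega> \<in> space M. restrict (pair \<omega>) {..t} \<in> A} |A. True}"
proof -
  have "sets (hist t) = {(\<lambda>\<omega>. restrict (pair \<omega>) {..t}) -` A \<inter> space M |A. A \<in> sets (count_space UNIV)}"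
    unfolding hist_def by (rule sets_vimage_algebra2) simp
  moreover have "(\<lambda>\<omega>. restrict (pair \<omega>) {..t}) -` A \<inter> space M = {\<omega> \<in> space M. restrict (pair \<omega>) {..t} \<in> A}" for A
    by auto
  ultimately show ?thesis by simp
qed

lemma hist_memI:
  assumes Q: "\<And>f g. (\<And>s. s \<le> t \<Longrightarrow> f s = g s) \<Longrightarrow> Q f \<longleftrightarrow> Q g"
  shows "{\<omega> \<in> space M. Q (pair \<omega>)} \<in> sets (hist t)"
proof -
  have "Q (restrict f {..t}) \<longleftrightarrow> Q f" for f by (rule Q) simp
  then have "{\<omega> \<in> space M. Q (pair \<omega>)} = {\<omega> \<in> space M. restrict (pair \<omega>) {..t} \<in> {f. Q f}}" by auto
  then show ?thesis unfolding sets_hist by blast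
qed

lemma hist_memE:
  assumes "A \<in> sets (hist t)"
  obtains Q where "\<And>f g. (\<And>s. s \<le> t \<Longrightarrow> f s = g s) \<Longrightarrow> Q f \<longleftrightarrow> Q g" "A = {\<omega> \<in> space M. Q (pair \<omega>)}"
proof -
  obtain B where A: "A = {\<omega> \<in> space M. restrict (pair \<omega>) {..t} \<in> B}" using assms sets_hist by auto
  have "restrict f {..t} = restrict g {..t}" if "\<And>s. s \<le> t \<Longrightarrow> f s = g s" for f g :: "nat \<Rightarrow> nat \<times> nat"
    using that by (auto simp: restrict_def)
  then show thesis using that[of "\<lambda>f. restrict f {..t} \<in> B"] A by metis
qed

lemma hist_event:
  assumes "A \<in> sets (hist t)"
  shows "A \<in> events"
proof -
  obtain Q where Q: "\<And>f g. (\<And>s. s \<le> t \<Longrightarrow> f s = g s) \<Longrightarrow> Q f \<longleftrightarrow> Q g" and A: "A = {\<omega> \<in> space M. Q (pair \<omega>)}"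
    using assms by (rule hist_memE) blast
  show ?thesis unfolding A
  proof (rule path_event_decomposition(2)[of "{..d} \<times> {..d}" "\<lambda>s \<omega>. pair \<omega> s" t Q "\<lambda>_. True"], goal_cases)
    case (4 f g)
    then show ?case by (rule Q)
  qed (rule pair_finite sets.top | simp)+
qed

lemma hist_subalgebra: "subalgebra M (hist t)"
  unfolding subalgebra_def using hist_event space_hist by auto

lemma hist_filtration: "filtration (space M) hist"
proof
  show "space (hist i) = space M" for i by (rule space_hist)
  show "sets (hist i) \<subseteq> sets (hist j)" if "i \<le> j" for i j
  proof
    fix A assume "A \<in> sets (hist i)"
    then obtain Q where Q: "\<And>f g. (\<And>s. s \<le> i \<Longrightarrow> f s = g s) \<Longrightarrow> Q f \<longleftrightarrow> Q g" and A: "A = {\<omega> \<in> space M. Q (pair \<omega>)}"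
      by (rule hist_memE) blast
    show "A \<in> sets (hist j)" unfolding A
    proof (rule hist_memI)
      fix f g :: "nat \<Rightarrow> nat \<times> nat" assume "\<And>s. s \<le> j \<Longrightarrow> f s = g s"
      then show "Q f \<longleftrightarrow> Q g" using \<open>i \<le> j\<close> by (intro Q) auto
    qed
  qed
qed

lemma X_hist_measurable: "X t \<in> hist t \<rightarrow>\<^sub>M count_space {..d}"
proof (rule measurableI)
  show "X t \<omega> \<in> space (count_space {..d})" if "\<omega> \<in> space (hist t)" for \<omega>
    using that X_le space_hist by simp
  fix A
  have "{\<omega> \<in> space M. fst (pair \<omega> t) \<in> A} \<in> sets (hist t)" by (rule hist_memI) auto
  moreover have "X t -` A \<inter> space (hist t) = {\<omega> \<in> space M. fst (pair \<omega> t) \<in> A}"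
    using space_hist by auto
  ultimately show "X t -` A \<inter> space (hist t) \<in> sets (hist t)" by (simp only:)
qed

text \<open>The product formula with \<open>X\<close> up to \<open>t + 1\<close> but the dual only
  up to \<open>t\<close> has the same sampling weights as the one with both up to \<open>t\<close>,
  so the past of the dual does not influence the next step of \<open>X\<close>.\<close>

lemma pair_path_X_step:
  assumes y: "y \<le> d"
  shows "\<P>(\<omega> in M. (\<forall>s\<le>t. pair \<omega> s = v s) \<and> X (Suc t) \<omega> = y) =
    P $$ (fst (v t), y) * \<P>(\<omega> in M. \<forall>s\<le>t. pair \<omega> s = v s)"
proof -
  let ?x = "\<lambda>s. if s \<le> t then fst (v s) else y" and ?z = "\<lambda>s. snd (v s)"
  let ?w = "of_bool (?z 0 = 0) * (\<Prod>s<t. dual_step d P \<theta> (?z s) (?x (Suc s)) (?z (Suc s)))"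
  have "\<P>(\<omega> in M. (\<forall>s\<le>t. pair \<omega> s = v s) \<and> X (Suc t) \<omega> = y) =
      \<P>(\<omega> in M. (\<forall>s\<le>Suc t. X s \<omega> = ?x s) \<and> (\<forall>s\<le>t. Z s \<omega> = ?z s))"
    by (rule arg_cong[where f = "measure M"]) (auto simp: le_Suc_eq prod_eq_iff)
  also have "\<dots> = \<P>(\<omega> in M. \<forall>s\<le>Suc t. X s \<omega> = ?x s) * ?w"
    using joint_path_prob[of t "Suc t" ?x ?z] by simp
  also have "\<P>(\<omega> in M. \<forall>s\<le>Suc t. X s \<omega> = ?x s) =
      \<P>(\<omega> in M. (\<forall>s\<le>t. X s \<omega> = ?x s) \<and> X (Suc t) \<omega> = y)"
    by (rule arg_cong[where f = "measure M"]) (auto simp: le_Suc_eq)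
  also have "\<dots> = P $$ (fst (v t), y) * \<P>(\<omega> in M. \<forall>s\<le>t. X s \<omega> = ?x s)"
    using markov_chain_path_step[OF mcX y, of t ?x] by simp
  also have "\<dots> * ?w = P $$ (fst (v t), y) * (\<P>(\<omega> in M. \<forall>s\<le>t. X s \<omega> = ?x s) * ?w)"
    by (simp only: mult.assoc)
  also have "\<P>(\<omega> in M. \<forall>s\<le>t. X s \<omega> = ?x s) * ?w = \<P>(\<omega> in M. (\<forall>s\<le>t. X s \<omega> = ?x s) \<and> (\<forall>s\<le>t. Z s \<omega> = ?z s))"
    using joint_path_prob[of t t ?x ?z] by (simp only: mult.assoc order_refl)
  also have "\<dots> = \<P>(\<omega> in M. \<forall>s\<le>t. pair \<omega> s = v s)"
    by (rule arg_cong[where f = "measure M"]) (auto simp: prod_eq_iff)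
  finally show ?thesis .
qed

lemma X_hist_step:
  assumes y: "y \<le> d" and A: "A \<in> sets (hist t)"
  shows "prob (A \<inter> {\<omega> \<in> space M. X (Suc t) \<omega> = y}) =
    (\<Sum>x\<le>d. P $$ (x, y) * prob (A \<inter> {\<omega> \<in> space M. X t \<omega> = x}))"
proof -
  obtain Q where Q: "\<And>f g. (\<And>s. s \<le> t \<Longrightarrow> f s = g s) \<Longrightarrow> Q f \<longleftrightarrow> Q g" and AQ: "A = {\<omega> \<in> space M. Q (pair \<omega>)}"
    using A by (rule hist_memE) blast
  have in1: "A \<inter> {\<omega> \<in> space M. R \<omega>} = {\<omega> \<in> space M. Q (pair \<omega>) \<and> R \<omega>}" for R using AQ by auto
  have step: "\<P>(\<omega> in M. (Q (pair \<omega>) \<and> fst (pair \<omega> t) = x) \<and> X (Suc t) \<omega> = y) =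
      P $$ (x, y) * \<P>(\<omega> in M. (Q (pair \<omega>) \<and> fst (pair \<omega> t) = x) \<and> True)" for x
  proof (rule path_event_scale[of "{..d} \<times> {..d}" "\<lambda>s \<omega>. pair \<omega> s" t "\<lambda>f. Q f \<and> fst (f t) = x"
        "\<lambda>\<omega>. X (Suc t) \<omega> = y" "\<lambda>_. True"], goal_cases)
    case (4 f g)
    then have "Q f \<longleftrightarrow> Q g" by (intro Q)
    then show ?case using 4[of t] by simp
  next
    case 5
    show ?case by (rule bounded_nat_measurable(3)[OF Xm])
  next
    case (7 v)
    then show ?case using pair_path_X_step[OF y, of t v] by simp
  qed (rule pair_finite sets.top | simp)+
  have Apred: "{\<omega> \<in> space M. Q (pair \<omega>) \<and> X (Suc t) \<omega> = y} \<in> events"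
    using hist_event[OF A] unfolding in1[symmetric] by (rule sets.Int) (rule bounded_nat_measurable(3)[OF Xm])
  have "\<P>(\<omega> in M. Q (pair \<omega>) \<and> X (Suc t) \<omega> = y) =
      (\<Sum>x\<le>d. \<P>(\<omega> in M. (Q (pair \<omega>) \<and> X (Suc t) \<omega> = y) \<and> X t \<omega> = x))"
    by (rule prob_sum_values[of "X t" d "\<lambda>\<omega>. Q (pair \<omega>) \<and> X (Suc t) \<omega> = y"])
      (use X_le Apred bounded_nat_measurable(3)[OF Xm] in simp_all)
  also have "\<dots> = (\<Sum>x\<le>d. P $$ (x, y) * \<P>(\<omega> in M. Q (pair \<omega>) \<and> X t \<omega> = x))"
  proof (rule sum.cong[OF refl])
    fix x
    have "{\<omega> \<in> space M. (Q (pair \<omega>) \<and> X (Suc t) \<omega> = y) \<and> X t \<omega> = x} =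
        {\<omega> \<in> space M. (Q (pair \<omega>) \<and> fst (pair \<omega> t) = x) \<and> X (Suc t) \<omega> = y}" by auto
    moreover have "{\<omega> \<in> space M. Q (pair \<omega>) \<and> X t \<omega> = x} =
        {\<omega> \<in> space M. (Q (pair \<omega>) \<and> fst (pair \<omega> t) = x) \<and> True}" by auto
    ultimately show "\<P>(\<omega> in M. (Q (pair \<omega>) \<and> X (Suc t) \<omega> = y) \<and> X t \<omega> = x) =
        P $$ (x, y) * \<P>(\<omega> in M. Q (pair \<omega>) \<and> X t \<omega> = x)"
      using step[of x] by (simp only:)
  qed
  finally show ?thesis unfolding in1 .
qed

lemma X_markov_wrt_hist: "markov_chain_wrt M hist d P X"
  unfolding markov_chain_wrt_def
proof (intro conjI allI impI)
  fix t y assume y: "y \<le> d"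
  show "AE \<omega> in M. real_cond_exp M (hist t) (indicat_real {\<omega> \<in> space M. X (Suc t) \<omega> = y}) \<omega> = P $$ (X t \<omega>, y)"
    using real_cond_exp_indicator_iff[OF hist_subalgebra[of t] X_hist_measurable[of t]
        bounded_nat_measurable(3)[OF Xm[of "Suc t"], of y], of "\<lambda>x. P $$ (x, y)"] X_hist_step[OF y] by blast
qed (rule hist_filtration hist_subalgebra X_hist_measurable)+

sublocale birth: pure_birth_chain M d \<theta> Z
  by standard (use Z_markov Z0 thlt theta_nonneg in auto)

abbreviation T :: "'a \<Rightarrow> enat" where "T \<equiv> hitting_time Z d"

lemma T_measurable [measurable]: "T \<in> M \<rightarrow>\<^sub>M count_space UNIV"
  unfolding hitting_time_path[abs_def] by (rule birth.hit_measurable)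

lemma T_finite: "AE \<omega> in M. \<exists>m. T \<omega> = enat m"
  unfolding hitting_time_path by (rule birth.hit_finite_AE) simp

text \<open>The event \<open>T = m\<close> is a history event of the dual with state
  \<open>d\<close> at time \<open>m\<close>, so the last row of the link is the conditional law of
  \<open>X\<close>.\<close>

lemma T_joint:
  assumes "j \<le> d"
  shows "\<P>(\<omega> in M. T \<omega> = enat m \<and> X m \<omega> = j) = link d P \<theta> $$ (d, j) * \<P>(\<omega> in M. T \<omega> = enat m)"
proof -
  let ?Q = "\<lambda>f. \<forall>s<m. f s \<noteq> d"
  have T: "T \<omega> = enat m \<longleftrightarrow> ?Q (\<lambda>s. Z s \<omega>) \<and> Z m \<omega> = d" for \<omega>
    by (auto simp: hitting_time_path path_hit_eq_enat)
  show ?thesis unfolding T using Z_history_link[OF assms, of m ?Q d] by simp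
qed

text \<open>Summed over the values of \<open>T\<close>. Taking \<open>B\<close> to be everything
  gives the law of the stopped chain; general \<open>B\<close> gives its independence of
  \<open>T\<close>.\<close>

lemma T_law:
  "\<P>(\<omega> in M. T \<omega> \<in> B \<and> X (the_enat (T \<omega>)) \<omega> \<in> A) =
    (\<Sum>j\<in>{..d} \<inter> A. link d P \<theta> $$ (d, j)) * \<P>(\<omega> in M. T \<omega> \<in> B)"
proof -
  let ?p = "\<Sum>j\<in>{..d} \<inter> A. link d P \<theta> $$ (d, j)"
  let ?Y = "\<lambda>\<omega>. X (the_enat (T \<omega>)) \<omega>"
  have Y [measurable]: "?Y \<in> M \<rightarrow>\<^sub>M count_space UNIV"
    by (rule measurable_compose_countable[of "\<lambda>i. X (the_enat i)" M "count_space UNIV" T]) measurable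
  have XA: "\<P>(\<omega> in M. T \<omega> = enat m \<and> X m \<omega> \<in> A) = ?p * \<P>(\<omega> in M. T \<omega> = enat m)" for m
  proof -
    have "{\<omega> \<in> space M. T \<omega> = enat m \<and> X m \<omega> \<in> A} = (\<Union>j\<in>{..d} \<inter> A. {\<omega> \<in> space M. T \<omega> = enat m \<and> X m \<omega> = j})"
      using X_le by auto
    then have "\<P>(\<omega> in M. T \<omega> = enat m \<and> X m \<omega> \<in> A) = (\<Sum>j\<in>{..d} \<inter> A. \<P>(\<omega> in M. T \<omega> = enat m \<and> X m \<omega> = j))"
      by (simp only:) (rule finite_measure_finite_Union, auto simp: disjoint_family_on_def)
    also have "\<dots> = (\<Sum>j\<in>{..d} \<inter> A. link d P \<theta> $$ (d, j) * \<P>(\<omega> in M. T \<omega> = enat m))"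
      by (intro sum.cong refl T_joint) simp
    finally show ?thesis by (simp add: sum_distrib_right)
  qed
  have 1: "(\<lambda>m. \<P>(\<omega> in M. (T \<omega> \<in> B \<and> ?Y \<omega> \<in> A) \<and> T \<omega> = enat m)) sums \<P>(\<omega> in M. T \<omega> \<in> B \<and> ?Y \<omega> \<in> A)"
    using T_finite by (intro prob_sums_enat[where g = "\<lambda>n. n"]) simp_all
  have "(\<lambda>m. \<P>(\<omega> in M. T \<omega> \<in> B \<and> T \<omega> = enat m)) sums \<P>(\<omega> in M. T \<omega> \<in> B)"
    using T_finite by (intro prob_sums_enat[where g = "\<lambda>n. n"]) simp_all
  then have 2: "(\<lambda>m. ?p * \<P>(\<omega> in M. T \<omega> \<in> B \<and> T \<omega> = enat m)) sums (?p * \<P>(\<omega> in M. T \<omega> \<in> B))"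
    by (rule sums_mult)
  have "\<P>(\<omega> in M. (T \<omega> \<in> B \<and> ?Y \<omega> \<in> A) \<and> T \<omega> = enat m) = ?p * \<P>(\<omega> in M. T \<omega> \<in> B \<and> T \<omega> = enat m)" for m
  proof (cases "enat m \<in> B")
    case True
    have "{\<omega> \<in> space M. (T \<omega> \<in> B \<and> ?Y \<omega> \<in> A) \<and> T \<omega> = enat m} = {\<omega> \<in> space M. T \<omega> = enat m \<and> X m \<omega> \<in> A}"
      "{\<omega> \<in> space M. T \<omega> \<in> B \<and> T \<omega> = enat m} = {\<omega> \<in> space M. T \<omega> = enat m}"
      using True by auto
    then show ?thesis using XA[of m] by (simp only:)
  next
    case False
    then have "{\<omega> \<in> space M. (T \<omega> \<in> B \<and> ?Y \<omega> \<in> A) \<and> T \<omega> = enat m} = {}"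
      "{\<omega> \<in> space M. T \<omega> \<in> B \<and> T \<omega> = enat m} = {}"
      by auto
    then show ?thesis by (simp only: measure_empty mult_zero_right)
  qed
  with 1 2 show ?thesis by (simp add: sums_unique2)
qed

lemma T_strong_stationary:
  assumes st: "stationary_distribution d P \<pi>"
  shows "strong_stationary_time M d P \<pi> X T"
proof -
  let ?Y = "\<lambda>\<omega>. X (the_enat (T \<omega>)) \<omega>"
  have Y [measurable]: "?Y \<in> M \<rightarrow>\<^sub>M count_space UNIV"
    by (rule measurable_compose_countable[of "\<lambda>i. X (the_enat i)" M "count_space UNIV" T]) measurable
  have Ylaw: "\<P>(\<omega> in M. ?Y \<omega> \<in> A) = (\<Sum>j\<in>{..d} \<inter> A. link d P \<theta> $$ (d, j))" for A
    using T_law[of UNIV A] by (simp add: prob_space)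
  have pr: "Measurable.pred (hist t) (\<lambda>\<omega>. T \<omega> \<le> enat t)" for t
  proof -
    have "{\<omega> \<in> space M. \<exists>s\<le>t. snd (pair \<omega> s) = d} \<in> sets (hist t)" by (rule hist_memI) auto
    moreover have "{\<omega> \<in> space (hist t). T \<omega> \<le> enat t} = {\<omega> \<in> space M. \<exists>s\<le>t. snd (pair \<omega> s) = d}"
      unfolding space_hist hitting_time_path path_hit_le_iff snd_conv ..
    ultimately show ?thesis unfolding pred_def by (simp only:)
  qed
  have "indep_var (count_space UNIV) (\<lambda>\<omega>. enat (?Y \<omega>)) (count_space UNIV) T"
  proof (rule indep_var_count_spaceI[OF _ T_measurable])
    show "(\<lambda>\<omega>. enat (?Y \<omega>)) \<in> M \<rightarrow>\<^sub>M count_space UNIV" by measurable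
    show "\<P>(\<omega> in M. T \<omega> \<in> B \<and> enat (?Y \<omega>) \<in> A) = \<P>(\<omega> in M. enat (?Y \<omega>) \<in> A) * \<P>(\<omega> in M. T \<omega> \<in> B)" for A B
      using T_law[of B "enat -` A"] Ylaw[of "enat -` A"] by (simp only: vimage_eq)
  qed
  moreover have "\<P>(\<omega> in M. ?Y \<omega> = j) = \<pi> j" if "j \<le> d" for j
    using Ylaw[of "{j}"] that stationary_eq_link[OF st that] by simp
  moreover have "AE \<omega> in M. T \<omega> < \<infinity>" using T_finite by eventually_elim auto
  ultimately show ?thesis
    unfolding strong_stationary_time_def using X_markov_wrt_hist pr by blast
qed

lemma T_tail:
  "link d P \<theta> $$ (d, d) * \<P>(\<omega> in M. T \<omega> \<le> enat t) = chain_law d P t d"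
proof -
  \<comment> \<open>A nondecreasing path that has reached the top state \<open>d\<close> stays
    there.\<close>
  have "\<P>(\<omega> in M. T \<omega> \<le> enat t) = \<P>(\<omega> in M. Z t \<omega> = d)"
  proof (rule finite_measure_eq_AE)
    show "AE \<omega> in M. \<omega> \<in> {\<omega> \<in> space M. T \<omega> \<le> enat t} \<longleftrightarrow> \<omega> \<in> {\<omega> \<in> space M. Z t \<omega> = d}"
      using birth.birth_path_AE AE_space
    proof eventually_elim
      case (elim \<omega>)
      have "Z t \<omega> = d" if "s \<le> t" "Z s \<omega> = d" for s
        using birth_path_mono[OF elim(1) that(1)] that(2) Z_le[OF elim(2), of t] by simp
      then show ?case by (auto simp: hitting_time_path path_hit_le_iff)
    qed
  qed measurable
  then have "link d P \<theta> $$ (d, d) * \<P>(\<omega> in M. T \<omega> \<le> enat t) = link d P \<theta> $$ (d, d) * \<P>(\<omega> in M. Z t \<omega> = d)"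
    by (rule arg_cong)
  also have "\<dots> = (\<Sum>k\<le>d. if k = d then link d P \<theta> $$ (k, d) * \<P>(\<omega> in M. Z t \<omega> = k) else 0)"
    by (subst sum.delta) simp_all
  also have "\<dots> = (\<Sum>k\<le>d. \<P>(\<omega> in M. X t \<omega> = d \<and> Z t \<omega> = k))"
  proof (rule sum.cong[OF refl])
    fix k assume "k \<in> {..d}"
    have "{\<omega> \<in> space M. X t \<omega> = d \<and> Z t \<omega> = k} = {\<omega> \<in> space M. (True \<and> Z t \<omega> = k) \<and> X t \<omega> = d}"
      "{\<omega> \<in> space M. Z t \<omega> = k} = {\<omega> \<in> space M. (True \<and> Z t \<omega> = k) \<and> True}" by auto
    then have "\<P>(\<omega> in M. X t \<omega> = d \<and> Z t \<omega> = k) = link d P \<theta> $$ (k, d) * \<P>(\<omega> in M. Z t \<omega> = k)"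
      using Z_history_link[of d t "\<lambda>_. True" k] by (simp only: order_refl)
    then show "(if k = d then link d P \<theta> $$ (k, d) * \<P>(\<omega> in M. Z t \<omega> = k) else 0) =
        \<P>(\<omega> in M. X t \<omega> = d \<and> Z t \<omega> = k)"
      using \<open>k \<in> {..d}\<close> link_eq_0[of k d] by (cases "k = d") simp_all
  qed
  also have "\<dots> = \<P>(\<omega> in M. X t \<omega> = d)"
    by (rule prob_sum_values[of "Z t" d "\<lambda>\<omega>. X t \<omega> = d", symmetric]) (use Z_le in simp, measurable)
  also have "\<dots> = chain_law d P t d"
    by (rule markov_chain_wrt_law[OF X_markov_wrt_hist X0]) simp
  finally show ?thesis .
qed

lemma T_fastest:
  assumes st: "stationary_distribution d P \<pi>"
  shows "fastest_strong_stationary_time TYPE('b) M d P \<pi> X T"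
  unfolding fastest_strong_stationary_time_def
proof (intro conjI allI impI T_strong_stationary[OF st])
  fix M' :: "'b measure" and X' T' t
  assume *: "prob_space M' \<and> (AE \<omega> in M'. X' 0 \<omega> = 0) \<and> strong_stationary_time M' d P \<pi> X' T'"
  interpret M': prob_space M' using * by simp
  have inv: "(\<Sum>x\<le>d. \<pi> x * P $$ (x, y)) = \<pi> y" if "y \<le> d" for y
    using st that by (simp add: stationary_distribution_def)
  have "\<pi> d * M'.prob {\<omega> \<in> space M'. T' \<omega> \<le> enat t} \<le> chain_law d P t d"
    using * inv by (intro M'.strong_stationary_time_bound[of d P \<pi> X' T' d t]) auto
  then have "\<pi> d * M'.prob {\<omega> \<in> space M'. T' \<omega> \<le> enat t} \<le> \<pi> d * \<P>(\<omega> in M. T \<omega> \<le> enat t)"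
    using T_tail[of t] stationary_eq_link[OF st, of d] by simp
  \<comment> \<open>The factor \<open>\<pi> d\<close> cancels, being the positive corner entry of
    the link.\<close>
  then have le: "M'.prob {\<omega> \<in> space M'. T' \<omega> \<le> enat t} \<le> \<P>(\<omega> in M. T \<omega> \<le> enat t)"
    using link_last_last_pos stationary_eq_link[OF st, of d] by simp
  have [measurable]: "T' \<in> M' \<rightarrow>\<^sub>M count_space UNIV"
    using * M'.indep_var_rv2 by (auto simp: strong_stationary_time_def)
  have "\<P>(\<omega> in M. enat t < T \<omega>) = 1 - \<P>(\<omega> in M. T \<omega> \<le> enat t)"
    by (subst prob_neg[symmetric]) (simp_all add: not_le)
  moreover have "\<P>(\<omega> in M'. enat t < T' \<omega>) = 1 - \<P>(\<omega> in M'. T' \<omega> \<le> enat t)"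
    by (subst M'.prob_neg[symmetric]) (simp_all add: not_le)
  ultimately show "\<P>(\<omega> in M. enat t < T \<omega>) \<le> \<P>(\<omega> in M'. enat t < T' \<omega>)" using le by simp
qed

end

section \<open>The construction from uniform seeds\<close>

context birth_death_spectrum
begin

lemma birth_prob_bounds:
  assumes "k < d" "y \<le> d"
  shows "0 \<le> birth_prob d P \<theta> k y" "birth_prob d P \<theta> k y \<le> 1"
proof -
  have nn: "0 \<le> \<theta> k * link d P \<theta> $$ (k, y)" "0 \<le> (1 - \<theta> k) * link d P \<theta> $$ (Suc k, y)"
    using assms by (auto intro!: mult_nonneg_nonneg link_nonneg theta_nonneg theta_le_1)
  show "0 \<le> birth_prob d P \<theta> k y" unfolding birth_prob_def using nn by (intro divide_nonneg_nonneg) auto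
  show "birth_prob d P \<theta> k y \<le> 1" unfolding birth_prob_def using nn by (intro divide_le_eq_1[THEN iffD2]) auto
qed

end

definition seed_step :: "nat \<Rightarrow> real mat \<Rightarrow> (nat \<Rightarrow> real) \<Rightarrow> nat \<Rightarrow> nat \<Rightarrow> real \<Rightarrow> nat" where
  "seed_step d P \<theta> k y u =
     (if k = d then d else if y \<le> k then (if u < birth_prob d P \<theta> k y then Suc k else k) else Suc k)"

lemma dual_path_Suc:
  "dual_path d P \<theta> X U (Suc t) \<omega> = seed_step d P \<theta> (dual_path d P \<theta> X U t \<omega>) (X (Suc t) \<omega>) (U (Suc t) \<omega>)"
  by (simp add: seed_step_def Let_def)

text \<open>Putting the prescribed values \<open>z\<close> into the recursion decouples it into one
  condition on each seed, to which independence of the seeds applies.\<close>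

lemma dual_path_eq_iff:
  "(\<forall>s\<le>t. dual_path d P \<theta> X U s \<omega> = z s) \<longleftrightarrow>
     z 0 = 0 \<and> (\<forall>s<t. seed_step d P \<theta> (z s) (X (Suc s) \<omega>) (U (Suc s) \<omega>) = z (Suc s))"
proof (induction t)
  case 0
  show ?case by auto
next
  case (Suc t)
  have "(\<forall>s\<le>Suc t. dual_path d P \<theta> X U s \<omega> = z s) \<longleftrightarrow>
      (\<forall>s\<le>t. dual_path d P \<theta> X U s \<omega> = z s) \<and> dual_path d P \<theta> X U (Suc t) \<omega> = z (Suc t)"
    by (auto simp: le_Suc_eq simp del: dual_path.simps)
  also have "\<dots> \<longleftrightarrow> (\<forall>s\<le>t. dual_path d P \<theta> X U s \<omega> = z s) \<and>
      seed_step d P \<theta> (z t) (X (Suc t) \<omega>) (U (Suc t) \<omega>) = z (Suc t)"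
    unfolding dual_path_Suc by auto
  finally show ?case unfolding Suc.IH by (auto simp: less_Suc_eq)
qed

lemma seed_step_sets: "{u. seed_step d P \<theta> k y u = l} \<in> sets borel"
proof -
  have "(\<lambda>u. seed_step d P \<theta> k y u) \<in> borel \<rightarrow>\<^sub>M count_space UNIV"
    unfolding seed_step_def by measurable
  then have "(\<lambda>u. seed_step d P \<theta> k y u) -` {l} \<inter> space borel \<in> sets borel"
    by (rule measurable_sets) simp
  then show ?thesis by (simp add: vimage_def)
qed

context prob_space
begin

lemma uniform_seed_less:
  assumes Ut: "random_variable borel V" and D: "distr M borel V = uniform_measure lborel {0..1}"
    and b: "0 \<le> b" "b \<le> (1::real)"
  shows "\<P>(\<omega> in M. V \<omega> < b) = b"
proof -
  have "\<P>(\<omega> in M. V \<omega> < b) = measure (distr M borel V) {..<b}"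
    using Ut by (subst measure_distr) (auto intro: arg_cong[where f = "measure M"])
  also have "\<dots> = measure lborel ({0..1} \<inter> {..<b}) / measure lborel {0..1::real}"
    unfolding D by (subst measure_uniform_measure) auto
  also have "{0..1} \<inter> {..<b} = {0..<b}" using b by auto
  finally show ?thesis using b by simp
qed

lemma uniform_seeds_path_prob:
  assumes us: "uniform_seeds M X U" and B: "\<And>s. B s \<in> sets borel"
  shows "\<P>(\<omega> in M. (\<forall>s\<le>n. X s \<omega> = x s) \<and> (\<forall>s<m. U (Suc s) \<omega> \<in> B s)) =
    \<P>(\<omega> in M. \<forall>s\<le>n. X s \<omega> = x s) * (\<Prod>s<m. \<P>(\<omega> in M. U (Suc s) \<omega> \<in> B s))"
proof -
  have ind: "indep_vars (\<lambda>_. borel) U UNIV" using us by (simp add: uniform_seeds_def)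
  \<comment> \<open>Both variables of \<open>indep_var\<close> must have the same type, so the
    states of \<open>X\<close> appear as reals.\<close>
  have ind2: "indep_var (\<Pi>\<^sub>M t\<in>UNIV. count_space UNIV) (\<lambda>\<omega> t. real (X t \<omega>)) (\<Pi>\<^sub>M t\<in>UNIV. borel) (\<lambda>\<omega> t. U t \<omega>)"
    using us by (simp add: uniform_seeds_def)
  let ?Xa = "{f \<in> space (\<Pi>\<^sub>M t\<in>(UNIV::nat set). count_space (UNIV::real set)). \<forall>s\<le>n. f s = real (x s)}"
  let ?Xb = "{g \<in> space (\<Pi>\<^sub>M t\<in>(UNIV::nat set). (borel :: real measure)). \<forall>s<m. g (Suc s) \<in> B s}"
  have Xa: "?Xa \<in> sets (\<Pi>\<^sub>M t\<in>UNIV. count_space UNIV)" by measurable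
  have Xb: "?Xb \<in> sets (\<Pi>\<^sub>M t\<in>UNIV. borel)" using B by measurable
  have "prob ((\<lambda>\<omega>. ((\<lambda>t. real (X t \<omega>)), (\<lambda>t. U t \<omega>))) -` (?Xa \<times> ?Xb) \<inter> space M) =
      prob ((\<lambda>\<omega> t. real (X t \<omega>)) -` ?Xa \<inter> space M) * prob ((\<lambda>\<omega> t. U t \<omega>) -` ?Xb \<inter> space M)"
    by (rule indep_varD[OF ind2 Xa Xb])
  moreover have "(\<lambda>\<omega>. ((\<lambda>t. real (X t \<omega>)), (\<lambda>t. U t \<omega>))) -` (?Xa \<times> ?Xb) \<inter> space M =
      {\<omega> \<in> space M. (\<forall>s\<le>n. X s \<omega> = x s) \<and> (\<forall>s<m. U (Suc s) \<omega> \<in> B s)}"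
    by (auto simp: space_PiM)
  moreover have "(\<lambda>\<omega> t. real (X t \<omega>)) -` ?Xa \<inter> space M = {\<omega> \<in> space M. \<forall>s\<le>n. X s \<omega> = x s}"
    by (auto simp: space_PiM)
  moreover have "(\<lambda>\<omega> t. U t \<omega>) -` ?Xb \<inter> space M = {\<omega> \<in> space M. \<forall>s<m. U (Suc s) \<omega> \<in> B s}"
    by (auto simp: space_PiM)
  ultimately have 1: "\<P>(\<omega> in M. (\<forall>s\<le>n. X s \<omega> = x s) \<and> (\<forall>s<m. U (Suc s) \<omega> \<in> B s)) =
      \<P>(\<omega> in M. \<forall>s\<le>n. X s \<omega> = x s) * \<P>(\<omega> in M. \<forall>s<m. U (Suc s) \<omega> \<in> B s)"
    by (simp only:)
  have "\<P>(\<omega> in M. \<forall>s<m. U (Suc s) \<omega> \<in> B s) = (\<Prod>s<m. \<P>(\<omega> in M. U (Suc s) \<omega> \<in> B s))"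
  proof (cases "m = 0")
    case False
    have "prob (\<Inter>i\<in>Suc ` {..<m}. U i -` B (i - 1) \<inter> space M) =
        (\<Prod>i\<in>Suc ` {..<m}. prob (U i -` B (i - 1) \<inter> space M))"
      using False B by (intro indep_varsD[OF ind]) (auto simp: lessThan_empty_iff)
    moreover have "(\<Inter>i\<in>Suc ` {..<m}. U i -` B (i - 1) \<inter> space M) = {\<omega> \<in> space M. \<forall>s<m. U (Suc s) \<omega> \<in> B s}"
      using False by auto
    moreover have "(\<Prod>i\<in>Suc ` {..<m}. prob (U i -` B (i - 1) \<inter> space M)) = (\<Prod>s<m. \<P>(\<omega> in M. U (Suc s) \<omega> \<in> B s))"
      by (subst prod.reindex) (auto intro!: prod.cong arg_cong[where f = "measure M"])
    ultimately show ?thesis by (simp only:)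
  qed (simp add: prob_space)
  with 1 show ?thesis by (simp only:)
qed

end

lemma (in birth_death_spectrum) uniform_seeds_dual_construction:
  fixes M :: "'a measure"
  assumes "prob_space M" and mcX: "markov_chain M d P X" and us: "uniform_seeds M X U"
  shows "dual_construction M d P \<theta> X (dual_path d P \<theta> X U)"
proof -
  interpret prob_space M by fact
  let ?Z = "dual_path d P \<theta> X U"
  have Xm: "X t \<in> M \<rightarrow>\<^sub>M count_space {..d}" for t using mcX by (simp add: markov_chain_def)
  note [measurable] = bounded_nat_measurable(1)[OF Xm]
  have U [measurable]: "U t \<in> borel_measurable M" for t
    using us by (auto simp: uniform_seeds_def indep_vars_def)
  have Zle: "?Z t \<omega> \<le> d" for t \<omega>
    by (induction t) (auto simp: dual_path_Suc seed_step_def simp del: dual_path.simps(2))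
  have Zmeas: "?Z t \<in> M \<rightarrow>\<^sub>M count_space UNIV" for t
  proof (induction t)
    case (Suc t)
    have "(\<lambda>\<omega>. seed_step d P \<theta> k y (U (Suc t) \<omega>)) \<in> M \<rightarrow>\<^sub>M count_space UNIV" for k y
      unfolding seed_step_def by measurable
    then have "(\<lambda>\<omega>. seed_step d P \<theta> k (X (Suc t) \<omega>) (U (Suc t) \<omega>)) \<in> M \<rightarrow>\<^sub>M count_space UNIV" for k
      by (rule measurable_compose_countable[where f = "\<lambda>y \<omega>. seed_step d P \<theta> k y (U (Suc t) \<omega>)"]) measurable
    then have "(\<lambda>\<omega>. seed_step d P \<theta> (?Z t \<omega>) (X (Suc t) \<omega>) (U (Suc t) \<omega>)) \<in> M \<rightarrow>\<^sub>M count_space UNIV"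
      by (rule measurable_compose_countable[where f = "\<lambda>k \<omega>. seed_step d P \<theta> k (X (Suc t) \<omega>) (U (Suc t) \<omega>)"])
        (rule Suc.IH)
    then show ?case unfolding dual_path_Suc[abs_def, symmetric] .
  qed simp
  have Zm: "?Z t \<in> M \<rightarrow>\<^sub>M count_space {..d}" for t
  proof (rule measurableI)
    fix A
    show "?Z t -` A \<inter> space M \<in> events" by (rule measurable_sets[OF Zmeas]) simp
  qed (use Zle in simp)
  \<comment> \<open>Given the path of \<open>X\<close> and the past of the dual, the next dual state
    is a function of seed \<open>t + 1\<close> alone, and the factors of the earlier seeds cancel in
    the quotient.\<close>
  have cond: "\<P>(\<omega> in M. ?Z (Suc t) \<omega> = k \<bar> (\<forall>s\<le>n. X s \<omega> = x s) \<and> (\<forall>s\<le>t. ?Z s \<omega> = z s)) =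
      \<P>(\<omega> in M. seed_step d P \<theta> (z t) (x (Suc t)) (U (Suc t) \<omega>) = k)"
    if tn: "Suc t \<le> n" and pos: "0 < \<P>(\<omega> in M. (\<forall>s\<le>n. X s \<omega> = x s) \<and> (\<forall>s\<le>t. ?Z s \<omega> = z s))" for t n x z k
  proof -
    let ?z = "z(Suc t := k)"
    define B where "B z s = {u. seed_step d P \<theta> (z s) (x (Suc s)) u = z (Suc s)}" for z s
    have Bs: "B z s \<in> sets borel" for z s unfolding B_def by (rule seed_step_sets)
    have ev: "{\<omega> \<in> space M. (\<forall>s\<le>n. X s \<omega> = x s) \<and> (\<forall>s\<le>m. ?Z s \<omega> = z s)} =
        {\<omega> \<in> space M. (\<forall>s\<le>n. X s \<omega> = x s) \<and> (\<forall>s<m. U (Suc s) \<omega> \<in> B z s)}" if "m \<le> n" "z 0 = 0" for m z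
      unfolding dual_path_eq_iff B_def using that by auto
    have z0: "z 0 = 0" using pos by (rule prob_pos_witness) auto
    have "{\<omega> \<in> space M. ?Z (Suc t) \<omega> = k \<and> (\<forall>s\<le>n. X s \<omega> = x s) \<and> (\<forall>s\<le>t. ?Z s \<omega> = z s)} =
        {\<omega> \<in> space M. (\<forall>s\<le>n. X s \<omega> = x s) \<and> (\<forall>s\<le>Suc t. ?Z s \<omega> = ?z s)}"
      by (auto simp: le_Suc_eq simp del: dual_path.simps)
    then have "\<P>(\<omega> in M. ?Z (Suc t) \<omega> = k \<and> (\<forall>s\<le>n. X s \<omega> = x s) \<and> (\<forall>s\<le>t. ?Z s \<omega> = z s)) =
        \<P>(\<omega> in M. \<forall>s\<le>n. X s \<omega> = x s) * (\<Prod>s<Suc t. \<P>(\<omega> in M. U (Suc s) \<omega> \<in> B ?z s))"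
      using ev[of "Suc t" ?z] uniform_seeds_path_prob[OF us, of "B ?z" n x "Suc t", OF Bs] tn z0
      by (simp only:) simp
    also have "(\<Prod>s<Suc t. \<P>(\<omega> in M. U (Suc s) \<omega> \<in> B ?z s)) =
        (\<Prod>s<t. \<P>(\<omega> in M. U (Suc s) \<omega> \<in> B z s)) * \<P>(\<omega> in M. U (Suc t) \<omega> \<in> B ?z t)"
      unfolding prod.lessThan_Suc by (intro arg_cong2[where f = "(*)"] prod.cong refl) (simp add: B_def)
    also have "\<P>(\<omega> in M. \<forall>s\<le>n. X s \<omega> = x s) * ((\<Prod>s<t. \<P>(\<omega> in M. U (Suc s) \<omega> \<in> B z s)) * \<P>(\<omega> in M. U (Suc t) \<omega> \<in> B ?z t)) =
        \<P>(\<omega> in M. (\<forall>s\<le>n. X s \<omega> = x s) \<and> (\<forall>s\<le>t. ?Z s \<omega> = z s)) * \<P>(\<omega> in M. U (Suc t) \<omega> \<in> B ?z t)"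
      using ev[of t z] uniform_seeds_path_prob[OF us, of "B z" n x t, OF Bs] tn z0
      by (simp only: mult.assoc[symmetric])
    finally show ?thesis using pos by (simp add: cond_prob_def B_def)
  qed
  have less: "\<P>(\<omega> in M. U (Suc t) \<omega> < b) = b" if "0 \<le> b" "b \<le> 1" for t b
    using us that by (intro uniform_seed_less[OF U]) (simp_all add: uniform_seeds_def)
  show ?thesis
    unfolding dual_construction_def Let_def
  proof (intro conjI allI impI)
    fix t n x z
    assume tn: "Suc t \<le> n" and pos: "0 < \<P>(\<omega> in M. (\<forall>s\<le>n. X s \<omega> = x s) \<and> (\<forall>s\<le>t. ?Z s \<omega> = z s))"
    note cond = cond[OF tn pos]
    show "\<P>(\<omega> in M. ?Z (Suc t) \<omega> = d \<bar> (\<forall>s\<le>n. X s \<omega> = x s) \<and> (\<forall>s\<le>t. ?Z s \<omega> = z s)) = 1" if "z t = d"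
      unfolding cond using that by (simp add: seed_step_def prob_space)
    show "\<P>(\<omega> in M. ?Z (Suc t) \<omega> = Suc (z t) \<bar> (\<forall>s\<le>n. X s \<omega> = x s) \<and> (\<forall>s\<le>t. ?Z s \<omega> = z s)) = 1"
      if "z t < d \<and> x (Suc t) = Suc (z t)"
      unfolding cond using that by (simp add: seed_step_def prob_space)
    let ?b = "birth_prob d P \<theta> (z t) (x (Suc t))"
    assume lt: "z t < d \<and> x (Suc t) \<le> z t"
    have b: "0 \<le> ?b" "?b \<le> 1" using birth_prob_bounds[of "z t" "x (Suc t)"] lt by auto
    have eq: "seed_step d P \<theta> (z t) (x (Suc t)) u = Suc (z t) \<longleftrightarrow> u < ?b"
      "seed_step d P \<theta> (z t) (x (Suc t)) u = z t \<longleftrightarrow> \<not> u < ?b" for u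
      using lt by (auto simp: seed_step_def)
    show "\<P>(\<omega> in M. ?Z (Suc t) \<omega> = Suc (z t) \<bar> (\<forall>s\<le>n. X s \<omega> = x s) \<and> (\<forall>s\<le>t. ?Z s \<omega> = z s)) = ?b"
      unfolding cond eq by (rule less[OF b])
    have "\<P>(\<omega> in M. \<not> U (Suc t) \<omega> < ?b) = 1 - \<P>(\<omega> in M. U (Suc t) \<omega> < ?b)"
      by (rule prob_neg) measurable
    then show "\<P>(\<omega> in M. ?Z (Suc t) \<omega> = z t \<bar> (\<forall>s\<le>n. X s \<omega> = x s) \<and> (\<forall>s\<le>t. ?Z s \<omega> = z s)) = 1 - ?b"
      unfolding cond eq using less[OF b] by simp
  qed (use Zm in auto)
qed

section \<open>The strong stationary dual\<close>

text \<open>The properties are stated for every process obeying the sampling rule, and uniform seeds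
  are shown to realize that rule. Pathwise claims hold almost surely, as the start at 0 and the rule
  constrain events only up to null sets.\<close>

theorem mainTheorem6:
  fixes M :: "'a measure" and d :: nat and P :: "real mat" and \<theta> \<pi> :: "nat \<Rightarrow> real"
    and X :: "nat \<Rightarrow> 'a \<Rightarrow> nat"
  assumes "prob_space M"
    and "birth_death_kernel d P" and "ergodic_kernel d P"
    and "stationary_distribution d P \<pi>"
    and "eigenvalue_list d P \<theta>"
    and "0 \<le> \<theta> 0" and "\<forall>i<d. \<theta> i \<le> \<theta> (Suc i)" and "\<forall>i<d. \<theta> i < 1" and "\<theta> d = 1"
    and "markov_chain M d P X" and "AE \<omega> in M. X 0 \<omega> = 0"
  shows
    "(\<forall>U. uniform_seeds M X U \<longrightarrow> dual_construction M d P \<theta> X (dual_path d P \<theta> X U)) \<and>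
     (\<forall>Xh. dual_construction M d P \<theta> X Xh \<longrightarrow>
        (AE \<omega> in M. \<forall>t. 0 < link d P \<theta> $$ (Xh t \<omega>, X t \<omega>) \<and> X t \<omega> \<le> Xh t \<omega>) \<and>
        (AE \<omega> in M. \<forall>t. Xh t \<omega> = d \<or> X (Suc t) \<omega> \<le> Xh t \<omega> \<or> X (Suc t) \<omega> = Suc (Xh t \<omega>)) \<and>
        markov_chain M d (pure_birth_kernel d \<theta>) Xh \<and>
        fastest_strong_stationary_time TYPE('b) M d P \<pi> X (hitting_time Xh d) \<and>
        prob_space.indep_vars M (\<lambda>_. count_space UNIV) (waiting_time Xh) {..<d} \<and>
        (\<forall>k<d. geometric_time M (\<theta> k) (waiting_time Xh k)) \<and>
        (AE \<omega> in M. (\<Sum>k<d. waiting_time Xh k \<omega>) = hitting_time Xh d \<omega>))"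
proof -
  interpret birth_death_spectrum d P \<theta>
    using assms by unfold_locales (auto simp: ergodic_kernel_def)
  show ?thesis
  proof (intro conjI allI impI)
    show "dual_construction M d P \<theta> X (dual_path d P \<theta> X U)" if "uniform_seeds M X U" for U
      using assms(1,10) that by (rule uniform_seeds_dual_construction)
    fix Xh assume dual: "dual_construction M d P \<theta> X Xh"
    interpret M: prob_space M by (rule assms(1))
    interpret D: dual_chain d P \<theta> M X Xh
      using assms(10,11) dual by unfold_locales
    show "AE \<omega> in M. \<forall>t. 0 < link d P \<theta> $$ (Xh t \<omega>, X t \<omega>) \<and> X t \<omega> \<le> Xh t \<omega>"
      by (rule D.link_pos_AE)
    show "AE \<omega> in M. \<forall>t. Xh t \<omega> = d \<or> X (Suc t) \<omega> \<le> Xh t \<omega> \<or> X (Suc t) \<omega> = Suc (Xh t \<omega>)"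
      by (rule D.cases_exhaustive_AE)
    show "markov_chain M d (pure_birth_kernel d \<theta>) Xh" by (rule D.Z_markov)
    show "fastest_strong_stationary_time TYPE('b) M d P \<pi> X (hitting_time Xh d)"
      by (rule D.T_fastest[OF assms(4)])
    show "prob_space.indep_vars M (\<lambda>_. count_space UNIV) (waiting_time Xh) {..<d}"
      by (rule D.birth.waits_indep)
    show "geometric_time M (\<theta> k) (waiting_time Xh k)" if "k < d" for k
      using that by (rule D.birth.wait_geometric)
    show "AE \<omega> in M. (\<Sum>k<d. waiting_time Xh k \<omega>) = hitting_time Xh d \<omega>"
      by (rule D.birth.waits_sum_AE)
  qed
qed

end
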